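(* Let $c_1>0$, $c_2>0$ with $c_1+c_2\le\sqrt2$, let $0<x_L<x_R<\pi$, $N\in\mathbb{N}$ ($N\ge1$), $\rho_x\ge0$, $\rho_u\ge0$ and $\gamma>0$. Consider the Euler--Bernoulli beam $$z_{tt}+z_{xxxx}+c_1z_t+c_2z_{xxxxt}=[\delta'(x-x_L)-\delta'(x-x_R)]u(t)+w(x,t),\quad x\in[0,\pi],\ t\ge0,$$ $$z(0,t)=z_{xx}(0,t)=z(\pi,t)=z_{xx}(\pi,t)=0,$$ with control $u$ and disturbance $w$. For $n\in\mathbb{N}$ let $$\omega_n=n^2,\quad \zeta_n=\tfrac12(c_1\omega_n^{-1}+c_2\omega_n),\quad b_n=n\sqrt{2/\pi}\,(\cos nx_R-\cos nx_L),$$ $$\rho_n=\begin{cases}\dfrac{b_n^2(1+\rho_x\omega_n^2)}{4\omega_n^4\zeta_n^2(1-\zeta_n^2)-(1+\rho_x\omega_n^2)\gamma^{-2}},&2\zeta_n^2\le1,\\[2mm] \dfrac{b_n^2(1+\rho_x\omega_n^2)}{\omega_n^4-(1+\rho_x\omega_n^2)\gamma^{-2}},&2\zeta_n^2>1,\end{cases}$$ $$M=\max\left\{N,\left\lfloor\sqrt{\frac{1+\sqrt{1-2c_1c_2}}{\sqrt2\,c_2}}\right\rfloor\right\},\qquad C_M=\frac{\omega_{M+1}^2(1+\rho_x\omega_{M+1}^2)}{\omega_{M+1}^4-(1+\rho_x\omega_{M+1}^2)\gamma^{-2}},$$ $$\rho_\infty=\sum_{n=N+1}^M\rho_n+C_M\left[|x_R-x_L|-\sum_{n=1}^M\frac{b_n^2}{\omega_n^2}\right].$$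 Let $\Omega_N=\operatorname{diag}\{\omega_1,\dots,\omega_N\}$ and $$A=\begin{bmatrix}0_N & I_N \\ -\Omega_N^2 & -(c_1I_N+c_2\Omega_N^2)\end{bmatrix},\quad B=[0,\dots,0,b_1,\dots,b_N]^\top\in\mathbb{R}^{2N},\quad E=\begin{bmatrix}0_N \\ I_N\end{bmatrix},$$ $$C=\begin{bmatrix}\sqrt{I_N+\rho_x\Omega_N^2} & 0_{N\times N} \\ 0_{1\times N} & 0_{1\times N}\end{bmatrix},\quad D=\begin{bmatrix}0_{N\times1} \\ \sqrt{\rho_u+\rho_\infty}\end{bmatrix},\quad R=D^\top D=\rho_u+\rho_\infty.$$ If a symmetric positive definite $P\in\mathbb{R}^{2N\times2N}$ satisfies $$PA+A^\top P-P(BR^{-1}B^\top-\gamma^{-2}EE^\top)P+C^\top C=0,$$ then the state feedback $$u(t)=-(\rho_u+\rho_\infty)^{-1}B^\top Pz^N(t),\qquad z^N=[z_1,\dots,z_N,\dot z_1,\dots,\dot z_N]^\top,$$ where $z_n(t)=\langle z(\cdot,t),\varphi_n\rangle_{L^2(0,\pi)}$ and $\varphi_n(x)=\sqrt{2/\pi}\sin nx$, guarantees that the $L^2$ gain of the beam is not greater than $\gamma$, that is, $$\int_0^\infty\left[\|z(\cdot,t)\|^2+\rho_x\|z_{xx}(\cdot,t)\|^2+\rho_uu^2(t)-\gamma^2\|w(\cdot,t)\|^2\right]dt\le0$$ for the closed-loop solution with $z(\cdot,0)\equiv0\equiv z_t(\cdot,0)$ and any $w\in H^1_{loc}((0,\infty),H_{BC}^{-4}(0,\pi))\cap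 L^2((0,\infty),L^2(0,\pi))$.
   Context: $\|\cdot\|$ and $\langle\cdot,\cdot\rangle$ are the norm and scalar product of $L^2(0,\pi)$; $\lfloor\cdot\rfloor$ is the integer part. $\delta'(\cdot-\tilde x)\in H^{-2}(0,\pi)$ is the functional $f\mapsto-f'(\tilde x)$ on $H^2(0,\pi)$. $H^2_{BC}$ and $H^4_{BC}$ are the closures in $H^2(0,\pi)$ and $H^4(0,\pi)$, respectively, of all $f\in C^\infty[0,\pi]$ with $f^{(2k)}(0)=0=f^{(2k)}(\pi)$ for all $k\ge0$. $H_{BC}^{-4}(0,\pi)$ is the dual of $H_{BC}^4$ with respect to the pivot space $L^2(0,\pi)$, and $Y$ is the dual of $H^4_{BC}$ with respect to the pivot space $H^2_{BC}$ equipped with the scalar product $\langle f'',g''\rangle$. $H^1_{loc}((0,\infty),\cdot)$ denotes functions belonging to $H^1(K,\cdot)$ for any compact $K\subset(0,\infty)$. The energy space is $X=H^2_{BC}(0,\pi)\times L^2(0,\pi)$ with scalar product $\langle(f_1,g_1),(f_2,g_2)\rangle_X=\langle f_1'',f_2''\rangle+\langle g_1,g_2\rangle$, and $X_{-1}=Y\times H_{BC}^{-4}(0,\pi)$. A solution of the beam equation is a function $z$ such that $\bar z=(z,z_t)\in C([0,\infty),X)\cap C^1([0,\infty),X_{-1})$ and the equation, written as a first-order system in $\bar z$, holds in $X_{-1}$. In particular, $z\in C([0,\infty),H^2_{BC})$ and $z_t\in C([0,\infty),L^2(0,\pi))$. The Fourier coefficients $z_n$ of a solution satisfy $\ddot z_n+2\zeta_n\omega_n\dot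 z_n+\omega_n^2z_n=b_nu+w_n$, where $w_n(t)=\langle w(\cdot,t),\varphi_n\rangle$.
   Formalization: The denominators of ρ_n for N<n≤M and of C_M are assumed positive, i.e. γ exceeds the open-loop gain of every truncated mode; without this the claim fails, since a disturbance w=w_n(t)φ_n excites only mode n while u=0. *)

theory Defs
  imports "HOL-Analysis.Analysis" "Jordan_Normal_Form.Matrix"
begin

section \<open>Sobolev spaces on the interval from 0 to pi\<close>

text \<open>Elements of function spaces are plain functions \<^typ>\<open>real \<Rightarrow> real\<close>; only their values almost
  everywhere on the open interval matter, so all the norms below are seminorms on functions.\<close>

abbreviation Ipi :: "real measure" where
  "Ipi \<equiv> lebesgue_on {0<..<pi}"

definition L2 :: "(real \<Rightarrow> real) set" where
  "L2 = {f. f \<in> borel_measurable Ipi \<and> integrable Ipi (\<lambda>x. (f x)\<^sup>2)}"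

definition ip :: "(real \<Rightarrow> real) \<Rightarrow> (real \<Rightarrow> real) \<Rightarrow> real" where
  "ip f g = integral\<^sup>L Ipi (\<lambda>x. f x * g x)"

definition L2norm :: "(real \<Rightarrow> real) \<Rightarrow> real" where
  "L2norm f = sqrt (ip f f)"

definition smooth :: "(real \<Rightarrow> real) \<Rightarrow> bool" where
  "smooth f \<longleftrightarrow> (\<forall>k x. (deriv ^^ k) f field_differentiable at x)"

definition test_fun :: "real set \<Rightarrow> (real \<Rightarrow> real) \<Rightarrow> bool" where
  "test_fun S \<phi> \<longleftrightarrow> smooth \<phi> \<and> (\<exists>K. compact K \<and> K \<subseteq> S \<and> (\<forall>x. x \<notin> K \<longrightarrow> \<phi> x = 0))"

definition weak_deriv :: "nat \<Rightarrow> (real \<Rightarrow> real) \<Rightarrow> (real \<Rightarrow> real) \<Rightarrow> bool" where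
  "weak_deriv k f g \<longleftrightarrow>
     (\<forall>\<phi>. test_fun {0<..<pi} \<phi> \<longrightarrow> ip f ((deriv ^^ k) \<phi>) = (-1) ^ k * ip g \<phi>)"

definition sobolev :: "nat \<Rightarrow> (real \<Rightarrow> real) set" where
  "sobolev k = {f \<in> L2. \<forall>j\<le>k. \<exists>g\<in>L2. weak_deriv j f g}"

text \<open>The \<open>k\<close>-th weak derivative, determined up to a null set.\<close>

definition wd :: "nat \<Rightarrow> (real \<Rightarrow> real) \<Rightarrow> real \<Rightarrow> real" where
  "wd k f = (SOME g. g \<in> L2 \<and> weak_deriv k f g)"

definition sobolev_norm :: "nat \<Rightarrow> (real \<Rightarrow> real) \<Rightarrow> real" where
  "sobolev_norm k f = sqrt (\<Sum>j\<le>k. (L2norm (wd j f))\<^sup>2)"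

text \<open>Smooth functions on the closed interval are taken as restrictions of smooth functions on the
  real line.\<close>

definition smooth_BC :: "(real \<Rightarrow> real) set" where
  "smooth_BC = {f. smooth f \<and> (\<forall>k. (deriv ^^ (2 * k)) f 0 = 0 \<and> (deriv ^^ (2 * k)) f pi = 0)}"

definition H_BC :: "nat \<Rightarrow> (real \<Rightarrow> real) set" where
  "H_BC k = {f \<in> sobolev k. \<forall>e>0. \<exists>g\<in>smooth_BC. sobolev_norm k (\<lambda>x. f x - g x) < e}"

section \<open>Duals of the fourth-order space\<close>

text \<open>Both \<open>H_BC\<^sup>-\<^sup>4\<close> and \<open>Y\<close> are, as normed spaces, the dual of \<^term>\<open>H_BC 4\<close>; a functional is
  represented by its action on \<^term>\<open>H_BC 4\<close>, its values elsewhere being irrelevant.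
  The two spaces differ in the pivot, that is, in which functional a function is identified with.\<close>

type_synonym functional = "(real \<Rightarrow> real) \<Rightarrow> real"

definition dual4 :: "functional set" where
  "dual4 = {F. (\<forall>f\<in>H_BC 4. \<forall>g\<in>H_BC 4. \<forall>a b. F (\<lambda>x. a * f x + b * g x) = a * F f + b * F g) \<and>
               (\<exists>K. \<forall>f\<in>H_BC 4. \<bar>F f\<bar> \<le> K * sobolev_norm 4 f)}"

definition dual4_norm :: "functional \<Rightarrow> real" where
  "dual4_norm F = (SUP f\<in>{f \<in> H_BC 4. sobolev_norm 4 f \<le> 1}. \<bar>F f\<bar>)"

text \<open>\<open>L\<^sup>2\<close> inside \<open>H_BC\<^sup>-\<^sup>4\<close> (pivot \<open>L\<^sup>2\<close>), and \<^term>\<open>H_BC 2\<close> inside \<open>Y\<close> (pivot \<^term>\<open>H_BC 2\<close>).\<close>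

definition emb_L2 :: "(real \<Rightarrow> real) \<Rightarrow> functional" where
  "emb_L2 h = (\<lambda>f. ip h f)"

definition emb_Y :: "(real \<Rightarrow> real) \<Rightarrow> functional" where
  "emb_Y h = (\<lambda>f. ip (wd 2 h) (wd 2 f))"

text \<open>For \<open>h\<close> in \<^term>\<open>H_BC 2\<close> and \<open>f\<close> in \<^term>\<open>H_BC 4\<close>, integration by parts gives
  \<open>\<langle>h'', f''\<rangle> = \<langle>h, f''''\<rangle>\<close>, and the right-hand side makes sense for all \<open>h\<close> in \<open>L\<^sup>2\<close>.
  This one functional therefore has two roles: read in \<open>Y\<close>, it is the continuous extension of
  \<^const>\<open>emb_Y\<close> from \<^term>\<open>H_BC 2\<close> to \<open>L\<^sup>2\<close>; read in \<open>H_BC\<^sup>-\<^sup>4\<close>, it is the fourth derivative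
  \<open>h_xxxx\<close>, extended continuously from \<^const>\<open>smooth_BC\<close> to \<open>L\<^sup>2\<close>.\<close>

definition dxxxx :: "(real \<Rightarrow> real) \<Rightarrow> functional" where
  "dxxxx h = (\<lambda>f. ip h (wd 4 f))"

definition emb_Y_L2 :: "(real \<Rightarrow> real) \<Rightarrow> functional" where
  "emb_Y_L2 h = (\<lambda>f. ip h (wd 4 f))"

text \<open>Point value of the continuous representative of \<open>f'\<close>.\<close>

definition deriv_at :: "(real \<Rightarrow> real) \<Rightarrow> real \<Rightarrow> real" where
  "deriv_at f x = (THE y. \<exists>g. continuous_on {0..pi} g \<and> weak_deriv 1 f g \<and> y = g x)"

definition delta' :: "real \<Rightarrow> functional" where
  "delta' x = (\<lambda>f. - deriv_at f x)"

section \<open>Curves in normed spaces of functions and functionals\<close>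

text \<open>\<open>L\<^sup>2(S, V)\<close> in the sense of Bochner, for a space \<open>V\<close> of functions with norm \<open>nrm\<close>.\<close>

definition bochner_L2 ::
  "real set \<Rightarrow> ('b \<Rightarrow> real) set \<Rightarrow> (('b \<Rightarrow> real) \<Rightarrow> real) \<Rightarrow> (real \<Rightarrow> 'b \<Rightarrow> real) \<Rightarrow> bool" where
  "bochner_L2 S V nrm F \<longleftrightarrow>
     (\<exists>s. (\<forall>n. simple_function (lebesgue_on S) (s n) \<and> (\<forall>t\<in>S. s n t \<in> V)) \<and>
          (AE t in lebesgue_on S. F t \<in> V \<and>
             (\<lambda>n::nat. nrm (\<lambda>y. s n t y - F t y)) \<longlonglongrightarrow> 0)) \<and>
     integrable (lebesgue_on S) (\<lambda>t. (nrm (F t))\<^sup>2)"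

text \<open>\<open>H\<^sup>1_loc((0,\<infinity>), H_BC\<^sup>-\<^sup>4)\<close>.\<close>

definition H1_loc_dual4 :: "(real \<Rightarrow> functional) \<Rightarrow> bool" where
  "H1_loc_dual4 W \<longleftrightarrow>
     (\<exists>W'. (\<forall>K. compact K \<and> K \<subseteq> {0<..} \<longrightarrow>
               bochner_L2 K dual4 dual4_norm W \<and> bochner_L2 K dual4 dual4_norm W') \<and>
           (\<forall>\<psi>. test_fun {0<..} \<psi> \<longrightarrow>
              (\<forall>f\<in>H_BC 4. integral\<^sup>L (lebesgue_on {0<..}) (\<lambda>t. deriv \<psi> t * W t f)
                         = - integral\<^sup>L (lebesgue_on {0<..}) (\<lambda>t. \<psi> t * W' t f))))"

definition C1_dual4 :: "(real \<Rightarrow> functional) \<Rightarrow> (real \<Rightarrow> functional) \<Rightarrow> bool" where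
  "C1_dual4 F F' \<longleftrightarrow>
     (\<forall>t\<ge>0. F t \<in> dual4 \<and> F' t \<in> dual4 \<and>
        ((\<lambda>s. dual4_norm (\<lambda>f. (F s f - F t f) / (s - t) - F' t f)) \<longlongrightarrow> 0) (at t within {0..}) \<and>
        ((\<lambda>s. dual4_norm (\<lambda>f. F' s f - F' t f)) \<longlongrightarrow> 0) (at t within {0..}))"

definition X_norm :: "(real \<Rightarrow> real) \<Rightarrow> (real \<Rightarrow> real) \<Rightarrow> real" where
  "X_norm f g = sqrt ((L2norm (wd 2 f))\<^sup>2 + (L2norm g)\<^sup>2)"

definition cont_X :: "(real \<Rightarrow> real \<Rightarrow> real) \<Rightarrow> (real \<Rightarrow> real \<Rightarrow> real) \<Rightarrow> bool" where
  "cont_X z v \<longleftrightarrow>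
     (\<forall>t\<ge>0. z t \<in> H_BC 2 \<and> v t \<in> L2 \<and>
        ((\<lambda>s. X_norm (\<lambda>x. z s x - z t x) (\<lambda>x. v s x - v t x)) \<longlongrightarrow> 0) (at t within {0..}))"

section \<open>Solutions of the beam equation\<close>

text \<open>Space-time functions are written with time first: \<open>z t x\<close> is \<open>z(x,t)\<close>.
  The first \<^const>\<open>C1_dual4\<close> clause lives in \<open>Y\<close> and says that \<open>zt\<close> is the derivative of \<open>z\<close>;
  the second lives in \<open>H_BC\<^sup>-\<^sup>4\<close> and produces \<open>ztt\<close>.  Since \<open>w\<close> is defined only up to null sets
  of times, the equation is imposed for almost every \<open>t\<close>.\<close>

definition beam_solution ::
  "real \<Rightarrow> real \<Rightarrow> real \<Rightarrow> real \<Rightarrow> (real \<Rightarrow> real) \<Rightarrow> (real \<Rightarrow> real \<Rightarrow> real) \<Rightarrow>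
   (real \<Rightarrow> real \<Rightarrow> real) \<Rightarrow> (real \<Rightarrow> real \<Rightarrow> real) \<Rightarrow> bool" where
  "beam_solution c1 c2 xL xR u w z zt \<longleftrightarrow>
     cont_X z zt \<and>
     C1_dual4 (\<lambda>t. emb_Y (z t)) (\<lambda>t. emb_Y_L2 (zt t)) \<and>
     (\<exists>ztt. C1_dual4 (\<lambda>t. emb_L2 (zt t)) ztt \<and>
        (AE t in lebesgue_on {0<..}. \<forall>f\<in>H_BC 4.
           ztt t f + dxxxx (z t) f + c1 * emb_L2 (zt t) f + c2 * dxxxx (zt t) f
           = (delta' xL f - delta' xR f) * u t + emb_L2 (w t) f))"

section \<open>Modal data\<close>

definition eigfun :: "nat \<Rightarrow> real \<Rightarrow> real" where
  "eigfun n x = sqrt (2 / pi) * sin (real n * x)"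

definition omega :: "nat \<Rightarrow> real" where
  "omega n = (real n)\<^sup>2"

definition zeta :: "real \<Rightarrow> real \<Rightarrow> nat \<Rightarrow> real" where
  "zeta c1 c2 n = (c1 * inverse (omega n) + c2 * omega n) / 2"

definition bcoef :: "real \<Rightarrow> real \<Rightarrow> nat \<Rightarrow> real" where
  "bcoef xL xR n = real n * sqrt (2 / pi) * (cos (real n * xR) - cos (real n * xL))"

text \<open>\<open>rho_den n\<close> is positive iff \<open>\<gamma>\<close> exceeds the gain of the uncontrolled mode \<open>n\<close> from \<open>w_n\<close> to
  \<open>sqrt (1 + rx * omega n ^ 2) * z_n\<close>.  The Riccati equation for the first \<open>N\<close> modes does not imply
  this for \<open>n > N\<close>.\<close>

definition rho_den :: "real \<Rightarrow> real \<Rightarrow> real \<Rightarrow> real \<Rightarrow> nat \<Rightarrow> real" where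
  "rho_den c1 c2 rx \<gamma> n =
     (if 2 * (zeta c1 c2 n)\<^sup>2 \<le> 1
      then 4 * omega n ^ 4 * (zeta c1 c2 n)\<^sup>2 * (1 - (zeta c1 c2 n)\<^sup>2)
             - (1 + rx * (omega n)\<^sup>2) / \<gamma>\<^sup>2
      else omega n ^ 4 - (1 + rx * (omega n)\<^sup>2) / \<gamma>\<^sup>2)"

definition rho :: "real \<Rightarrow> real \<Rightarrow> real \<Rightarrow> real \<Rightarrow> real \<Rightarrow> real \<Rightarrow> nat \<Rightarrow> real" where
  "rho c1 c2 xL xR rx \<gamma> n =
     (bcoef xL xR n)\<^sup>2 * (1 + rx * (omega n)\<^sup>2) / rho_den c1 c2 rx \<gamma> n"

definition Mcut :: "real \<Rightarrow> real \<Rightarrow> nat \<Rightarrow> nat" where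
  "Mcut c1 c2 N = max N (nat \<lfloor>sqrt ((1 + sqrt (1 - 2 * c1 * c2)) / (sqrt 2 * c2))\<rfloor>)"

definition C_den :: "real \<Rightarrow> real \<Rightarrow> nat \<Rightarrow> real" where
  "C_den rx \<gamma> M = omega (M + 1) ^ 4 - (1 + rx * (omega (M + 1))\<^sup>2) / \<gamma>\<^sup>2"

definition C_M :: "real \<Rightarrow> real \<Rightarrow> nat \<Rightarrow> real" where
  "C_M rx \<gamma> M = (omega (M + 1))\<^sup>2 * (1 + rx * (omega (M + 1))\<^sup>2) / C_den rx \<gamma> M"

definition rho_inf :: "real \<Rightarrow> real \<Rightarrow> real \<Rightarrow> real \<Rightarrow> real \<Rightarrow> real \<Rightarrow> nat \<Rightarrow> real" where
  "rho_inf c1 c2 xL xR rx \<gamma> N =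
     (let M = Mcut c1 c2 N in
      (\<Sum>n=N+1..M. rho c1 c2 xL xR rx \<gamma> n)
      + C_M rx \<gamma> M * (\<bar>xR - xL\<bar> - (\<Sum>n=1..M. (bcoef xL xR n)\<^sup>2 / (omega n)\<^sup>2)))"

section \<open>Finite-dimensional data\<close>

text \<open>Matrix and vector indices start at 0, so position \<open>i\<close> belongs to mode \<open>i + 1\<close>.\<close>

definition Omega_mat :: "nat \<Rightarrow> real mat" where
  "Omega_mat N = mat_diag N (\<lambda>i. omega (i + 1))"

definition A_mat :: "real \<Rightarrow> real \<Rightarrow> nat \<Rightarrow> real mat" where
  "A_mat c1 c2 N =
     four_block_mat (0\<^sub>m N N) (1\<^sub>m N)
       (- (Omega_mat N * Omega_mat N))
       (- (c1 \<cdot>\<^sub>m 1\<^sub>m N + c2 \<cdot>\<^sub>m (Omega_mat N * Omega_mat N)))"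

definition B_mat :: "real \<Rightarrow> real \<Rightarrow> nat \<Rightarrow> real mat" where
  "B_mat xL xR N = 0\<^sub>m N 1 @\<^sub>r Matrix.mat N 1 (\<lambda>(i, j). bcoef xL xR (i + 1))"

definition E_mat :: "nat \<Rightarrow> real mat" where
  "E_mat N = 0\<^sub>m N N @\<^sub>r 1\<^sub>m N"

text \<open>The square root of the diagonal matrix \<open>I + rx * Omega\<^sup>2\<close> is taken entrywise on the diagonal.\<close>

definition C_mat :: "real \<Rightarrow> nat \<Rightarrow> real mat" where
  "C_mat rx N =
     four_block_mat (mat_diag N (\<lambda>i. sqrt (1 + rx * (omega (i + 1))\<^sup>2))) (0\<^sub>m N N)
       (0\<^sub>m 1 N) (0\<^sub>m 1 N)"

definition D_mat :: "nat \<Rightarrow> real \<Rightarrow> real mat" where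
  "D_mat N r = 0\<^sub>m N 1 @\<^sub>r Matrix.mat 1 1 (\<lambda>_. sqrt r)"

text \<open>The entry of the 1-by-1 matrix \<open>D\<^sup>T D\<close>, used as a scalar.\<close>

definition R_weight :: "nat \<Rightarrow> real \<Rightarrow> real" where
  "R_weight N r = (transpose_mat (D_mat N r) * D_mat N r) $$ (0, 0)"

definition sym_pos_def :: "nat \<Rightarrow> real mat \<Rightarrow> bool" where
  "sym_pos_def m P \<longleftrightarrow> P \<in> carrier_mat m m \<and> transpose_mat P = P \<and>
     (\<forall>v\<in>carrier_vec m. v \<noteq> 0\<^sub>v m \<longrightarrow> scalar_prod v (P *\<^sub>v v) > 0)"

text \<open>Time derivatives at \<open>t = 0\<close> are one-sided.\<close>

definition zN :: "nat \<Rightarrow> (real \<Rightarrow> real \<Rightarrow> real) \<Rightarrow> real \<Rightarrow> real Matrix.vec" where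
  "zN N z t = Matrix.vec (2 * N) (\<lambda>i.
     if i < N then ip (z t) (eigfun (i + 1))
     else vector_derivative (\<lambda>s. ip (z s) (eigfun (i - N + 1))) (at t within {0..}))"

definition feedback ::
  "nat \<Rightarrow> real mat \<Rightarrow> real mat \<Rightarrow> real \<Rightarrow> (real \<Rightarrow> real \<Rightarrow> real) \<Rightarrow> real \<Rightarrow> real" where
  "feedback N B P r z t = - inverse r * vec_index ((transpose_mat B * P) *\<^sub>v zN N z t) 0"

end

theory Submission
  imports Defs
begin

text \<open>
Projection on the sine eigenfunctions turns the beam into scalar oscillators
  \<open>z\<^sub>n'' + a\<^sub>n z\<^sub>n' + \<omega>\<^sub>n\<^sup>2 z\<^sub>n = b\<^sub>n u + w\<^sub>n\<close> with \<open>a\<^sub>n = 2 \<zeta>\<^sub>n \<omega>\<^sub>n = c\<^sub>1 + c\<^sub>2 \<omega>\<^sub>n\<^sup>2\<close>, which interact only through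
  the control. The gain bound follows by adding storage functions of these oscillators.

  For the controlled modes \<open>n \<le> N\<close> the storage is \<open>x\<^sup>T P x\<close> with the state \<open>x\<close> of these modes. Because
  the Riccati equation carries the weight \<open>R = \<rho>\<^sub>u + \<rho>\<^sub>\<infinity>\<close>, these modes satisfy the dissipation
  inequality not only with the cost \<open>\<rho>\<^sub>u u\<^sup>2\<close> but with the reserve \<open>\<rho>\<^sub>\<infinity> u\<^sup>2\<close> on top of it
  (\<open>low_modes_dissipation\<close>). The control is a disturbance for every mode \<open>n > N\<close>, and the reserve pays
  for that: an explicit quadratic storage function realises the \<open>H\<^sub>\<infinity>\<close> norm of the oscillator
  (\<open>mode_dissipation\<close>), and splitting the input \<open>b\<^sub>n u + w\<^sub>n\<close> by Cauchy--Schwarz bounds the output of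
  mode \<open>n\<close> by \<open>\<rho>\<^sub>n u\<^sup>2 + \<gamma>\<^sup>2 w\<^sub>n\<^sup>2\<close> (\<open>high_mode_dissipation\<close>). The reserve suffices since
  \<open>\<Sum> \<rho>\<^sub>n \<le> \<rho>\<^sub>\<infinity>\<close> (\<open>sum_rho_le_rho_inf\<close>): beyond the cutoff \<open>M\<close> one has \<open>\<rho>\<^sub>n \<le> C\<^sub>M b\<^sub>n\<^sup>2 / \<omega>\<^sub>n\<^sup>2\<close>, and up to sign
  the \<open>b\<^sub>n / \<omega>\<^sub>n\<close> are the sine coefficients of the indicator of \<open>(x\<^sub>L, x\<^sub>R)\<close>, so Bessel's inequality
  bounds their tail.

  Adding the first \<open>K\<close> modes and integrating over \<open>(0, T)\<close>, where the total storage starts at zero and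
  ends nonnegative, gives
  \<open>\<integral>\<^sub>0\<^sup>T [\<Sum>\<^sub>n\<^sub>\<le>\<^sub>K (1 + \<rho>\<^sub>x \<omega>\<^sub>n\<^sup>2) z\<^sub>n\<^sup>2 + \<rho>\<^sub>u u\<^sup>2] dt \<le> \<gamma>\<^sup>2 \<integral>\<^sub>0\<^sup>\<infinity> \<parallel>w\<parallel>\<^sup>2 dt\<close>. As \<open>K\<close> and \<open>T\<close> grow, Parseval's identity for \<open>z\<close> and
  \<open>z\<^sub>x\<^sub>x\<close> and monotone convergence yield both the integrability and the sign of the integral.

  Two preparations link this argument to the function spaces. A Sobolev norm is built from arbitrarily
  chosen weak derivatives, so everything rests on their uniqueness almost everywhere, which is proved
  with explicit smooth bump functions. Parseval's identity needs completeness of the sines; it comes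
  from Weierstrass' theorem, since \<open>sin x\<close> times a polynomial in \<open>cos x\<close> is a sine polynomial.
  Testing the equation with an eigenfunction shows that the coefficients \<open>z\<^sub>n\<close> are twice continuously
  differentiable (\<open>beam_modes\<close>), so the storage functions are continuously differentiable in time and
  the fundamental theorem of calculus applies to them.
\<close>

section \<open>Square-integrable functions\<close>

lemma L2_mult_integrable:
  assumes "f \<in> L2" "g \<in> L2"
  shows "integrable Ipi (\<lambda>x. f x * g x)"
proof (rule Bochner_Integration.integrable_bound)
  show "integrable Ipi (\<lambda>x. (f x)\<^sup>2 + (g x)\<^sup>2)"
    using assms by (auto simp: L2_def)
  show "(\<lambda>x. f x * g x) \<in> borel_measurable Ipi"
    using assms by (auto simp: L2_def)
  have "\<bar>a * b\<bar> \<le> a\<^sup>2 + b\<^sup>2" for a b :: real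
  proof -
    have "2 * (\<bar>a\<bar> * \<bar>b\<bar>) \<le> a\<^sup>2 + b\<^sup>2"
      using sum_squares_bound[of "\<bar>a\<bar>" "\<bar>b\<bar>"] by (simp add: mult.assoc)
    moreover have "0 \<le> \<bar>a\<bar> * \<bar>b\<bar>" by simp
    ultimately show ?thesis unfolding abs_mult by linarith
  qed
  then show "AE x in Ipi. norm (f x * g x) \<le> norm ((f x)\<^sup>2 + (g x)\<^sup>2)"
    by simp
qed

lemma L2_lincomb:
  assumes "f \<in> L2" "g \<in> L2"
  shows "(\<lambda>x. a * f x + b * g x) \<in> L2"
proof -
  have "integrable Ipi (\<lambda>x. a\<^sup>2 * (f x)\<^sup>2 + 2 * a * b * (f x * g x) + b\<^sup>2 * (g x)\<^sup>2)"
    using assms L2_mult_integrable[OF assms] by (auto simp: L2_def)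
  moreover have "a\<^sup>2 * (f x)\<^sup>2 + 2 * a * b * (f x * g x) + b\<^sup>2 * (g x)\<^sup>2 = (a * f x + b * g x)\<^sup>2" for x
    by (simp add: power2_eq_square algebra_simps)
  moreover have "(\<lambda>x. a * f x + b * g x) \<in> borel_measurable Ipi"
    using assms by (auto simp: L2_def)
  ultimately show ?thesis by (simp add: L2_def)
qed

lemma L2_zero: "(\<lambda>x. 0) \<in> L2"
  by (simp add: L2_def)

lemma L2_add: "f \<in> L2 \<Longrightarrow> g \<in> L2 \<Longrightarrow> (\<lambda>x. f x + g x) \<in> L2"
  using L2_lincomb[of f g 1 1] by simp

lemma L2_diff: "f \<in> L2 \<Longrightarrow> g \<in> L2 \<Longrightarrow> (\<lambda>x. f x - g x) \<in> L2"
  using L2_lincomb[of f g 1 "-1"] by simp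

lemma L2_scale: "f \<in> L2 \<Longrightarrow> (\<lambda>x. a * f x) \<in> L2"
  using L2_lincomb[of f f a 0] by simp

lemma L2_sum: "(\<And>i. i \<in> I \<Longrightarrow> f i \<in> L2) \<Longrightarrow> (\<lambda>x. \<Sum>i\<in>I. a i * f i x) \<in> L2"
  by (induction I rule: infinite_finite_induct) (auto simp: L2_zero intro!: L2_add L2_scale)

lemma continuous_integrable_Ipi:
  fixes f :: "real \<Rightarrow> real"
  assumes "continuous_on {0..pi} f"
  shows "integrable Ipi f"
proof -
  have "f absolutely_integrable_on {0..pi}"
    using absolutely_integrable_continuous[where a = 0 and b = pi and f = f] assms by simp
  then have "f absolutely_integrable_on {0<..<pi}"
    using absolutely_integrable_on_open_interval[where f = f and a = 0 and b = pi] by simp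
  then show ?thesis
    by (rule absolutely_integrable_imp_integrable) simp
qed

lemma continuous_L2:
  assumes "continuous_on {0..pi} f"
  shows "f \<in> L2"
proof -
  have "integrable Ipi f" "integrable Ipi (\<lambda>x. (f x)\<^sup>2)"
    using assms by (auto intro!: continuous_integrable_Ipi continuous_intros)
  then show ?thesis by (auto simp: L2_def)
qed

lemma integral_Ipi_FTC:
  assumes "\<And>x. x \<in> {0..pi} \<Longrightarrow> (F has_real_derivative f x) (at x)"
    and "continuous_on {0..pi} f"
  shows "integral\<^sup>L Ipi f = F pi - F 0"
proof -
  have "(f has_integral F pi - F 0) {0..pi}"
    using assms(1)
    by (intro fundamental_theorem_of_calculus)
       (auto simp: has_real_derivative_iff_has_vector_derivative[symmetric]
             intro: has_field_derivative_at_within)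
  then have "(f has_integral F pi - F 0) {0<..<pi}"
    using has_integral_open_interval[of f _ 0 pi] by simp
  moreover have "(f has_integral integral\<^sup>L Ipi f) {0<..<pi}"
    by (rule has_integral_integral_lebesgue_on) (use assms(2) in \<open>auto intro: continuous_integrable_Ipi\<close>)
  ultimately show ?thesis
    by (rule has_integral_unique[symmetric])
qed

lemma ip_commute: "ip f g = ip g f"
  by (simp add: ip_def mult.commute)

lemma ip_lincomb_left:
  assumes "f \<in> L2" "g \<in> L2" "h \<in> L2"
  shows "ip (\<lambda>x. a * f x + b * g x) h = a * ip f h + b * ip g h"
proof -
  have "ip (\<lambda>x. a * f x + b * g x) h = integral\<^sup>L Ipi (\<lambda>x. a * (f x * h x) + b * (g x * h x))"
    unfolding ip_def by (rule arg_cong[where f = "integral\<^sup>L Ipi"]) (auto simp: algebra_simps)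
  also have "\<dots> = a * ip f h + b * ip g h"
    using assms by (simp add: ip_def L2_mult_integrable)
  finally show ?thesis .
qed

lemma ip_diff_left:
  "f \<in> L2 \<Longrightarrow> g \<in> L2 \<Longrightarrow> h \<in> L2 \<Longrightarrow> ip (\<lambda>x. f x - g x) h = ip f h - ip g h"
  using ip_lincomb_left[of f g h 1 "-1"] by simp

lemma ip_scale_left: "ip (\<lambda>x. a * f x) h = a * ip f h"
  by (simp add: ip_def mult.assoc)

lemma ip_scale_right: "ip h (\<lambda>x. a * f x) = a * ip h f"
  by (metis ip_commute ip_scale_left)

lemma ip_sum_left:
  assumes "\<And>i. i \<in> I \<Longrightarrow> f i \<in> L2" "h \<in> L2"
  shows "ip (\<lambda>x. \<Sum>i\<in>I. a i * f i x) h = (\<Sum>i\<in>I. a i * ip (f i) h)"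
  using assms(1)
proof (induction I rule: infinite_finite_induct)
  case (insert i I)
  then have "ip (\<lambda>x. a i * f i x + 1 * (\<Sum>i\<in>I. a i * f i x)) h
      = a i * ip (f i) h + 1 * ip (\<lambda>x. \<Sum>i\<in>I. a i * f i x) h"
    by (intro ip_lincomb_left L2_sum assms(2)) blast+
  with insert show ?case by simp
qed (auto simp: ip_def)

lemma ip_diff_right:
  "f \<in> L2 \<Longrightarrow> g \<in> L2 \<Longrightarrow> h \<in> L2 \<Longrightarrow> ip h (\<lambda>x. f x - g x) = ip h f - ip h g"
  using ip_diff_left[of f g h] by (simp add: ip_commute)

lemma ip_cong_AE:
  assumes "AE x in Ipi. f x = f' x" "f \<in> L2" "f' \<in> L2" "g \<in> L2"
  shows "ip f g = ip f' g"
  unfolding ip_def using assms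
  by (intro integral_cong_AE) (auto simp: L2_def)

lemma ip_self_nonneg: "0 \<le> ip f f"
  unfolding ip_def by (rule Bochner_Integration.integral_nonneg_AE) auto

lemma L2norm_nonneg: "0 \<le> L2norm f"
  by (simp add: L2norm_def ip_self_nonneg)

lemma L2norm_power2: "(L2norm f)\<^sup>2 = ip f f"
  by (simp add: L2norm_def ip_self_nonneg)

lemma L2norm_cong_AE:
  assumes "AE x in Ipi. f x = g x" "f \<in> L2" "g \<in> L2"
  shows "L2norm f = L2norm g"
  unfolding L2norm_def by (metis assms ip_cong_AE ip_commute)

text \<open>On plain functions \<open>ip\<close> is only a semi-inner product, so the discriminant argument has a
  degenerate case in which \<open>\<langle>f, f\<rangle> = 0\<close> although \<open>f\<close> need not vanish.\<close>

lemma ip_Cauchy_Schwarz: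
  assumes "f \<in> L2" "g \<in> L2"
  shows "\<bar>ip f g\<bar> \<le> L2norm f * L2norm g"
proof -
  have quad: "0 \<le> ip f f * t\<^sup>2 + 2 * t * ip f g + ip g g" for t
  proof -
    let ?h = "\<lambda>x. t * f x + 1 * g x"
    have h: "?h \<in> L2" by (rule L2_lincomb[OF assms])
    have "ip ?h ?h = t * ip f ?h + 1 * ip g ?h"
      by (rule ip_lincomb_left[OF assms h])
    moreover have "ip f ?h = t * ip f f + 1 * ip g f" "ip g ?h = t * ip f g + 1 * ip g g"
      using ip_lincomb_left[OF assms assms(1), of t 1] ip_lincomb_left[OF assms assms(2), of t 1]
      by (simp_all only: ip_commute[of _ ?h])
    ultimately have "ip ?h ?h = ip f f * t\<^sup>2 + 2 * t * ip f g + ip g g"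
      by (simp add: ip_commute[of g f] power2_eq_square algebra_simps)
    then show ?thesis using ip_self_nonneg[of ?h] by simp
  qed
  have "(ip f g)\<^sup>2 \<le> ip f f * ip g g"
  proof (cases "ip f f = 0")
    case True
    have "ip f g = 0"
    proof (rule ccontr)
      assume "ip f g \<noteq> 0"
      then show False
        (* Here the quadratic, which is affine, takes the value -1. *)
        using quad[of "- (ip g g + 1) / (2 * ip f g)"] True by (simp add: field_simps)
    qed
    then show ?thesis using True by simp
  next
    case False
    then have pos: "ip f f > 0" using ip_self_nonneg[of f] by simp
    have "0 \<le> ip f f * (ip f f * (- ip f g / ip f f)\<^sup>2 + 2 * (- ip f g / ip f f) * ip f g + ip g g)"
      by (rule mult_nonneg_nonneg[OF _ quad]) (use pos in simp)
    also have "\<dots> = ip f f * ip g g - (ip f g)\<^sup>2"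
      using pos by (simp add: field_simps power2_eq_square)
    finally show ?thesis by simp
  qed
  then have "\<bar>ip f g\<bar>\<^sup>2 \<le> (L2norm f * L2norm g)\<^sup>2"
    by (simp add: power_mult_distrib L2norm_power2)
  then show ?thesis
    by (rule power2_le_imp_le) (simp add: L2norm_nonneg)
qed

lemma L2norm_triangle:
  assumes "f \<in> L2" "g \<in> L2"
  shows "L2norm (\<lambda>x. f x + g x) \<le> L2norm f + L2norm g"
proof (rule power2_le_imp_le)
  let ?h = "\<lambda>x. 1 * f x + 1 * g x"
  have h: "?h \<in> L2" by (rule L2_lincomb[OF assms])
  have "ip ?h ?h = 1 * ip f ?h + 1 * ip g ?h"
    by (rule ip_lincomb_left[OF assms h])
  moreover have "ip f ?h = 1 * ip f f + 1 * ip g f" "ip g ?h = 1 * ip f g + 1 * ip g g"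
    using ip_lincomb_left[OF assms assms(1), of 1 1] ip_lincomb_left[OF assms assms(2), of 1 1]
    by (simp_all only: ip_commute[of _ ?h])
  ultimately have "ip ?h ?h = ip f f + 2 * ip f g + ip g g"
    by (simp add: ip_commute[of g f])
  then show "(L2norm (\<lambda>x. f x + g x))\<^sup>2 \<le> (L2norm f + L2norm g)\<^sup>2"
    using ip_Cauchy_Schwarz[OF assms] by (simp add: L2norm_power2 power2_sum)
qed (simp add: L2norm_nonneg)

lemma L2norm_scale: "L2norm (\<lambda>x. a * f x) = \<bar>a\<bar> * L2norm f"
  by (simp add: L2norm_def ip_scale_left ip_scale_right real_sqrt_mult flip: mult.assoc)

section \<open>Smooth functions and bump functions\<close>

text \<open>Smoothness is a statement about all iterated derivatives at once; it follows from membership in any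
  class of differentiable functions that is closed under differentiation.\<close>

lemma smooth_coinduct:
  assumes "f \<in> S"
    and S: "\<And>g. g \<in> S \<Longrightarrow> (\<forall>x. g field_differentiable at x) \<and> deriv g \<in> S"
  shows "smooth f"
proof -
  have "(deriv ^^ k) f \<in> S" for k
    by (induction k) (use assms in auto)
  then show ?thesis using S by (auto simp: smooth_def)
qed

lemma smooth_deriv: "smooth f \<Longrightarrow> smooth (deriv f)"
  unfolding smooth_def by (metis funpow_Suc_right o_apply)

lemma smooth_funpow_deriv: "smooth f \<Longrightarrow> smooth ((deriv ^^ k) f)"
  by (induction k) (auto intro: smooth_deriv)

lemma smooth_has_deriv: "smooth f \<Longrightarrow> (f has_real_derivative deriv f x) (at x)"
  unfolding smooth_def by (metis DERIV_deriv_iff_field_differentiable funpow_0)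

lemma smooth_continuous_on: "smooth f \<Longrightarrow> continuous_on S f"
  by (meson DERIV_isCont continuous_at_imp_continuous_on smooth_has_deriv)

text \<open>This class is closed under differentiation: the derivative of a product or of an affine substitution
  is again built from sums, products and affine substitutions. So all closure properties of smooth
  functions follow together from the coinduction principle.\<close>

inductive_set smooth_algebra :: "(real \<Rightarrow> real) set" where
  base: "smooth f \<Longrightarrow> f \<in> smooth_algebra"
| add: "f \<in> smooth_algebra \<Longrightarrow> g \<in> smooth_algebra \<Longrightarrow> (\<lambda>x. f x + g x) \<in> smooth_algebra"
| mult: "f \<in> smooth_algebra \<Longrightarrow> g \<in> smooth_algebra \<Longrightarrow> (\<lambda>x. f x * g x) \<in> smooth_algebra"
| affine: "f \<in> smooth_algebra \<Longrightarrow> (\<lambda>x. f (a * x + b)) \<in> smooth_algebra"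

lemma smooth_const: "smooth (\<lambda>x. c)"
  by (rule smooth_coinduct[where S = "range (\<lambda>c x. c)"]) auto

lemma smooth_algebra_deriv:
  "f \<in> smooth_algebra \<Longrightarrow> \<exists>f'\<in>smooth_algebra. \<forall>x. (f has_real_derivative f' x) (at x)"
proof (induction rule: smooth_algebra.induct)
  case (base f)
  then show ?case
    using smooth_deriv smooth_has_deriv smooth_algebra.base by blast
next
  case (add f g)
  then obtain f' g' where "f' \<in> smooth_algebra" "g' \<in> smooth_algebra"
    "\<forall>x. (f has_real_derivative f' x) (at x)" "\<forall>x. (g has_real_derivative g' x) (at x)" by blast
  then show ?case
    by (intro bexI[of _ "\<lambda>x. f' x + g' x"]) (auto intro: DERIV_add smooth_algebra.add)
next
  case (mult f g)
  then obtain f' g' where "f' \<in> smooth_algebra" "g' \<in> smooth_algebra"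
    "\<forall>x. (f has_real_derivative f' x) (at x)" "\<forall>x. (g has_real_derivative g' x) (at x)" by blast
  with mult show ?case
    by (intro bexI[of _ "\<lambda>x. f' x * g x + g' x * f x"])
       (auto intro: DERIV_mult smooth_algebra.add smooth_algebra.mult)
next
  case (affine f a b)
  then obtain f' where f': "f' \<in> smooth_algebra" "\<forall>x. (f has_real_derivative f' x) (at x)" by blast
  have "((\<lambda>x. f (a * x + b)) has_real_derivative f' (a * x + b) * a) (at x)" for x
    by (rule DERIV_chain2[of f]) (use f' in \<open>auto intro!: derivative_eq_intros\<close>)
  with f' show ?case
    by (intro bexI[of _ "\<lambda>x. f' (a * x + b) * a"])
       (auto intro!: smooth_algebra.mult smooth_algebra.affine smooth_algebra.base[OF smooth_const])
qed

lemma smooth_algebra_smooth: "f \<in> smooth_algebra \<Longrightarrow> smooth f"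
proof (rule smooth_coinduct)
  fix g assume "g \<in> smooth_algebra"
  then obtain g' where g': "g' \<in> smooth_algebra" "\<forall>x. (g has_real_derivative g' x) (at x)"
    using smooth_algebra_deriv by blast
  then have "deriv g = g'" by (auto intro: DERIV_imp_deriv)
  with g' show "(\<forall>x. g field_differentiable at x) \<and> deriv g \<in> smooth_algebra"
    by (auto simp: field_differentiable_def)
qed

lemma smooth_mult: "smooth f \<Longrightarrow> smooth g \<Longrightarrow> smooth (\<lambda>x. f x * g x)"
  and smooth_affine: "smooth f \<Longrightarrow> smooth (\<lambda>x. f (a * x + b))"
  by (blast intro: smooth_algebra_smooth smooth_algebra.intros smooth_const)+

lemma smooth_scale: "smooth f \<Longrightarrow> smooth (\<lambda>x. c * f x)"
  by (rule smooth_mult[OF smooth_const])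

lemma smooth_sin: "smooth sin"
proof (rule smooth_coinduct[where S = "(\<lambda>(a,b) x. a * sin x + b * cos x) ` UNIV"])
  show "sin \<in> (\<lambda>(a,b) x. a * sin x + b * cos x) ` UNIV"
    by (rule image_eqI[of _ _ "(1,0)"]) auto
  fix g :: "real \<Rightarrow> real" assume "g \<in> (\<lambda>(a,b) x. a * sin x + b * cos x) ` UNIV"
  then obtain a b where g: "g = (\<lambda>x. a * sin x + b * cos x)" by auto
  have d: "(g has_real_derivative (- b) * sin x + a * cos x) (at x)" for x
    unfolding g by (auto intro!: derivative_eq_intros)
  then have "deriv g = (\<lambda>(a,b) x. a * sin x + b * cos x) (- b, a)"
    by (auto intro!: DERIV_imp_deriv)
  then have "deriv g \<in> (\<lambda>(a,b) x. a * sin x + b * cos x) ` UNIV"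
    by (rule image_eqI) simp
  with d show "(\<forall>x. g field_differentiable at x) \<and> deriv g \<in> (\<lambda>(a,b) x. a * sin x + b * cos x) ` UNIV"
    by (auto simp: field_differentiable_def)
qed

lemma poly_div_exp_tendsto_0: "((\<lambda>y. poly p y / exp y) \<longlongrightarrow> (0::real)) at_top"
proof -
  have "((\<lambda>y. \<Sum>i\<le>degree p. coeff p i * (y ^ i / exp y)) \<longlongrightarrow> (0::real)) at_top"
    by (rule tendsto_null_sum) (rule tendsto_mult_right_zero, rule tendsto_power_div_exp_0)
  then show ?thesis
    by (simp add: poly_altdef sum_divide_distrib)
qed

text \<open>The polynomial factor makes the family closed under differentiation; \<open>flat_exp 1\<close> is the classical
  smooth function that vanishes exactly for \<open>x \<le> 0\<close>.\<close>

definition flat_exp :: "real poly \<Rightarrow> real \<Rightarrow> real" where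
  "flat_exp p x = (if x > 0 then poly p (inverse x) / exp (inverse x) else 0)"

text \<open>For positive \<open>x\<close>, differentiating \<open>p(1/x) e\<^bsup>-1/x\<^esup>\<close> multiplies by a polynomial in \<open>1/x\<close>. At \<open>0\<close> the right
  difference quotient is \<open>1/h\<close> times such a function, which the exponential sends to \<open>0\<close>.\<close>

lemma flat_exp_has_deriv:
  "(flat_exp p has_real_derivative flat_exp (monom 1 2 * (p - pderiv p)) x) (at x)"
proof -
  consider "x > 0" | "x < 0" | "x = 0" by linarith
  then show ?thesis
  proof cases
    case 1
    have "((\<lambda>x. poly p (inverse x) / exp (inverse x)) has_real_derivative
       flat_exp (monom 1 2 * (p - pderiv p)) x) (at x)"
      using 1 unfolding flat_exp_def
      by (auto intro!: derivative_eq_intros poly_DERIV DERIV_chain2[of "poly p"]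
          simp: poly_monom field_simps power2_eq_square exp_minus)
    then show ?thesis
      by (rule has_field_derivative_transform_within_open[of _ _ _ "{0<..}"])
         (use 1 in \<open>auto simp: flat_exp_def\<close>)
  next
    case 2
    have "((\<lambda>x. 0) has_real_derivative flat_exp (monom 1 2 * (p - pderiv p)) x) (at x)"
      using 2 by (auto simp: flat_exp_def)
    then show ?thesis
      by (rule has_field_derivative_transform_within_open[of _ _ _ "{..<0}"])
         (use 2 in \<open>auto simp: flat_exp_def\<close>)
  next
    case 3
    have "((\<lambda>h. poly (monom 1 1 * p) (inverse h) / exp (inverse h)) \<longlongrightarrow> 0) (at_right 0)"
      by (rule filterlim_compose[OF poly_div_exp_tendsto_0 filterlim_inverse_at_top_right])
    then have R: "((\<lambda>h. (flat_exp p (0 + h) - flat_exp p 0) / h) \<longlongrightarrow> 0) (at_right 0)"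
      by (rule Lim_transform_eventually)
         (auto simp: eventually_at_filter flat_exp_def poly_monom divide_simps)
    have L: "((\<lambda>h. (flat_exp p (0 + h) - flat_exp p 0) / h) \<longlongrightarrow> 0) (at_left 0)"
      by (rule Lim_transform_eventually[OF tendsto_const])
         (auto simp: eventually_at_filter flat_exp_def)
    show ?thesis
      using filterlim_split_at[OF L R] 3 by (simp add: DERIV_def flat_exp_def)
  qed
qed

lemma smooth_flat_exp: "smooth (flat_exp p)"
proof (rule smooth_coinduct[where S = "range flat_exp"])
  fix g assume "g \<in> range flat_exp"
  then obtain p where "g = flat_exp p" by blast
  moreover have "deriv (flat_exp p) = flat_exp (monom 1 2 * (p - pderiv p))"
    by (auto intro: DERIV_imp_deriv flat_exp_has_deriv)
  ultimately show "(\<forall>x. g field_differentiable at x) \<and> deriv g \<in> range flat_exp"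
    using flat_exp_has_deriv by (auto simp: field_differentiable_def)
qed simp

text \<open>Steepening the flat exponential by a factor \<open>n + 1\<close> lets it rise to \<open>1\<close> immediately; the product of
  one factor rising at \<open>a\<close> and one falling at \<open>b\<close> has its support in the fixed compact interval.\<close>

lemma test_fun_approx_indicator:
  assumes "a < b" "{a..b} \<subseteq> S"
  obtains \<phi> :: "nat \<Rightarrow> real \<Rightarrow> real"
  where "\<And>n. test_fun S (\<phi> n)" "\<And>n x. \<bar>\<phi> n x\<bar> \<le> 1"
    "\<And>x. (\<lambda>n. \<phi> n x) \<longlonglongrightarrow> indicator {a<..<b} x"
proof
  define h where "h = flat_exp 1"
  define \<phi> where "\<phi> n x = h (real (Suc n) * (x - a)) * h (real (Suc n) * (b - x))" for n x
  have h: "0 \<le> h x" "h x \<le> 1" "x \<le> 0 \<Longrightarrow> h x = 0" for x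
    by (auto simp: h_def flat_exp_def)
  have "smooth h" unfolding h_def by (rule smooth_flat_exp)
  then have "smooth (\<lambda>x. h (real (Suc n) * x + - real (Suc n) * a) *
      h (- real (Suc n) * x + real (Suc n) * b))" for n
    by (intro smooth_mult smooth_affine)
  moreover have "\<phi> n = (\<lambda>x. h (real (Suc n) * x + - real (Suc n) * a) *
      h (- real (Suc n) * x + real (Suc n) * b))" for n
    by (rule ext) (simp add: \<phi>_def algebra_simps)
  ultimately have sm: "smooth (\<phi> n)" for n
    by simp
  have z: "\<phi> n x = 0" if "x \<notin> {a..b}" for n x
  proof -
    have "real (Suc n) * (x - a) \<le> 0 \<or> real (Suc n) * (b - x) \<le> 0"
      using that by (auto simp: mult_le_0_iff)
    then show ?thesis using h(3) unfolding \<phi>_def by (metis mult_eq_0_iff)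
  qed
  show "test_fun S (\<phi> n)" for n
    unfolding test_fun_def using sm z assms(2) compact_Icc by blast
  show "\<bar>\<phi> n x\<bar> \<le> 1" for n x
    using h(1,2) by (simp add: \<phi>_def abs_mult mult_le_one)
  have hlim: "(\<lambda>n. h (real (Suc n) * y)) \<longlonglongrightarrow> 1" if "y > 0" for y
  proof -
    have "(\<lambda>n. inverse (real (Suc n)) * inverse y) \<longlonglongrightarrow> 0"
      by (rule tendsto_mult_left_zero[OF LIMSEQ_inverse_real_of_nat])
    then have "(\<lambda>n. 1 / exp (inverse (real (Suc n)) * inverse y)) \<longlonglongrightarrow> 1 / exp 0"
      by (intro tendsto_intros) auto
    moreover have "h (real (Suc n) * y) = 1 / exp (inverse (real (Suc n)) * inverse y)" for n
      using that unfolding h_def flat_exp_def by (simp del: of_nat_Suc)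
    ultimately show ?thesis by simp
  qed
  show "(\<lambda>n. \<phi> n x) \<longlonglongrightarrow> indicator {a<..<b} x" for x
  proof (cases "x \<in> {a<..<b}")
    case True
    then have "(\<lambda>n. \<phi> n x) \<longlonglongrightarrow> 1 * 1"
      unfolding \<phi>_def by (intro tendsto_mult hlim) auto
    with True show ?thesis by simp
  next
    case False
    then have "real (Suc n) * (x - a) \<le> 0 \<or> real (Suc n) * (b - x) \<le> 0" for n
      by (auto simp: mult_le_0_iff)
    then have "\<phi> n x = 0" for n using h(3) unfolding \<phi>_def by (metis mult_eq_0_iff)
    with False show ?thesis by simp
  qed
qed

lemma test_fun_smooth: "test_fun S \<phi> \<Longrightarrow> smooth \<phi>"
  by (simp add: test_fun_def)

lemma test_fun_L2: "test_fun S \<phi> \<Longrightarrow> \<phi> \<in> L2"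
  by (intro continuous_L2 smooth_continuous_on test_fun_smooth)

lemma test_fun_deriv:
  assumes "test_fun S \<phi>"
  shows "test_fun S (deriv \<phi>)"
proof -
  obtain K where K: "compact K" "K \<subseteq> S" "\<And>x. x \<notin> K \<Longrightarrow> \<phi> x = 0"
    using assms by (auto simp: test_fun_def)
  have "deriv \<phi> x = 0" if "x \<notin> K" for x
  proof (rule DERIV_imp_deriv)
    have "((\<lambda>x. 0) has_real_derivative 0) (at x)" by simp
    then show "(\<phi> has_real_derivative 0) (at x)"
      by (rule has_field_derivative_transform_within_open[of _ _ _ "- K"])
         (use K that in \<open>auto intro: compact_imp_closed\<close>)
  qed
  then show ?thesis
    using assms K by (auto simp: test_fun_def intro: smooth_deriv)
qed

lemma test_fun_funpow_deriv: "test_fun S \<phi> \<Longrightarrow> test_fun S ((deriv ^^ k) \<phi>)"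
  by (induction k) (auto intro: test_fun_deriv)

lemma indicator_Ioo_measurable_Ipi: "indicat_real {a<..<b} \<in> borel_measurable Ipi"
  by (intro measurable_restrict_space1) (simp add: borel_measurable_indicator)

text \<open>By Lebesgue differentiation an integrable function is, almost everywhere, the limit of its means over
  small intervals, and these means vanish.\<close>

lemma AE_zero_if_interval_integrals_zero:
  fixes h :: "real \<Rightarrow> real"
  assumes h: "integrable Ipi h"
    and z: "\<And>a b. 0 < a \<Longrightarrow> a < b \<Longrightarrow> b < pi \<Longrightarrow> integral\<^sup>L Ipi (\<lambda>x. h x * indicator {a<..<b} x) = 0"
  shows "AE x in Ipi. h x = 0"
proof -
  define f where "f x = (if x \<in> {0<..<pi} then h x else 0)" for x
  have int: "integrable Ipi (\<lambda>x. h x * indicator {a<..<b} x)" for a b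
    by (rule Bochner_Integration.integrable_bound[OF h])
       (use h indicator_Ioo_measurable_Ipi[of a b] in \<open>auto split: split_indicator\<close>)
  have I: "((\<lambda>x. h x) has_integral 0) {a..b}" if "0 < a" "a < b" "b < pi" for a b
  proof -
    have "((\<lambda>x. h x * indicator {a<..<b} x) has_integral 0) {0<..<pi}"
      using has_integral_integral_lebesgue_on[OF int, of a b] z[OF that] by simp
    then have "((\<lambda>x. if x \<in> {a<..<b} then h x else 0) has_integral 0) {0<..<pi}"
      by (rule has_integral_eq[rotated]) auto
    moreover have "{a<..<b} \<subseteq> {0<..<pi}"
      using that by auto
    ultimately have "(h has_integral 0) {a<..<b}"
      by (simp only: has_integral_restrict)
    then show ?thesis using has_integral_open_interval[of h 0 a b] by simp
  qed
  have "h integrable_on {0<..<pi}"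
    by (rule integrable_on_lebesgue_on[OF h]) simp
  then have "f integrable_on UNIV"
    unfolding f_def by (subst integrable_restrict_UNIV)
  then have "f integrable_on cbox a b" for a b
    by (rule integrable_on_subcbox) auto
  then obtain N where N: "negligible N"
    "\<And>x e. x \<notin> N \<Longrightarrow> 0 < e \<Longrightarrow> \<exists>d>0. \<forall>h. 0 < h \<and> h < d \<longrightarrow>
        norm (integral (cbox x (x + h *\<^sub>R One)) f /\<^sub>R h ^ DIM(real) - f x) < e"
    using integrable_ccontinuous_explicit[of f] by blast
  have "h x = 0" if x: "x \<in> {0<..<pi}" "x \<notin> N" for x
  proof (rule ccontr)
    assume nz: "h x \<noteq> 0"
    then obtain d where d: "d > 0" "\<And>t. 0 < t \<Longrightarrow> t < d \<Longrightarrow>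
        norm (integral (cbox x (x + t *\<^sub>R One)) f /\<^sub>R t ^ DIM(real) - f x) < \<bar>h x\<bar>"
      using N(2)[of x "\<bar>h x\<bar>"] x by auto
    define t where "t = min (d / 2) ((pi - x) / 2)"
    have t: "0 < t" "t < d" "x + t < pi" using d x by (auto simp: t_def min_def field_simps)
    have "integral {x..x + t} f = integral {x..x + t} h"
      by (rule integral_cong) (use x t in \<open>auto simp: f_def\<close>)
    also have "\<dots> = 0" using I[of x "x + t"] x t by (auto intro: integral_unique)
    finally show False using d(2)[of t] t x by (simp add: f_def)
  qed
  moreover have "AE x in lebesgue. x \<notin> N"
    using N(1) by (auto simp: negligible_iff_null_sets intro: AE_not_in)
  ultimately show ?thesis
    by (auto simp: AE_restrict_space_iff)
qed

text \<open>Test functions converge boundedly to the indicator of any interval, so orthogonality to test functions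
  forces all interval integrals to vanish.\<close>

lemma AE_zero_if_orthogonal_to_test_funs:
  assumes h: "h \<in> L2" and z: "\<And>\<phi>. test_fun {0<..<pi} \<phi> \<Longrightarrow> ip h \<phi> = 0"
  shows "AE x in Ipi. h x = 0"
proof (rule AE_zero_if_interval_integrals_zero)
  show h1: "integrable Ipi h"
    using L2_mult_integrable[OF h continuous_L2[of "\<lambda>x. 1"]] by simp
  fix a b :: real assume ab: "0 < a" "a < b" "b < pi"
  then have "{a..b} \<subseteq> {0<..<pi}" by auto
  then obtain \<phi> :: "nat \<Rightarrow> real \<Rightarrow> real" where \<phi>: "\<And>n. test_fun {0<..<pi} (\<phi> n)" "\<And>n x. \<bar>\<phi> n x\<bar> \<le> 1"
    "\<And>x. (\<lambda>n. \<phi> n x) \<longlonglongrightarrow> indicator {a<..<b} x"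
    using test_fun_approx_indicator[OF ab(2)] by blast
  have "(\<lambda>n. integral\<^sup>L Ipi (\<lambda>x. h x * \<phi> n x)) \<longlonglongrightarrow> integral\<^sup>L Ipi (\<lambda>x. h x * indicator {a<..<b} x)"
  proof (rule integral_dominated_convergence[where w = "\<lambda>x. \<bar>h x\<bar>"])
    show "(\<lambda>x. h x * \<phi> n x) \<in> borel_measurable Ipi" for n
      using L2_mult_integrable[OF h test_fun_L2[OF \<phi>(1)]] by blast
    show "AE x in Ipi. norm (h x * \<phi> n x) \<le> \<bar>h x\<bar>" for n
      using \<phi>(2) by (auto simp: abs_mult mult_left_le)
    show "AE x in Ipi. (\<lambda>n. h x * \<phi> n x) \<longlonglongrightarrow> h x * indicator {a<..<b} x"
      by (auto intro!: tendsto_mult \<phi>(3))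
    show "(\<lambda>x. h x * indicat_real {a<..<b} x) \<in> borel_measurable Ipi"
      using h indicator_Ioo_measurable_Ipi[of a b] by (auto simp: L2_def)
  qed (use h1 in auto)
  moreover have "integral\<^sup>L Ipi (\<lambda>x. h x * \<phi> n x) = 0" for n
    using z[OF \<phi>(1)] by (simp add: ip_def)
  ultimately show "integral\<^sup>L Ipi (\<lambda>x. h x * indicator {a<..<b} x) = 0"
    by (simp add: LIMSEQ_const_iff)
qed

section \<open>Weak derivatives and Sobolev spaces\<close>

text \<open>The function \<^const>\<open>wd\<close> is an arbitrary choice of a weak derivative; uniqueness makes all norms and
  scalar products formed with it independent of that choice.\<close>

lemma weak_deriv_unique:
  assumes "weak_deriv k f g" "weak_deriv k f g'" "g \<in> L2" "g' \<in> L2"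
  shows "AE x in Ipi. g x = g' x"
proof -
  have "AE x in Ipi. g x - g' x = 0"
  proof (rule AE_zero_if_orthogonal_to_test_funs)
    fix \<phi> assume "test_fun {0<..<pi} \<phi>"
    then have "(-1) ^ k * ip g \<phi> = (-1) ^ k * ip g' \<phi>" "\<phi> \<in> L2"
      using assms by (auto simp: weak_deriv_def test_fun_L2)
    then show "ip (\<lambda>x. g x - g' x) \<phi> = 0"
      using assms by (simp add: ip_diff_left)
  qed (use assms in \<open>auto intro: L2_diff\<close>)
  then show ?thesis by simp
qed

lemma ip_integration_by_parts:
  assumes "\<And>x. x \<in> {0..pi} \<Longrightarrow> (f has_real_derivative f' x) (at x)"
    "\<And>x. x \<in> {0..pi} \<Longrightarrow> (g has_real_derivative g' x) (at x)"
    "continuous_on {0..pi} f'" "continuous_on {0..pi} g'"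
  shows "ip f g' = f pi * g pi - f 0 * g 0 - ip f' g"
proof -
  have c: "continuous_on {0..pi} f" "continuous_on {0..pi} g"
    by (meson assms(1,2) DERIV_isCont continuous_at_imp_continuous_on)+
  have "integral\<^sup>L Ipi (\<lambda>x. f' x * g x + f x * g' x) = f pi * g pi - f 0 * g 0"
  proof (rule integral_Ipi_FTC)
    fix x assume "x \<in> {0..pi}"
    from DERIV_mult[OF assms(1,2)[OF this]]
    show "((\<lambda>x. f x * g x) has_real_derivative f' x * g x + f x * g' x) (at x)"
      by (simp add: mult.commute)
  qed (intro continuous_intros assms c)
  moreover have "integral\<^sup>L Ipi (\<lambda>x. f' x * g x + f x * g' x) = ip f' g + ip f g'"
    unfolding ip_def
    by (rule Bochner_Integration.integral_add)
       (use assms c in \<open>auto intro!: L2_mult_integrable continuous_L2\<close>)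
  ultimately show ?thesis by simp
qed

lemma ip_smooth_by_parts:
  "smooth f \<Longrightarrow> smooth g \<Longrightarrow> ip f (deriv g) = f pi * g pi - f 0 * g 0 - ip (deriv f) g"
  by (intro ip_integration_by_parts smooth_has_deriv smooth_continuous_on smooth_deriv)

lemma test_fun_boundary: "test_fun {0<..<pi} \<phi> \<Longrightarrow> \<phi> 0 = 0 \<and> \<phi> pi = 0"
  by (force simp: test_fun_def)

lemma weak_deriv_smooth:
  assumes "smooth f"
  shows "weak_deriv k f ((deriv ^^ k) f)"
  unfolding weak_deriv_def
proof (intro allI impI)
  fix \<phi> assume "test_fun {0<..<pi} \<phi>"
  then show "ip f ((deriv ^^ k) \<phi>) = (-1) ^ k * ip ((deriv ^^ k) f) \<phi>"
  proof (induction k arbitrary: \<phi>)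
    case (Suc k)
    have "ip f ((deriv ^^ Suc k) \<phi>) = ip f ((deriv ^^ k) (deriv \<phi>))"
      by (simp add: funpow_swap1)
    also have "\<dots> = (-1) ^ k * ip ((deriv ^^ k) f) (deriv \<phi>)"
      by (rule Suc.IH[OF test_fun_deriv[OF Suc.prems]])
    also have "ip ((deriv ^^ k) f) (deriv \<phi>) = - ip ((deriv ^^ Suc k) f) \<phi>"
      using ip_smooth_by_parts[OF smooth_funpow_deriv[OF assms] test_fun_smooth[OF Suc.prems]]
        test_fun_boundary[OF Suc.prems] by simp
    finally show ?case by simp
  qed simp
qed

lemma weak_deriv_lincomb:
  assumes "weak_deriv k f f'" "weak_deriv k g g'" "f \<in> L2" "g \<in> L2" "f' \<in> L2" "g' \<in> L2"
  shows "weak_deriv k (\<lambda>x. a * f x + b * g x) (\<lambda>x. a * f' x + b * g' x)"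
  unfolding weak_deriv_def
proof (intro allI impI)
  fix \<phi> assume \<phi>: "test_fun {0<..<pi} \<phi>"
  then show "ip (\<lambda>x. a * f x + b * g x) ((deriv ^^ k) \<phi>)
      = (-1) ^ k * ip (\<lambda>x. a * f' x + b * g' x) \<phi>"
    using assms test_fun_L2[OF \<phi>] test_fun_L2[OF test_fun_funpow_deriv[OF \<phi>]]
    by (simp add: ip_lincomb_left weak_deriv_def algebra_simps)
qed

lemma wd_spec:
  assumes "g \<in> L2" "weak_deriv k f g"
  shows "wd k f \<in> L2" "weak_deriv k f (wd k f)" "AE x in Ipi. wd k f x = g x"
proof -
  have "wd k f \<in> L2 \<and> weak_deriv k f (wd k f)"
    unfolding wd_def by (rule someI[of _ g]) (use assms in blast)
  then show "wd k f \<in> L2" "weak_deriv k f (wd k f)" by auto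
  then show "AE x in Ipi. wd k f x = g x"
    using weak_deriv_unique assms by blast
qed

lemma wd_sobolev:
  assumes "f \<in> sobolev m" "k \<le> m"
  shows "wd k f \<in> L2" "weak_deriv k f (wd k f)"
proof -
  obtain g where "g \<in> L2" "weak_deriv k f g"
    using assms by (auto simp: sobolev_def)
  then show "wd k f \<in> L2" "weak_deriv k f (wd k f)"
    using wd_spec by blast+
qed

lemma sobolev_L2: "f \<in> sobolev k \<Longrightarrow> f \<in> L2"
  by (simp add: sobolev_def)

lemma smooth_L2: "smooth f \<Longrightarrow> f \<in> L2"
  by (intro continuous_L2 smooth_continuous_on)

lemma smooth_sobolev: "smooth f \<Longrightarrow> f \<in> sobolev k"
  unfolding sobolev_def using weak_deriv_smooth smooth_L2 smooth_funpow_deriv by blast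

lemma wd_smooth: "smooth f \<Longrightarrow> AE x in Ipi. wd k f x = (deriv ^^ k) f x"
  by (intro wd_spec(3) weak_deriv_smooth smooth_L2 smooth_funpow_deriv)

lemma wd_0: "f \<in> L2 \<Longrightarrow> AE x in Ipi. wd 0 f x = f x"
  by (rule wd_spec) (simp_all add: weak_deriv_def)

text \<open>This gives access to the Sobolev distance of \<open>f\<close> from a smooth function, which is defined through the
  choice made for the difference and not through the weak derivatives of the two functions.\<close>

lemma wd_diff_smooth:
  assumes "f \<in> sobolev m" "smooth g" "k \<le> m"
  shows "wd k (\<lambda>x. f x - g x) \<in> L2"
    "AE x in Ipi. wd k (\<lambda>x. f x - g x) x = wd k f x - (deriv ^^ k) g x"
proof -
  have "weak_deriv k (\<lambda>x. 1 * f x + (-1) * g x) (\<lambda>x. 1 * wd k f x + (-1) * (deriv ^^ k) g x)"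
    using assms by (intro weak_deriv_lincomb weak_deriv_smooth wd_sobolev sobolev_L2 smooth_L2
        smooth_funpow_deriv)
  then have w: "weak_deriv k (\<lambda>x. f x - g x) (\<lambda>x. wd k f x - (deriv ^^ k) g x)" by simp
  have l: "(\<lambda>x. wd k f x - (deriv ^^ k) g x) \<in> L2"
    using assms by (intro L2_diff wd_sobolev smooth_L2 smooth_funpow_deriv)
  show "wd k (\<lambda>x. f x - g x) \<in> L2"
    "AE x in Ipi. wd k (\<lambda>x. f x - g x) x = wd k f x - (deriv ^^ k) g x"
    using wd_spec[OF l w] by auto
qed

lemma L2norm_wd_le_sobolev_norm:
  assumes "j \<le> k"
  shows "L2norm (wd j f) \<le> sobolev_norm k f"
proof -
  have "(L2norm (wd j f))\<^sup>2 \<le> (\<Sum>j\<le>k. (L2norm (wd j f))\<^sup>2)"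
    by (rule member_le_sum) (use assms in auto)
  then have "sqrt ((L2norm (wd j f))\<^sup>2) \<le> sobolev_norm k f"
    unfolding sobolev_norm_def by (rule real_sqrt_le_mono)
  then show ?thesis by (simp add: L2norm_nonneg)
qed

text \<open>The closure in the Sobolev norm, restated as simultaneous \<open>L\<^sup>2\<close>-approximation of \<open>f\<close> and of its weak
  derivatives by a function satisfying the boundary conditions and its classical derivatives.\<close>

lemma H_BC_smooth_approx:
  assumes "f \<in> H_BC k" "e > 0"
  obtains g where "g \<in> smooth_BC" "L2norm (\<lambda>x. f x - g x) < e"
    "\<And>j. j \<le> k \<Longrightarrow> L2norm (\<lambda>x. wd j f x - (deriv ^^ j) g x) < e"
proof -
  have f: "f \<in> sobolev k" using assms by (simp add: H_BC_def)
  obtain g where g: "g \<in> smooth_BC" "sobolev_norm k (\<lambda>x. f x - g x) < e"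
    using assms by (auto simp: H_BC_def)
  then have sm: "smooth g" by (simp add: smooth_BC_def)
  have "L2norm (\<lambda>x. wd j f x - (deriv ^^ j) g x) < e" if "j \<le> k" for j
  proof -
    have "L2norm (wd j (\<lambda>x. f x - g x)) = L2norm (\<lambda>x. wd j f x - (deriv ^^ j) g x)"
      using wd_diff_smooth[OF f sm that] wd_sobolev(1)[OF f that] smooth_L2[OF smooth_funpow_deriv[OF sm]]
      by (intro L2norm_cong_AE L2_diff)
    then show ?thesis
      using L2norm_wd_le_sobolev_norm[OF that, of "\<lambda>x. f x - g x"] g(2) by simp
  qed
  moreover have "L2norm (\<lambda>x. f x - g x) < e"
  proof -
    have "AE x in Ipi. wd 0 f x - (deriv ^^ 0) g x = f x - g x"
      using wd_0[OF sobolev_L2[OF f]] by auto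
    then have "L2norm (\<lambda>x. wd 0 f x - (deriv ^^ 0) g x) = L2norm (\<lambda>x. f x - g x)"
      using f sm by (intro L2norm_cong_AE L2_diff wd_sobolev smooth_L2 smooth_funpow_deriv sobolev_L2)
        (auto simp: sobolev_def)
    then show ?thesis using calculation[of 0] by simp
  qed
  ultimately show ?thesis using that g by blast
qed

lemma smooth_BC_H_BC: "f \<in> smooth_BC \<Longrightarrow> f \<in> H_BC k"
proof -
  assume f: "f \<in> smooth_BC"
  then have sm: "smooth f" by (simp add: smooth_BC_def)
  have "L2norm (wd j (\<lambda>x. f x - f x)) = 0" for j
  proof -
    have "weak_deriv j (\<lambda>x. f x - f x) (\<lambda>x. 0)" by (simp add: weak_deriv_def ip_def)
    then have "L2norm (wd j (\<lambda>x. f x - f x)) = L2norm (\<lambda>x. 0)"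
      using wd_spec[OF L2_zero] L2_zero by (intro L2norm_cong_AE) auto
    then show ?thesis by (simp add: L2norm_def ip_def)
  qed
  then have "sobolev_norm k (\<lambda>x. f x - f x) = 0" by (simp add: sobolev_norm_def)
  then show "f \<in> H_BC k"
    using f sm by (auto simp: H_BC_def intro: smooth_sobolev bexI[of _ f])
qed

lemma H_BC_sobolev: "f \<in> H_BC k \<Longrightarrow> f \<in> sobolev k"
  by (simp add: H_BC_def)

section \<open>Sine series\<close>

lemma eigfun_has_deriv:
  "(eigfun n has_real_derivative sqrt (2 / pi) * real n * cos (real n * x)) (at x)"
  unfolding eigfun_def by (auto intro!: derivative_eq_intros)

lemma deriv_eigfun: "deriv (eigfun n) = (\<lambda>x. sqrt (2 / pi) * real n * cos (real n * x))"
  by (rule ext, rule DERIV_imp_deriv, rule eigfun_has_deriv)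

lemma smooth_eigfun: "smooth (eigfun n)"
proof -
  have "smooth (\<lambda>x. sqrt (2 / pi) * sin (real n * x + 0))"
    by (intro smooth_scale smooth_affine smooth_sin)
  then show ?thesis by (simp add: eigfun_def[abs_def])
qed

lemma deriv2_scaled_eigfun:
  "deriv (deriv (\<lambda>x. c * eigfun n x)) = (\<lambda>x. - (real n)\<^sup>2 * c * eigfun n x)"
proof -
  have "deriv (\<lambda>x. c * eigfun n x) = (\<lambda>x. c * (sqrt (2 / pi) * real n * cos (real n * x)))"
    by (rule ext, rule DERIV_imp_deriv) (auto intro!: derivative_eq_intros eigfun_has_deriv)
  moreover have "deriv (\<lambda>x. c * (sqrt (2 / pi) * real n * cos (real n * x)))
      = (\<lambda>x. - (real n)\<^sup>2 * c * eigfun n x)"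
    by (rule ext, rule DERIV_imp_deriv)
       (auto intro!: derivative_eq_intros simp: eigfun_def power2_eq_square)
  ultimately show ?thesis by simp
qed

lemma deriv_even_eigfun: "(deriv ^^ (2 * k)) (eigfun n) = (\<lambda>x. (- (real n)\<^sup>2) ^ k * eigfun n x)"
  by (induction k) (auto simp: deriv2_scaled_eigfun mult.assoc)

lemma eigfun_0: "eigfun n 0 = 0"
  by (simp add: eigfun_def)

lemma eigfun_pi: "eigfun n pi = 0"
  by (simp add: eigfun_def)

lemma eigfun_smooth_BC: "eigfun n \<in> smooth_BC"
  by (auto simp: smooth_BC_def smooth_eigfun deriv_even_eigfun eigfun_0 eigfun_pi)

lemma eigfun_L2: "eigfun n \<in> L2"
  by (rule smooth_L2[OF smooth_eigfun])

text \<open>Integrating by parts twice leaves no boundary terms, because both \<open>g\<close> and the eigenfunction vanish at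
  the end points.\<close>

lemma ip_deriv2_eigfun:
  assumes "g \<in> smooth_BC"
  shows "ip ((deriv ^^ 2) g) (eigfun n) = - (real n)\<^sup>2 * ip g (eigfun n)"
proof -
  have sm: "smooth g" using assms by (simp add: smooth_BC_def)
  have g0: "g 0 = 0" "g pi = 0"
    using assms by (auto simp: smooth_BC_def dest!: spec[of _ 0])
  have d: "deriv (deriv (eigfun n)) = (\<lambda>x. - (real n)\<^sup>2 * eigfun n x)"
    using deriv2_scaled_eigfun[of 1 n] by simp
  have "ip (eigfun n) (deriv (deriv g)) = - ip (deriv (eigfun n)) (deriv g)"
    using ip_smooth_by_parts[OF smooth_eigfun smooth_deriv[OF sm]] by (simp add: eigfun_0 eigfun_pi)
  also have "\<dots> = ip (deriv (deriv (eigfun n))) g"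
    using ip_smooth_by_parts[OF smooth_deriv[OF smooth_eigfun] sm] g0 by simp
  also have "\<dots> = - (real n)\<^sup>2 * ip (eigfun n) g"
    unfolding d by (rule ip_scale_left)
  finally show ?thesis by (simp add: ip_commute numeral_2_eq_2)
qed

lemma ip_eigfun_eigfun:
  assumes "n \<ge> 1" "m \<ge> 1"
  shows "ip (eigfun n) (eigfun m) = (if n = m then 1 else 0)"
proof (cases "n = m")
  case True
  define F where "F x = (x / 2 - sin (2 * real n * x) / (4 * real n)) * (2 / pi)" for x
  have "integral\<^sup>L Ipi (\<lambda>x. eigfun n x * eigfun n x) = F pi - F 0"
  proof (rule integral_Ipi_FTC)
    fix x :: real
    have "sin (real n * x) * sin (real n * x) = 1 / 2 - cos (2 * real n * x) / 2"
      using cos_double_sin[of "real n * x"] by (simp add: power2_eq_square mult.assoc field_simps)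
    then have "eigfun n x * eigfun n x = (1 / 2 - cos (2 * real n * x) / 2) * (2 / pi)"
      unfolding eigfun_def power2_eq_square[symmetric] by (simp add: power_mult_distrib)
    moreover have "(F has_real_derivative (1 / 2 - cos (2 * real n * x) / 2) * (2 / pi)) (at x)"
      unfolding F_def using assms by (auto intro!: derivative_eq_intros simp: field_simps)
    ultimately show "(F has_real_derivative eigfun n x * eigfun n x) (at x)"
      by simp
  qed (intro continuous_intros smooth_continuous_on smooth_eigfun)
  moreover have "F pi - F 0 = 1"
  proof -
    have "sin (2 * real n * pi) = 0"
      using sin_npi[of "2 * n"] by simp
    then show ?thesis by (simp add: F_def)
  qed
  ultimately show ?thesis using True by (simp add: ip_def)
next
  case False
  (* The second derivative is symmetric, and the two eigenvalues differ. *)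
  have "- (real n)\<^sup>2 * ip (eigfun n) (eigfun m) = - (real m)\<^sup>2 * ip (eigfun n) (eigfun m)"
  proof -
    have "(deriv ^^ 2) (eigfun n) = (\<lambda>x. - (real n)\<^sup>2 * eigfun n x)"
      using deriv_even_eigfun[of 1 n] by simp
    then show ?thesis
      using ip_deriv2_eigfun[OF eigfun_smooth_BC, of n m] by (metis ip_scale_left)
  qed
  moreover have "(real n)\<^sup>2 \<noteq> (real m)\<^sup>2"
    using False by (simp add: power2_eq_iff)
  ultimately show ?thesis using False by simp
qed

lemma L2norm_eigfun: "n \<ge> 1 \<Longrightarrow> L2norm (eigfun n) = 1"
  by (simp add: L2norm_def ip_eigfun_eigfun)

text \<open>The distance from \<open>f\<close> to a sine polynomial splits orthogonally; Bessel's inequality and the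
  best-approximation property of the partial sums are both read off from this identity.\<close>

lemma L2_distance_sine_poly:
  assumes "f \<in> L2"
  shows "ip (\<lambda>x. f x - (\<Sum>n=1..K. a n * eigfun n x)) (\<lambda>x. f x - (\<Sum>n=1..K. a n * eigfun n x))
    = ip f f - (\<Sum>n=1..K. (ip f (eigfun n))\<^sup>2) + (\<Sum>n=1..K. (a n - ip f (eigfun n))\<^sup>2)"
proof -
  define s where "s x = (\<Sum>n=1..K. a n * eigfun n x)" for x
  have s: "s \<in> L2" unfolding s_def[abs_def] by (rule L2_sum[OF eigfun_L2])
  have sh: "ip s h = (\<Sum>n=1..K. a n * ip (eigfun n) h)" if "h \<in> L2" for h
    unfolding s_def[abs_def] by (rule ip_sum_left[OF eigfun_L2 that])
  have se: "ip s (eigfun m) = a m" if "m \<in> {1..K}" for m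
  proof -
    have "ip s (eigfun m) = (\<Sum>n=1..K. if n = m then a n else 0)"
      unfolding sh[OF eigfun_L2] by (rule sum.cong) (use that in \<open>auto simp: ip_eigfun_eigfun\<close>)
    then show ?thesis using that by simp
  qed
  have "ip s s = (\<Sum>n=1..K. (a n)\<^sup>2)"
    unfolding sh[OF s] by (rule sum.cong) (auto simp: ip_commute[of _ s] se power2_eq_square)
  moreover have "ip s f = (\<Sum>n=1..K. a n * ip f (eigfun n))"
    unfolding sh[OF assms] by (simp add: ip_commute)
  moreover have "ip (\<lambda>x. f x - s x) (\<lambda>x. f x - s x) = ip f f - 2 * ip s f + ip s s"
    using assms s by (simp add: ip_diff_left ip_diff_right L2_diff ip_commute[of f s])
  ultimately show ?thesis
    unfolding s_def[symmetric]
    by (simp add: power2_diff sum.distrib sum_subtractf sum_distrib_left algebra_simps)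
qed

lemma Bessel_inequality:
  assumes "f \<in> L2"
  shows "(\<Sum>n=1..K. (ip f (eigfun n))\<^sup>2) \<le> ip f f"
  using L2_distance_sine_poly[OF assms, where K = K and a = "\<lambda>n. ip f (eigfun n)"]
    ip_self_nonneg[of "\<lambda>x. f x - (\<Sum>n=1..K. ip f (eigfun n) * eigfun n x)"] by simp

text \<open>Finite linear combinations of the eigenfunctions, characterised by being equal to their own sine
  partial sums from some index on. In this form, closure under linear combinations is the linearity of
  the coefficients.\<close>

definition sine_poly :: "(real \<Rightarrow> real) set" where
  "sine_poly = {p \<in> L2. \<exists>K0. \<forall>K\<ge>K0. \<forall>x. p x = (\<Sum>n=1..K. ip p (eigfun n) * eigfun n x)}"

lemma sine_poly_lincomb:
  assumes "p \<in> sine_poly" "q \<in> sine_poly"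
  shows "(\<lambda>x. a * p x + b * q x) \<in> sine_poly"
proof -
  have L: "p \<in> L2" "q \<in> L2" using assms by (auto simp: sine_poly_def)
  obtain K1 K2 where K: "\<And>K x. K1 \<le> K \<Longrightarrow> p x = (\<Sum>n=1..K. ip p (eigfun n) * eigfun n x)"
     "\<And>K x. K2 \<le> K \<Longrightarrow> q x = (\<Sum>n=1..K. ip q (eigfun n) * eigfun n x)"
    using assms unfolding sine_poly_def by blast
  have "a * p x + b * q x = (\<Sum>n=1..K. ip (\<lambda>x. a * p x + b * q x) (eigfun n) * eigfun n x)"
    if "max K1 K2 \<le> K" for K x
  proof -
    have "(\<Sum>n=1..K. ip (\<lambda>x. a * p x + b * q x) (eigfun n) * eigfun n x)
      = a * (\<Sum>n=1..K. ip p (eigfun n) * eigfun n x) + b * (\<Sum>n=1..K. ip q (eigfun n) * eigfun n x)"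
      by (simp add: ip_lincomb_left L eigfun_L2 sum.distrib sum_distrib_left distrib_right mult.assoc)
    also have "\<dots> = a * p x + b * q x"
      using K(1)[of K x] K(2)[of K x] that by simp
    finally show ?thesis by simp
  qed
  then show ?thesis
    unfolding sine_poly_def using L2_lincomb[OF L] by blast
qed

lemma zero_sine_poly: "(\<lambda>x. 0) \<in> sine_poly"
  by (auto simp: sine_poly_def L2_zero ip_def)

lemma eigfun_sine_poly: "eigfun n \<in> sine_poly"
proof (cases "n = 0")
  case True
  then have "eigfun n = (\<lambda>x. 0)" by (auto simp: eigfun_def)
  then show ?thesis by (simp add: zero_sine_poly)
next
  case False
  have "eigfun n x = (\<Sum>m=1..K. ip (eigfun n) (eigfun m) * eigfun m x)" if "n \<le> K" for K x
  proof -
    have "(\<Sum>m=1..K. ip (eigfun n) (eigfun m) * eigfun m x) = (\<Sum>m=1..K. if m = n then eigfun m x else 0)"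
      by (rule sum.cong) (use False in \<open>auto simp: ip_eigfun_eigfun\<close>)
    then show ?thesis using that False by simp
  qed
  then show ?thesis unfolding sine_poly_def using eigfun_L2 by blast
qed

lemma sine_poly_sum:
  "(\<And>i. i \<in> I \<Longrightarrow> p i \<in> sine_poly) \<Longrightarrow> (\<lambda>x. \<Sum>i\<in>I. a i * p i x) \<in> sine_poly"
proof (induction I rule: infinite_finite_induct)
  case (insert i I)
  then have "(\<lambda>x. a i * p i x + 1 * (\<Sum>i\<in>I. a i * p i x)) \<in> sine_poly"
    by (intro sine_poly_lincomb) auto
  with insert show ?case by simp
qed (auto simp: zero_sine_poly)

text \<open>Induction with the formula \<open>2 sin((n+1)x) cos x = sin((n+2)x) + sin(n x)\<close>. For \<open>n = 0\<close> the last term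
  vanishes, so that lowering the index never leaves the class.\<close>

lemma eigfun_cos_power_sine_poly: "(\<lambda>x. eigfun (Suc n) x * cos x ^ k) \<in> sine_poly"
proof (induction k arbitrary: n)
  case 0
  show ?case by (simp add: eigfun_sine_poly)
next
  case (Suc k)
  have gen: "a = s * c + k * d \<Longrightarrow> b = s * c - k * d \<Longrightarrow> s * c = (a + b) / 2" for a b s c k d :: real
    by simp
  have prod: "eigfun (Suc n) x * cos x = 1/2 * eigfun (Suc (Suc n)) x + 1/2 * eigfun n x" for x
  proof -
    have "sin (real (Suc (Suc n)) * x) = sin (real (Suc n) * x) * cos x + cos (real (Suc n) * x) * sin x"
      using sin_add[of "real (Suc n) * x" x] by (simp add: algebra_simps)
    moreover have "sin (real n * x) = sin (real (Suc n) * x) * cos x - cos (real (Suc n) * x) * sin x"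
      using sin_diff[of "real (Suc n) * x" x] by (simp add: algebra_simps)
    ultimately have "sin (real (Suc n) * x) * cos x = (sin (real (Suc (Suc n)) * x) + sin (real n * x)) / 2"
      by (rule gen)
    then show ?thesis unfolding eigfun_def mult.assoc by (simp only:) (simp add: field_simps)
  qed
  have lower: "(\<lambda>x. eigfun n x * cos x ^ k) \<in> sine_poly"
  proof (cases n)
    case 0
    then show ?thesis by (simp add: eigfun_def zero_sine_poly)
  next
    case (Suc m)
    then show ?thesis using Suc.IH by blast
  qed
  have "(\<lambda>x. 1/2 * (eigfun (Suc (Suc n)) x * cos x ^ k) + 1/2 * (eigfun n x * cos x ^ k)) \<in> sine_poly"
    by (rule sine_poly_lincomb[OF Suc.IH lower])
  moreover have "1/2 * (eigfun (Suc (Suc n)) x * cos x ^ k) + 1/2 * (eigfun n x * cos x ^ k)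
      = eigfun (Suc n) x * cos x ^ Suc k" for x
    using prod[of x] by (simp add: algebra_simps flip: mult.assoc)
  ultimately show ?case by simp
qed

lemma sin_poly_cos_sine_poly:
  assumes "real_polynomial_function q"
  shows "(\<lambda>x. sin x * q (cos x)) \<in> sine_poly"
proof -
  obtain a n where q: "q = (\<lambda>y. \<Sum>i\<le>n. a i * y ^ i)"
    using assms by (auto simp: real_polynomial_function_iff_sum)
  have "(\<lambda>x. \<Sum>i\<le>n. (a i / sqrt (2 / pi)) * (eigfun (Suc 0) x * cos x ^ i)) \<in> sine_poly"
    by (intro sine_poly_sum eigfun_cos_power_sine_poly)
  moreover have "(\<Sum>i\<le>n. (a i / sqrt (2 / pi)) * (eigfun (Suc 0) x * cos x ^ i)) = sin x * q (cos x)" for x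
    unfolding q eigfun_def by (simp add: sum_distrib_left mult.left_commute)
  ultimately show ?thesis by simp
qed

lemma L2norm_le_bound:
  assumes "f \<in> L2" "\<And>x. x \<in> {0<..<pi} \<Longrightarrow> \<bar>f x\<bar> \<le> e" "e \<ge> 0"
  shows "L2norm f \<le> e * sqrt pi"
proof -
  have "ip f f \<le> integral\<^sup>L Ipi (\<lambda>x. e * e)"
    unfolding ip_def
  proof (rule integral_mono_AE)
    have "f x * f x \<le> e * e" if "x \<in> {0<..<pi}" for x
      using mult_mono[OF assms(2,2)[OF that]] assms(3) by (simp add: abs_mult_self_eq)
    then show "AE x in Ipi. f x * f x \<le> e * e" by (intro AE_I2) simp
    show "integrable Ipi (\<lambda>x. f x * f x)" by (rule L2_mult_integrable[OF assms(1,1)])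
    show "integrable Ipi (\<lambda>x. e * e)" by (intro continuous_integrable_Ipi continuous_intros)
  qed
  also have "\<dots> = e * e * pi" by (simp add: measure_restrict_space)
  finally have "L2norm f \<le> sqrt (e * e * pi)" unfolding L2norm_def by (rule real_sqrt_le_mono)
  then show ?thesis using assms(3) by (simp add: real_sqrt_mult)
qed

text \<open>A continuous function is \<open>L\<^sup>2\<close>-close to one divisible by \<open>sin x\<close>, and Weierstrass' theorem in the
  variable \<open>cos x\<close> approximates the quotient uniformly.\<close>

lemma continuous_sine_poly_approx:
  assumes g: "continuous_on {0..pi} g" and "e > 0"
  obtains p where "p \<in> sine_poly" "L2norm (\<lambda>x. g x - p x) < e"
proof -
  define \<delta> where "\<delta> n = inverse (real (Suc n))" for n
  have \<delta>: "\<delta> n > 0" for n by (simp add: \<delta>_def)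
  (* Regularised quotient of g by sin, finite also at the end points where sin vanishes:
     sin x * h n x is g x times sin^2 x / (sin^2 x + delta n), a factor tending to 1. *)
  define h where "h n x = g x * sin x / ((sin x)\<^sup>2 + \<delta> n)" for n x
  have den: "(sin x)\<^sup>2 + \<delta> n \<noteq> 0" for n x
    using \<delta>[of n] by (metis add_nonneg_pos less_irrefl zero_le_power2)
  have h: "continuous_on {0..pi} (h n)" for n
    unfolding h_def[abs_def] by (intro continuous_intros g) (use den in auto)
  have hs: "continuous_on {0..pi} (\<lambda>x. g x - sin x * h n x)" for n
    by (intro continuous_intros g h)
  have "bounded (g ` {0..pi})"
    using g compact_continuous_image compact_imp_bounded by blast
  then obtain b where b: "\<And>x. x \<in> {0..pi} \<Longrightarrow> \<bar>g x\<bar> \<le> b" by (force simp: bounded_iff)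
  have gs: "g x - sin x * h n x = g x * (\<delta> n / ((sin x)\<^sup>2 + \<delta> n))" for n x
    unfolding h_def using den[of x n] by (simp add: field_simps power2_eq_square)
  have "(\<lambda>n. integral\<^sup>L Ipi (\<lambda>x. (g x - sin x * h n x) * (g x - sin x * h n x))) \<longlonglongrightarrow> integral\<^sup>L Ipi (\<lambda>x. 0)"
  proof (rule integral_dominated_convergence[where w = "\<lambda>x. b * b"])
    show "(\<lambda>x. (g x - sin x * h n x) * (g x - sin x * h n x)) \<in> borel_measurable Ipi" for n
      using L2_mult_integrable[OF continuous_L2[OF hs] continuous_L2[OF hs]] by blast
    show "AE x in Ipi. norm ((g x - sin x * h n x) * (g x - sin x * h n x)) \<le> b * b" for n
    proof (rule AE_I2)
      fix x assume "x \<in> space Ipi"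
      then have x: "x \<in> {0..pi}" by auto
      have "\<bar>\<delta> n / ((sin x)\<^sup>2 + \<delta> n)\<bar> \<le> 1"
        using \<delta>[of n] by (simp add: add_nonneg_pos)
      then have "\<bar>g x - sin x * h n x\<bar> \<le> b * 1"
        unfolding gs abs_mult using b[OF x] by (intro mult_mono) auto
      then show "norm ((g x - sin x * h n x) * (g x - sin x * h n x)) \<le> b * b"
        unfolding real_norm_def abs_mult by (intro mult_mono) auto
    qed
    show "AE x in Ipi. (\<lambda>n. (g x - sin x * h n x) * (g x - sin x * h n x)) \<longlonglongrightarrow> 0"
    proof (rule AE_I2)
      fix x assume "x \<in> space Ipi"
      then have "sin x > 0" by (auto intro: sin_gt_zero)
      moreover have "\<delta> \<longlonglongrightarrow> 0" unfolding \<delta>_def[abs_def] by (rule LIMSEQ_inverse_real_of_nat)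
      ultimately have "(\<lambda>n. g x * (\<delta> n / ((sin x)\<^sup>2 + \<delta> n)) * (g x * (\<delta> n / ((sin x)\<^sup>2 + \<delta> n))))
          \<longlonglongrightarrow> g x * (0 / ((sin x)\<^sup>2 + 0)) * (g x * (0 / ((sin x)\<^sup>2 + 0)))"
        by (intro tendsto_intros) auto
      then show "(\<lambda>n. (g x - sin x * h n x) * (g x - sin x * h n x)) \<longlonglongrightarrow> 0"
        unfolding gs by simp
    qed
    show "integrable Ipi (\<lambda>x. b * b)"
      by (intro continuous_integrable_Ipi continuous_intros)
  qed simp
  then have "(\<lambda>n. sqrt (ip (\<lambda>x. g x - sin x * h n x) (\<lambda>x. g x - sin x * h n x))) \<longlonglongrightarrow> sqrt 0"
    unfolding ip_def by (intro tendsto_real_sqrt) simp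
  then have "(\<lambda>n. L2norm (\<lambda>x. g x - sin x * h n x)) \<longlonglongrightarrow> 0"
    by (simp add: L2norm_def)
  then have "\<forall>\<^sub>F n in sequentially. L2norm (\<lambda>x. g x - sin x * h n x) < e / 2"
    by (rule order_tendstoD) (use \<open>e > 0\<close> in simp)
  then obtain n where n: "L2norm (\<lambda>x. g x - sin x * h n x) < e / 2"
    by (auto simp: eventually_sequentially)
  (* Uniform closeness e' costs at most e' * sqrt pi = e / 4 in the L^2 norm. *)
  define e' where "e' = e / 2 / sqrt pi / 2"
  have e': "e' > 0" using \<open>e > 0\<close> by (simp add: e'_def)
  have "continuous_on {-1..1} (\<lambda>y. h n (arccos y))"
    by (intro continuous_on_compose2[OF h[of n]] continuous_on_arccos continuous_on_id)
       (auto intro: arccos_lbound arccos_ubound)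
  then obtain q where q: "real_polynomial_function q" "\<And>y. y \<in> {-1..1} \<Longrightarrow> \<bar>h n (arccos y) - q y\<bar> < e'"
    using Stone_Weierstrass_real_polynomial_function[of "{-1..1::real}" "\<lambda>y. h n (arccos y)" e'] e'
    by auto
  define p where "p x = sin x * q (cos x)" for x
  have p: "p \<in> sine_poly" unfolding p_def[abs_def] by (rule sin_poly_cos_sine_poly[OF q(1)])
  then have pL: "p \<in> L2" by (simp add: sine_poly_def)
  have sL: "(\<lambda>x. sin x * h n x) \<in> L2" by (intro continuous_L2 continuous_intros h)
  have gL: "g \<in> L2" by (rule continuous_L2[OF g])
  have "L2norm (\<lambda>x. sin x * h n x - p x) \<le> e' * sqrt pi"
  proof (rule L2norm_le_bound)
    fix x assume x: "x \<in> {0<..<pi}"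
    then have "\<bar>h n x - q (cos x)\<bar> \<le> e'"
      using q(2)[of "cos x"] by (simp add: arccos_cos less_imp_le)
    then have "\<bar>sin x\<bar> * \<bar>h n x - q (cos x)\<bar> \<le> 1 * e'"
      by (intro mult_mono) auto
    then show "\<bar>sin x * h n x - p x\<bar> \<le> e'"
      by (simp add: p_def right_diff_distrib flip: abs_mult)
  qed (use e' pL sL in \<open>auto intro: L2_diff\<close>)
  also have "\<dots> < e / 2" using \<open>e > 0\<close> by (simp add: e'_def)
  finally have "L2norm (\<lambda>x. (g x - sin x * h n x) + (sin x * h n x - p x)) < e"
    using L2norm_triangle[OF L2_diff[OF gL sL] L2_diff[OF sL pL]] n by linarith
  with p that show ?thesis by simp
qed

text \<open>The partial sums of \<open>f\<close> are best approximations; once they have as many terms as a sine polynomial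
  near \<open>f\<close>, they are at least as close to \<open>f\<close> as that polynomial.\<close>

lemma Parseval_if_continuous_approx:
  assumes f: "f \<in> L2"
    and approx: "\<And>e. e > 0 \<Longrightarrow> \<exists>g. continuous_on {0..pi} g \<and> L2norm (\<lambda>x. f x - g x) < e"
  shows "(\<lambda>K. \<Sum>n=1..K. (ip f (eigfun n))\<^sup>2) \<longlonglongrightarrow> (L2norm f)\<^sup>2"
proof (rule LIMSEQ_I)
  fix e :: real assume "e > 0"
  define d where "d = sqrt e / 2"
  have d: "d > 0" using \<open>e > 0\<close> by (simp add: d_def)
  obtain g where g: "continuous_on {0..pi} g" "L2norm (\<lambda>x. f x - g x) < d"
    using approx[OF d] by blast
  obtain p where p: "p \<in> sine_poly" "L2norm (\<lambda>x. g x - p x) < d"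
    using continuous_sine_poly_approx[OF g(1) d] by blast
  have L: "g \<in> L2" "p \<in> L2" using g p by (auto simp: continuous_L2 sine_poly_def)
  have "L2norm (\<lambda>x. (f x - g x) + (g x - p x)) < sqrt e"
    using L2norm_triangle[OF L2_diff[OF f L(1)] L2_diff[OF L]] g(2) p(2)
    by (simp add: d_def)
  then have "L2norm (\<lambda>x. f x - p x) < sqrt e" by simp
  then have fp: "ip (\<lambda>x. f x - p x) (\<lambda>x. f x - p x) < e"
    by (simp add: L2norm_def)
  obtain K0 where K0: "\<And>K x. K \<ge> K0 \<Longrightarrow> p x = (\<Sum>n=1..K. ip p (eigfun n) * eigfun n x)"
    using p(1) unfolding sine_poly_def by blast
  have "norm ((\<Sum>n=1..K. (ip f (eigfun n))\<^sup>2) - (L2norm f)\<^sup>2) < e" if "K \<ge> K0" for K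
  proof -
    have "ip (\<lambda>x. f x - p x) (\<lambda>x. f x - p x) = ip f f - (\<Sum>n=1..K. (ip f (eigfun n))\<^sup>2)
        + (\<Sum>n=1..K. (ip p (eigfun n) - ip f (eigfun n))\<^sup>2)"
      using L2_distance_sine_poly[OF f, where K = K and a = "\<lambda>n. ip p (eigfun n)"]
      unfolding K0[OF that, symmetric] .
    moreover have "0 \<le> (\<Sum>n=1..K. (ip p (eigfun n) - ip f (eigfun n))\<^sup>2)"
      by (rule sum_nonneg) simp
    ultimately show ?thesis
      using fp Bessel_inequality[OF f, of K] by (simp add: L2norm_power2)
  qed
  then show "\<exists>K0. \<forall>K\<ge>K0. norm ((\<Sum>n=1..K. (ip f (eigfun n))\<^sup>2) - (L2norm f)\<^sup>2) < e" by blast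
qed

text \<open>The identity holds for smooth functions with the boundary conditions, and both sides are continuous
  in the Sobolev norm, so it extends to the closure.\<close>

lemma ip_wd2_eigfun:
  assumes f: "f \<in> H_BC 2" and n: "n \<ge> 1"
  shows "ip (wd 2 f) (eigfun n) = - (real n)\<^sup>2 * ip f (eigfun n)"
proof -
  have L: "f \<in> L2" "wd 2 f \<in> L2"
    using H_BC_sobolev[OF f] by (auto intro: sobolev_L2 wd_sobolev)
  have "\<bar>ip (wd 2 f) (eigfun n) + (real n)\<^sup>2 * ip f (eigfun n)\<bar> \<le> 0 + e" if "e > 0" for e
  proof -
    define d where "d = e / (1 + (real n)\<^sup>2)"
    have "d > 0" using that by (simp add: d_def add_pos_nonneg)
    then obtain g where g: "g \<in> smooth_BC" "L2norm (\<lambda>x. f x - g x) < d"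
      "L2norm (\<lambda>x. wd 2 f x - (deriv ^^ 2) g x) < d"
      using H_BC_smooth_approx[OF f] by (metis order_refl)
    have gL: "g \<in> L2" "(deriv ^^ 2) g \<in> L2"
      using g(1) by (auto simp: smooth_BC_def intro: smooth_L2 smooth_funpow_deriv
          simp del: funpow.simps)
    have "\<bar>ip (\<lambda>x. wd 2 f x - (deriv ^^ 2) g x) (eigfun n)\<bar> \<le> d"
         "\<bar>ip (\<lambda>x. f x - g x) (eigfun n)\<bar> \<le> d"
      using ip_Cauchy_Schwarz[OF L2_diff[OF L(2) gL(2)] eigfun_L2, of n]
        ip_Cauchy_Schwarz[OF L2_diff[OF L(1) gL(1)] eigfun_L2, of n] g L2norm_eigfun[OF n] by auto
    then have a: "\<bar>ip (wd 2 f) (eigfun n) - ip ((deriv ^^ 2) g) (eigfun n)\<bar> \<le> d"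
         and b: "\<bar>ip f (eigfun n) - ip g (eigfun n)\<bar> \<le> d"
      using L gL by (simp_all add: ip_diff_left eigfun_L2)
    have "\<bar>(real n)\<^sup>2 * (ip f (eigfun n) - ip g (eigfun n))\<bar> \<le> (real n)\<^sup>2 * d"
      unfolding abs_mult using b by (intro mult_mono) auto
    then have "\<bar>ip (wd 2 f) (eigfun n) + (real n)\<^sup>2 * ip f (eigfun n)\<bar> \<le> d + (real n)\<^sup>2 * d"
      using a unfolding ip_deriv2_eigfun[OF g(1)] by (simp add: right_diff_distrib)
    also have "\<dots> = d * (1 + (real n)\<^sup>2)" by (simp add: algebra_simps)
    also have "\<dots> = e" unfolding d_def by (simp add: add_pos_nonneg[THEN less_imp_neq, symmetric])
    finally show ?thesis by simp
  qed
  then have "\<bar>ip (wd 2 f) (eigfun n) + (real n)\<^sup>2 * ip f (eigfun n)\<bar> \<le> 0"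
    by (rule field_le_epsilon)
  then show ?thesis by simp
qed

lemma Parseval_H_BC:
  assumes f: "f \<in> H_BC 2"
  shows "(\<lambda>K. \<Sum>n=1..K. (ip f (eigfun n))\<^sup>2) \<longlonglongrightarrow> (L2norm f)\<^sup>2"
    and "(\<lambda>K. \<Sum>n=1..K. (omega n)\<^sup>2 * (ip f (eigfun n))\<^sup>2) \<longlonglongrightarrow> (L2norm (wd 2 f))\<^sup>2"
proof -
  have L: "f \<in> L2" "wd 2 f \<in> L2"
    using H_BC_sobolev[OF f] by (auto intro: sobolev_L2 wd_sobolev)
  have cont: "continuous_on {0..pi} g" "continuous_on {0..pi} ((deriv ^^ 2) g)"
    if "g \<in> smooth_BC" for g
    using that by (auto simp: smooth_BC_def intro!: smooth_continuous_on smooth_funpow_deriv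
        simp del: funpow.simps)
  show "(\<lambda>K. \<Sum>n=1..K. (ip f (eigfun n))\<^sup>2) \<longlonglongrightarrow> (L2norm f)\<^sup>2"
  proof (rule Parseval_if_continuous_approx[OF L(1)])
    fix e :: real assume "e > 0"
    then show "\<exists>g. continuous_on {0..pi} g \<and> L2norm (\<lambda>x. f x - g x) < e"
      using H_BC_smooth_approx[OF f] cont(1) by metis
  qed
  have "(\<lambda>K. \<Sum>n=1..K. (ip (wd 2 f) (eigfun n))\<^sup>2) \<longlonglongrightarrow> (L2norm (wd 2 f))\<^sup>2"
  proof (rule Parseval_if_continuous_approx[OF L(2)])
    fix e :: real assume "e > 0"
    then show "\<exists>g. continuous_on {0..pi} g \<and> L2norm (\<lambda>x. wd 2 f x - g x) < e"
      using H_BC_smooth_approx[OF f] cont(2) by (metis order_refl)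
  qed
  moreover have "(\<Sum>n=1..K. (ip (wd 2 f) (eigfun n))\<^sup>2)
      = (\<Sum>n=1..K. (omega n)\<^sup>2 * (ip f (eigfun n))\<^sup>2)" for K
    by (rule sum.cong) (auto simp: ip_wd2_eigfun[OF f] omega_def power_mult_distrib)
  ultimately show "(\<lambda>K. \<Sum>n=1..K. (omega n)\<^sup>2 * (ip f (eigfun n))\<^sup>2) \<longlonglongrightarrow> (L2norm (wd 2 f))\<^sup>2"
    by simp
qed

section \<open>The gain of a damped oscillator\<close>

text \<open>For the oscillator \<open>z'' + a z' + k z = v\<close> this is the minimum over \<open>\<theta> \<ge> 0\<close> of \<open>(k - \<theta>\<^sup>2)\<^sup>2 + a\<^sup>2 \<theta>\<^sup>2\<close>, the
  reciprocal of the squared \<open>H\<^sub>\<infinity>\<close> norm from \<open>v\<close> to \<open>z\<close>. In the first case it is attained at the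
  resonance \<open>\<theta>\<^sup>2 = k - a\<^sup>2/2\<close>, in the second at \<open>\<theta> = 0\<close>.\<close>

definition mode_gain :: "real \<Rightarrow> real \<Rightarrow> real" where
  "mode_gain a k = (if a\<^sup>2 \<le> 2 * k then k * a\<^sup>2 - a ^ 4 / 4 else k\<^sup>2)"

text \<open>Expanding \<open>v\<^sup>2 = (z'' + a z' + k z)\<^sup>2\<close>, the mixed products are exact derivatives up to squares; the
  storage collects these derivatives, and the coefficient of \<open>p q\<close> is chosen so that the squares left
  over have nonnegative coefficients.\<close>

definition mode_storage :: "real \<Rightarrow> real \<Rightarrow> real \<Rightarrow> real \<Rightarrow> real" where
  "mode_storage a k p q = a * q\<^sup>2 + a * k * p\<^sup>2 + (if a\<^sup>2 \<le> 2 * k then a\<^sup>2 else 2 * k) * (p * q)"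

lemma mode_storage_nonneg:
  assumes "a > 0" "k > 0"
  shows "0 \<le> mode_storage a k p q"
proof (cases "a\<^sup>2 \<le> 2 * k")
  case True
  have "a * (4 * k - a\<^sup>2) * p\<^sup>2 \<ge> 0"
    using assms True by (intro mult_nonneg_nonneg) auto
  moreover have "4 * mode_storage a k p q = a * (2 * q + a * p)\<^sup>2 + a * (4 * k - a\<^sup>2) * p\<^sup>2"
    using True by (simp add: mode_storage_def power2_eq_square algebra_simps)
  moreover have "a * (2 * q + a * p)\<^sup>2 \<ge> 0" using assms by simp
  ultimately show ?thesis by linarith
next
  case False
  have "a * mode_storage a k p q = (a * q + k * p)\<^sup>2 + k * (a\<^sup>2 - k) * p\<^sup>2"
    using False by (simp add: mode_storage_def power2_eq_square algebra_simps)
  moreover have "k * (a\<^sup>2 - k) * p\<^sup>2 \<ge> 0"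
    using assms False by (intro mult_nonneg_nonneg) auto
  ultimately have "a * mode_storage a k p q \<ge> 0" by simp
  then show ?thesis using assms by (simp add: zero_le_mult_iff)
qed

text \<open>With \<open>p, q, y\<close> for position, velocity and acceleration, all terms on the left except the last one form
  the time derivative of the storage. The defect of the inequality is \<open>(y + (k - a\<^sup>2/2) p)\<^sup>2\<close> in the
  resonant case and \<open>y\<^sup>2 + (a\<^sup>2 - 2 k) q\<^sup>2\<close> otherwise.\<close>

lemma mode_dissipation:
  assumes "y + a * q + k * p = v"
  shows "2 * a * q * y + 2 * a * k * p * q + (if a\<^sup>2 \<le> 2 * k then a\<^sup>2 else 2 * k) * (q\<^sup>2 + p * y)
    + mode_gain a k * p\<^sup>2 \<le> v\<^sup>2"
proof (cases "a\<^sup>2 \<le> 2 * k")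
  case True
  have "v\<^sup>2 - (2 * a * q * y + 2 * a * k * p * q + a\<^sup>2 * (q\<^sup>2 + p * y) + (k * a\<^sup>2 - a ^ 4 / 4) * p\<^sup>2)
     = (y + (k - a\<^sup>2 / 2) * p)\<^sup>2"
    unfolding assms[symmetric] by (simp add: power2_eq_square power4_eq_xxxx algebra_simps) 
  then show ?thesis using True by (simp add: mode_gain_def) (smt (verit) zero_le_power2)
next
  case False
  have "v\<^sup>2 - (2 * a * q * y + 2 * a * k * p * q + 2 * k * (q\<^sup>2 + p * y) + k\<^sup>2 * p\<^sup>2)
     = y\<^sup>2 + (a\<^sup>2 - 2 * k) * q\<^sup>2"
    unfolding assms[symmetric] by (simp add: power2_eq_square algebra_simps)
  moreover have "0 \<le> (a\<^sup>2 - 2 * k) * q\<^sup>2"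
    using False by (intro mult_nonneg_nonneg) auto
  moreover have "0 \<le> y\<^sup>2" by simp
  ultimately have "2 * a * q * y + 2 * a * k * p * q + 2 * k * (q\<^sup>2 + p * y) + k\<^sup>2 * p\<^sup>2 \<le> v\<^sup>2"
    by linarith
  then show ?thesis using False by (simp add: mode_gain_def)
qed

text \<open>Cauchy--Schwarz with the conjugate factors \<open>g / d\<close> on \<open>b u\<close> and \<open>g \<gamma>\<^sup>2 / k\<close> on \<open>w\<close>, where
  \<open>d = g - k / \<gamma>\<^sup>2\<close>; it is this splitting that produces the weight \<open>b\<^sup>2 k / d\<close> of the control.\<close>

lemma weighted_input_bound:
  fixes b u w g k \<gamma> :: real
  assumes "\<gamma> > 0" "k > 0" "g - k / \<gamma>\<^sup>2 > 0"
  shows "k / g * (b * u + w)\<^sup>2 \<le> b\<^sup>2 * k / (g - k / \<gamma>\<^sup>2) * u\<^sup>2 + \<gamma>\<^sup>2 * w\<^sup>2"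
proof -
  define d where "d = g - k / \<gamma>\<^sup>2"
  define h where "h = \<gamma>\<^sup>2"
  have h: "h > 0" and d: "d > 0" and g: "g = d + k / h"
    using assms by (auto simp: d_def h_def)
  have gpos: "g > 0" using d assms(2) h by (simp add: g add_pos_pos)
  have "d * g * (b\<^sup>2 * k / d * u\<^sup>2 + h * w\<^sup>2 - k / g * (b * u + w)\<^sup>2)
     = b\<^sup>2 * k * u\<^sup>2 * g + d * g * h * w\<^sup>2 - d * k * (b * u + w)\<^sup>2"
    using d gpos by (simp add: field_simps)
  also have "\<dots> = h * (k * (b * u) / h - d * w)\<^sup>2"
    unfolding g using h by (simp add: field_simps power2_eq_square)
  also have "\<dots> \<ge> 0" using h by simp
  finally have "0 \<le> b\<^sup>2 * k / d * u\<^sup>2 + h * w\<^sup>2 - k / g * (b * u + w)\<^sup>2"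
    using mult_le_cancel_left_pos[OF mult_pos_pos[OF d gpos], of 0] by (simp only: mult_zero_right)
  then show ?thesis by (simp add: d_def h_def)
qed

section \<open>The weights of the uncontrolled modes\<close>

lemma omega_pos: "n \<ge> 1 \<Longrightarrow> omega n > 0"
  by (simp add: omega_def)

text \<open>The two cases in the definition of \<open>\<rho>\<^sub>n\<close> are the resonant and the non-resonant case for
  \<open>a = 2 \<zeta> \<omega>\<close> and \<open>k = \<omega>\<^sup>2\<close>.\<close>

lemma rho_den_mode_gain:
  assumes "n \<ge> 1"
  shows "rho_den c1 c2 rx \<gamma> n
    = mode_gain (c1 + c2 * (omega n)\<^sup>2) ((omega n)\<^sup>2) - (1 + rx * (omega n)\<^sup>2) / \<gamma>\<^sup>2"
proof -
  define o' where "o' = omega n"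
  define z where "z = zeta c1 c2 n"
  have o: "o' > 0" using omega_pos[OF assms] by (simp add: o'_def)
  have a: "c1 + c2 * o'\<^sup>2 = 2 * z * o'"
    using o unfolding z_def zeta_def o'_def[symmetric] by (simp add: field_simps power2_eq_square)
  have "(2 * z * o')\<^sup>2 \<le> 2 * o'\<^sup>2 \<longleftrightarrow> o'\<^sup>2 * (4 * z\<^sup>2) \<le> o'\<^sup>2 * 2"
    by (simp add: power_mult_distrib mult.commute)
  also have "\<dots> \<longleftrightarrow> 2 * z\<^sup>2 \<le> 1" using o by (subst mult_le_cancel_left_pos) auto
  finally have iff: "(2 * z * o')\<^sup>2 \<le> 2 * o'\<^sup>2 \<longleftrightarrow> 2 * z\<^sup>2 \<le> 1" .
  have "o'\<^sup>2 * (2 * z * o')\<^sup>2 - (2 * z * o') ^ 4 / 4 = 4 * o' ^ 4 * z\<^sup>2 * (1 - z\<^sup>2)"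
    by (simp add: power2_eq_square power4_eq_xxxx algebra_simps)
  moreover have "(o'\<^sup>2)\<^sup>2 = o' ^ 4" by simp
  ultimately show ?thesis
    unfolding rho_den_def mode_gain_def o'_def[symmetric] z_def[symmetric] a iff by simp
qed

lemma integral_Ipi_indicator_FTC:
  assumes "0 < a" "a < b" "b < pi"
    and F: "\<And>x. (F has_real_derivative f x) (at x)" and f: "continuous_on UNIV f"
  shows "integral\<^sup>L Ipi (\<lambda>x. indicator {a<..<b} x * f x) = F b - F a"
proof -
  have "integrable Ipi f"
    by (rule continuous_integrable_Ipi) (use f continuous_on_subset in blast)
  then have int: "integrable Ipi (\<lambda>x. indicator {a<..<b} x * f x)"
    by (rule Bochner_Integration.integrable_bound)
       (use \<open>integrable Ipi f\<close> indicator_Ioo_measurable_Ipi[of a b] in \<open>auto split: split_indicator\<close>)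
  have "(f has_integral F b - F a) {a..b}"
    using F assms(2) by (intro fundamental_theorem_of_calculus)
       (auto simp: has_real_derivative_iff_has_vector_derivative[symmetric]
             intro: has_field_derivative_at_within)
  then have "(f has_integral F b - F a) {a<..<b}"
    using has_integral_open_interval[of f _ a b] by simp
  moreover have "{a<..<b} \<subseteq> {0<..<pi}" using assms by auto
  ultimately have "((\<lambda>x. if x \<in> {a<..<b} then f x else 0) has_integral F b - F a) {0<..<pi}"
    by (simp only: has_integral_restrict)
  then have "((\<lambda>x. indicator {a<..<b} x * f x) has_integral F b - F a) {0<..<pi}"
    by (rule has_integral_eq[rotated]) auto
  moreover have "((\<lambda>x. indicator {a<..<b} x * f x) has_integral
      integral\<^sup>L Ipi (\<lambda>x. indicator {a<..<b} x * f x)) {0<..<pi}"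
    by (rule has_integral_integral_lebesgue_on[OF int]) simp
  ultimately show ?thesis by (rule has_integral_unique[symmetric])
qed

text \<open>Up to sign, the numbers \<open>b\<^sub>n / \<omega>\<^sub>n\<close> are the sine coefficients of the indicator of \<open>(x\<^sub>L, x\<^sub>R)\<close>, whose
  squared norm is the length of the interval.\<close>

lemma bcoef_Bessel:
  assumes "0 < xL" "xL < xR" "xR < pi"
  shows "(\<Sum>n=1..K. (bcoef xL xR n)\<^sup>2 / (omega n)\<^sup>2) \<le> \<bar>xR - xL\<bar>"
proof -
  let ?I = "indicat_real {xL<..<xR}"
  have II: "?I x * ?I x = ?I x * 1" for x by (simp add: indicator_def)
  have nrm: "ip ?I ?I = xR - xL"
    unfolding ip_def II by (rule integral_Ipi_indicator_FTC[OF assms]) auto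
  have "integrable Ipi (\<lambda>x. ?I x * 1)"
    using nrm assms unfolding ip_def II by (metis diff_gt_0_iff_gt less_irrefl not_integrable_integral_eq)
  moreover have "(\<lambda>x. (?I x)\<^sup>2) = (\<lambda>x. ?I x * 1)" by (auto simp: power2_eq_square II)
  ultimately have L: "?I \<in> L2"
    using indicator_Ioo_measurable_Ipi[of xL xR] by (simp add: L2_def)
  have "(\<Sum>n=1..K. (bcoef xL xR n)\<^sup>2 / (omega n)\<^sup>2) = (\<Sum>n=1..K. (ip ?I (eigfun n))\<^sup>2)"
  proof (rule sum.cong[OF refl])
    fix n assume "n \<in> {1..K}"
    then have n: "n \<ge> 1" by simp
    define F where "F x = - sqrt (2 / pi) * cos (real n * x) / real n" for x
    have "ip ?I (eigfun n) = F xR - F xL"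
      unfolding ip_def
    proof (rule integral_Ipi_indicator_FTC[OF assms])
      show "(F has_real_derivative eigfun n x) (at x)" for x
        unfolding F_def eigfun_def using n by (auto intro!: derivative_eq_intros)
      show "continuous_on UNIV (eigfun n)" by (rule smooth_continuous_on[OF smooth_eigfun])
    qed
    also have "\<dots> = - (bcoef xL xR n / omega n)"
      using n unfolding F_def bcoef_def omega_def by (simp add: field_simps power2_eq_square)
    finally show "(bcoef xL xR n)\<^sup>2 / (omega n)\<^sup>2 = (ip ?I (eigfun n))\<^sup>2"
      by (simp add: power_divide)
  qed
  also have "\<dots> \<le> xR - xL" using Bessel_inequality[OF L, of K] nrm by simp
  finally show ?thesis by simp
qed

text \<open>The condition \<open>2 \<zeta>\<^sub>n\<^sup>2 > 1\<close> says \<open>c\<^sub>2 \<omega>\<^sup>2 - \<surd>2 \<omega> + c\<^sub>1 > 0\<close>, and the cutoff bounds \<open>\<omega>\<close> from below by the larger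
  root of this quadratic, which is real because \<open>c\<^sub>1 + c\<^sub>2 \<le> \<surd>2\<close> implies \<open>2 c\<^sub>1 c\<^sub>2 \<le> 1\<close>.\<close>

lemma zeta_above_Mcut:
  assumes c: "c1 > 0" "c2 > 0" "c1 + c2 \<le> sqrt 2" and n: "n > Mcut c1 c2 N"
  shows "2 * (zeta c1 c2 n)\<^sup>2 > 1"
proof -
  have "(c1 + c2)\<^sup>2 \<le> (sqrt 2)\<^sup>2"
    using c by (intro power_mono) auto
  moreover have "(c1 + c2)\<^sup>2 = (c1 - c2)\<^sup>2 + 4 * (c1 * c2)"
    by (simp add: power2_eq_square algebra_simps)
  moreover have "0 \<le> (c1 - c2)\<^sup>2" by simp
  ultimately have "4 * (c1 * c2) \<le> 2" by (simp only: real_sqrt_pow2)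
  then have cc: "0 \<le> 1 - 2 * c1 * c2" by simp
  define s where "s = sqrt (1 - 2 * c1 * c2)"
  define X where "X = (1 + s) / (sqrt 2 * c2)"
  have s: "s \<ge> 0" "s\<^sup>2 = 1 - 2 * c1 * c2" using cc by (auto simp: s_def)
  have X: "X > 0" using s c by (simp add: X_def)
  have "nat \<lfloor>sqrt X\<rfloor> < n" using n by (simp add: Mcut_def X_def s_def)
  then have "sqrt X < real n" by linarith
  then have "X < (real n)\<^sup>2"
    using X by (metis real_sqrt_less_iff real_sqrt_abs abs_of_nat)
  then have o: "omega n > X" by (simp add: omega_def)
  have n1: "omega n > 0" using o X by linarith
  have "sqrt 2 * c2 * X = 1 + s" using c by (simp add: X_def)
  then have "sqrt 2 * c2 * omega n > 1 + s"
    using o c by (smt (verit) mult_strict_left_mono real_sqrt_gt_zero mult_pos_pos)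
  then have "sqrt 2 * c2 * omega n - 1 > s" by linarith
  then have "(sqrt 2 * c2 * omega n - 1)\<^sup>2 > s\<^sup>2"
    using s(1) by (intro power_strict_mono) auto
  moreover have "(sqrt 2 * c2 * omega n - 1)\<^sup>2
      = 2 * c2 * (c2 * (omega n)\<^sup>2) - 2 * c2 * (sqrt 2 * omega n) + 1"
    by (simp add: power2_diff power_mult_distrib) (simp add: power2_eq_square)
  ultimately have "2 * c2 * (c2 * (omega n)\<^sup>2 - sqrt 2 * omega n + c1) > 0"
    unfolding s(2) by (simp add: algebra_simps)
  then have "c2 * (omega n)\<^sup>2 - sqrt 2 * omega n + c1 > 0"
    using c by (simp add: zero_less_mult_iff)
  moreover have "2 * zeta c1 c2 n * omega n = c1 + c2 * (omega n)\<^sup>2"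
    using n1 by (simp add: zeta_def field_simps power2_eq_square)
  ultimately have "sqrt 2 * omega n < 2 * zeta c1 c2 n * omega n" by linarith
  then have "2 * zeta c1 c2 n > sqrt 2"
    using n1 by (simp only: mult_less_cancel_right_pos)
  then have "(2 * zeta c1 c2 n)\<^sup>2 > (sqrt 2)\<^sup>2"
    by (intro power_strict_mono) auto
  then show ?thesis by (simp add: power_mult_distrib)
qed

text \<open>The weight is the reciprocal of \<open>s / (1 + \<rho>\<^sub>x s) - 1 / (h s)\<close>, and both summands increase with \<open>s\<close>. In
  particular one positive denominator makes all later ones positive.\<close>

lemma tail_weight_antimono:
  fixes s s' rx h :: real
  assumes "0 < s" "s \<le> s'" "rx \<ge> 0" "h > 0" "s\<^sup>2 - (1 + rx * s) / h > 0"
  shows "s'\<^sup>2 - (1 + rx * s') / h > 0"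
    and "s' * (1 + rx * s') / (s'\<^sup>2 - (1 + rx * s') / h) \<le> s * (1 + rx * s) / (s\<^sup>2 - (1 + rx * s) / h)"
proof -
  have s': "s' > 0" using assms by simp
  have k: "1 + rx * s > 0" "1 + rx * s' > 0" using assms s' by (auto simp: add_pos_nonneg)
  define f where "f x = x / (1 + rx * x) - 1 / (h * x)" for x
  have q': "x\<^sup>2 - k / h = x * k * (x / k - 1 / (h * x))" if "x > 0" "k > 0" for x k
    using that assms(4) by (simp add: field_simps power2_eq_square)
  have q: "x\<^sup>2 - (1 + rx * x) / h = x * (1 + rx * x) * f x" if "x > 0" "1 + rx * x > 0" for x
    unfolding f_def by (rule q'[OF that])
  have "s / (1 + rx * s) \<le> s' / (1 + rx * s')"
    using k assms by (simp add: divide_simps algebra_simps)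
  moreover have "1 / (h * s') \<le> 1 / (h * s)"
    using assms s' by (intro divide_left_mono) auto
  ultimately have ff: "f s \<le> f s'" unfolding f_def by linarith
  have fs: "f s > 0"
    using assms(5) unfolding q[OF assms(1) k(1)]
    by (rule zero_less_mult_pos) (use assms(1) k(1) in simp)
  show "s'\<^sup>2 - (1 + rx * s') / h > 0"
    unfolding q[OF s' k(2)] using s' k ff fs by simp
  have "s' * (1 + rx * s') / (s' * (1 + rx * s') * f s') = 1 / f s'"
       "s * (1 + rx * s) / (s * (1 + rx * s) * f s) = 1 / f s"
    using s' k assms(1) by auto
  moreover have "1 / f s' \<le> 1 / f s" using ff fs by (intro divide_left_mono) auto
  ultimately show "s' * (1 + rx * s') / (s'\<^sup>2 - (1 + rx * s') / h)
      \<le> s * (1 + rx * s) / (s\<^sup>2 - (1 + rx * s) / h)"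
    unfolding q[OF s' k(2)] q[OF assms(1) k(1)] by simp
qed

context
  fixes c1 c2 xL xR rx \<gamma> :: real and N M :: nat
  assumes c: "c1 > 0" "c2 > 0" "c1 + c2 \<le> sqrt 2"
    and x: "0 < xL" "xL < xR" "xR < pi"
    and rx: "rx \<ge> 0" and \<gamma>: "\<gamma> > 0"
    and M: "M = Mcut c1 c2 N"
    and low: "\<forall>n\<in>{N+1..M}. rho_den c1 c2 rx \<gamma> n > 0"
    and CM: "C_den rx \<gamma> M > 0"
begin

lemma high_mode_weight:
  assumes "n > M"
  shows "rho_den c1 c2 rx \<gamma> n > 0"
    and "rho c1 c2 xL xR rx \<gamma> n \<le> C_M rx \<gamma> M * ((bcoef xL xR n)\<^sup>2 / (omega n)\<^sup>2)"
proof -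
  have z: "\<not> 2 * (zeta c1 c2 n)\<^sup>2 \<le> 1"
    using zeta_above_Mcut[OF c] assms M by fastforce
  define s where "s = (omega (M + 1))\<^sup>2"
  define s' where "s' = (omega n)\<^sup>2"
  have s: "s > 0" using omega_pos[of "M + 1"] by (simp add: s_def)
  have le: "s \<le> s'"
    unfolding s_def s'_def omega_def using assms by (intro power_mono) auto
  have s2: "omega (M + 1) ^ 4 = s\<^sup>2" "omega n ^ 4 = s'\<^sup>2" by (simp_all add: s_def s'_def)
  have h: "\<gamma>\<^sup>2 > 0" using \<gamma> by simp
  have den: "s\<^sup>2 - (1 + rx * s) / \<gamma>\<^sup>2 > 0"
    using CM unfolding C_den_def s2 s_def[symmetric] .
  have rd: "rho_den c1 c2 rx \<gamma> n = s'\<^sup>2 - (1 + rx * s') / \<gamma>\<^sup>2"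
    using z unfolding rho_den_def s2 s'_def by simp
  have mono: "s'\<^sup>2 - (1 + rx * s') / \<gamma>\<^sup>2 > 0"
    "s' * (1 + rx * s') / (s'\<^sup>2 - (1 + rx * s') / \<gamma>\<^sup>2) \<le> s * (1 + rx * s) / (s\<^sup>2 - (1 + rx * s) / \<gamma>\<^sup>2)"
    using tail_weight_antimono[OF s le rx h den] .
  show "rho_den c1 c2 rx \<gamma> n > 0" using mono(1) by (simp add: rd)
  have s': "s' > 0" using s le by simp
  have "rho c1 c2 xL xR rx \<gamma> n
      = s' * (1 + rx * s') / (s'\<^sup>2 - (1 + rx * s') / \<gamma>\<^sup>2) * ((bcoef xL xR n)\<^sup>2 / s')"
    unfolding rho_def rd s'_def[symmetric] using s' by simp
  also have "\<dots> \<le> s * (1 + rx * s) / (s\<^sup>2 - (1 + rx * s) / \<gamma>\<^sup>2) * ((bcoef xL xR n)\<^sup>2 / s')"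
    using s' by (intro mult_right_mono mono(2)) auto
  also have "s * (1 + rx * s) / (s\<^sup>2 - (1 + rx * s) / \<gamma>\<^sup>2) = C_M rx \<gamma> M"
    unfolding C_M_def C_den_def s2 s_def[symmetric] ..
  finally show "rho c1 c2 xL xR rx \<gamma> n \<le> C_M rx \<gamma> M * ((bcoef xL xR n)\<^sup>2 / (omega n)\<^sup>2)"
    by (simp add: s'_def)
qed

lemma rho_den_pos: "n > N \<Longrightarrow> rho_den c1 c2 rx \<gamma> n > 0"
  using low high_mode_weight(1)[of n] by (cases "n \<le> M") auto

lemma rho_nonneg: "n > N \<Longrightarrow> rho c1 c2 xL xR rx \<gamma> n \<ge> 0"
  using rho_den_pos[of n] rx unfolding rho_def
  by (intro divide_nonneg_pos mult_nonneg_nonneg) auto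

text \<open>Up to the cutoff the \<open>\<rho>\<^sub>n\<close> occur individually in \<open>\<rho>\<^sub>\<infinity>\<close>; the bracket multiplying \<open>C\<^sub>M\<close> bounds the tail
  of the Bessel sum of the indicator.\<close>

lemma sum_rho_le_rho_inf:
  assumes "K \<ge> M"
  shows "(\<Sum>n=N+1..K. rho c1 c2 xL xR rx \<gamma> n) \<le> rho_inf c1 c2 xL xR rx \<gamma> N"
proof -
  have NM: "N \<le> M" by (simp add: M Mcut_def)
  have CMn: "C_M rx \<gamma> M \<ge> 0"
    unfolding C_M_def using CM rx by (intro divide_nonneg_pos mult_nonneg_nonneg) auto
  have split: "sum f {N+1..K} = sum f {N+1..M} + sum f {M+1..K}"
    "sum f {1..K} = sum f {1..M} + sum f {M+1..K}" for f :: "nat \<Rightarrow> real"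
    using NM assms sum.ub_add_nat[of "N+1" M f "K - M"] sum.ub_add_nat[of 1 M f "K - M"] by auto
  have "(\<Sum>n=M+1..K. rho c1 c2 xL xR rx \<gamma> n)
      \<le> (\<Sum>n=M+1..K. C_M rx \<gamma> M * ((bcoef xL xR n)\<^sup>2 / (omega n)\<^sup>2))"
    by (intro sum_mono high_mode_weight) auto
  also have "\<dots> = C_M rx \<gamma> M * (\<Sum>n=M+1..K. (bcoef xL xR n)\<^sup>2 / (omega n)\<^sup>2)"
    by (simp add: sum_distrib_left)
  also have "\<dots> \<le> C_M rx \<gamma> M * (\<bar>xR - xL\<bar> - (\<Sum>n=1..M. (bcoef xL xR n)\<^sup>2 / (omega n)\<^sup>2))"
    using bcoef_Bessel[OF x, of K] split(2)[of "\<lambda>n. (bcoef xL xR n)\<^sup>2 / (omega n)\<^sup>2"]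
    by (intro mult_left_mono CMn) simp
  finally show ?thesis
    unfolding rho_inf_def Let_def M[symmetric] split(1)[of "rho c1 c2 xL xR rx \<gamma>"] by simp
qed

lemma rho_inf_nonneg: "rho_inf c1 c2 xL xR rx \<gamma> N \<ge> 0"
  by (rule order_trans[OF sum_nonneg sum_rho_le_rho_inf[OF order_refl]]) (auto intro: rho_nonneg)

end

section \<open>The Riccati equation\<close>

text \<open>The sum of the squares of the entries of \<open>\<gamma> w - e / \<gamma>\<close> is nonnegative. With \<open>e = E\<^sup>T P x\<close> this is how
  the indefinite term of the Riccati equation pays for the disturbance.\<close>

lemma disturbance_complete_square:
  fixes e w :: "real Matrix.vec"
  assumes "e \<in> carrier_vec k" "w \<in> carrier_vec k" "\<gamma> > 0"
  shows "2 * scalar_prod e w - inverse (\<gamma>\<^sup>2) * scalar_prod e e \<le> \<gamma>\<^sup>2 * scalar_prod w w"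
proof -
  have "2 * (a * b) - inverse (\<gamma>\<^sup>2) * (a * a) \<le> \<gamma>\<^sup>2 * (b * b)" for a b :: real
  proof -
    have "0 \<le> (\<gamma> * b - a / \<gamma>)\<^sup>2" by simp
    then show ?thesis using assms(3) by (simp add: power2_diff field_simps power2_eq_square)
  qed
  then have "(\<Sum>i\<in>{0..<k}. 2 * (vec_index e i * vec_index w i) - inverse (\<gamma>\<^sup>2) * (vec_index e i * vec_index e i))
      \<le> (\<Sum>i\<in>{0..<k}. \<gamma>\<^sup>2 * (vec_index w i * vec_index w i))"
    by (intro sum_mono)
  then show ?thesis
    using assms by (simp add: scalar_prod_def sum_subtractf sum_distrib_left)
qed

lemma scalar_prod_gram:
  fixes B :: "real mat"
  assumes "B \<in> carrier_mat m k" "q \<in> carrier_vec m"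
  shows "scalar_prod q ((B * transpose_mat B) *\<^sub>v q)
    = scalar_prod (transpose_mat B *\<^sub>v q) (transpose_mat B *\<^sub>v q)"
  using transpose_vec_mult_scalar[OF assms(1), of "transpose_mat B *\<^sub>v q" q] assms
  by (simp add: assoc_mult_mat_vec[of B m k "transpose_mat B" m])

text \<open>The Riccati equation, read as an identity of quadratic forms at \<open>x\<close>, expresses the derivative of
  \<open>x\<^sup>T P x\<close> along the drift \<open>A x\<close> through \<open>B\<^sup>T P x\<close>, \<open>E\<^sup>T P x\<close> and \<open>C x\<close>.\<close>

lemma riccati_quadratic_form:
  fixes A B C E P :: "real mat"
  assumes A: "A \<in> carrier_mat m m" and B: "B \<in> carrier_mat m k" and C: "C \<in> carrier_mat l m"
    and E: "E \<in> carrier_mat m j" and P: "P \<in> carrier_mat m m" "transpose_mat P = P"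
    and x: "x \<in> carrier_vec m"
    and ric: "P * A + transpose_mat A * P - P * (a \<cdot>\<^sub>m (B * transpose_mat B)
       - g \<cdot>\<^sub>m (E * transpose_mat E)) * P + transpose_mat C * C = 0\<^sub>m m m"
  defines "q \<equiv> P *\<^sub>v x"
  shows "2 * scalar_prod (A *\<^sub>v x) q = a * scalar_prod (transpose_mat B *\<^sub>v q) (transpose_mat B *\<^sub>v q)
     - g * scalar_prod (transpose_mat E *\<^sub>v q) (transpose_mat E *\<^sub>v q)
     - scalar_prod (C *\<^sub>v x) (C *\<^sub>v x)"
proof -
  define S where "S = a \<cdot>\<^sub>m (B * transpose_mat B) - g \<cdot>\<^sub>m (E * transpose_mat E)"
  have S: "S \<in> carrier_mat m m" unfolding S_def using B E
    by (intro minus_carrier_mat smult_carrier_mat mult_carrier_mat[of _ m j]) auto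
  have q: "q \<in> carrier_vec m" using P x by (simp add: q_def)
  have Ax: "A *\<^sub>v x \<in> carrier_vec m" using A x by simp
  have symP: "scalar_prod x (P *\<^sub>v v) = scalar_prod q v" if "v \<in> carrier_vec m" for v
    using transpose_vec_mult_scalar[OF P(1) that x] comm_scalar_prod[of _ m] P x that
    unfolding q_def by (metis mult_mat_vec_carrier)
  have Av: "(a' \<cdot>\<^sub>m G) *\<^sub>v q = a' \<cdot>\<^sub>v (G *\<^sub>v q)" if "G \<in> carrier_mat m m" for a' :: real and G
    using that q by (intro eq_vecI) auto
  have BB: "B * transpose_mat B \<in> carrier_mat m m" "E * transpose_mat E \<in> carrier_mat m m"
    using B E by auto
  have "scalar_prod q (S *\<^sub>v q)
      = a * scalar_prod q ((B * transpose_mat B) *\<^sub>v q) - g * scalar_prod q ((E * transpose_mat E) *\<^sub>v q)"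
    unfolding S_def using BB q
    by (subst minus_mult_distrib_mat_vec[of _ m m])
       (simp_all add: Av scalar_prod_minus_distrib[of _ m] del: assoc_mult_mat_vec)
  then have Sq: "scalar_prod q (S *\<^sub>v q)
      = a * scalar_prod (transpose_mat B *\<^sub>v q) (transpose_mat B *\<^sub>v q)
        - g * scalar_prod (transpose_mat E *\<^sub>v q) (transpose_mat E *\<^sub>v q)"
    by (simp only: scalar_prod_gram[OF B q] scalar_prod_gram[OF E q])
  have PA: "P * A \<in> carrier_mat m m" "transpose_mat A * P \<in> carrier_mat m m"
    "P * S * P \<in> carrier_mat m m" "transpose_mat C * C \<in> carrier_mat m m" "P * S \<in> carrier_mat m m"
    using A P S C by auto
  have "0\<^sub>m m m *\<^sub>v x = (P * A) *\<^sub>v x + (transpose_mat A * P) *\<^sub>v x - (P * S * P) *\<^sub>v x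
      + (transpose_mat C * C) *\<^sub>v x"
    unfolding ric[symmetric] S_def[symmetric]
    using add_mult_distrib_mat_vec[OF minus_carrier_mat[OF PA(3)] PA(4) x, of "P * A + transpose_mat A * P"]
      minus_mult_distrib_mat_vec[OF add_carrier_mat[OF PA(2)] PA(3) x, of "P * A"]
      add_mult_distrib_mat_vec[OF PA(1,2) x]
    by (simp only:)
  also have "\<dots> = P *\<^sub>v (A *\<^sub>v x) + transpose_mat A *\<^sub>v q - P *\<^sub>v (S *\<^sub>v q)
      + transpose_mat C *\<^sub>v (C *\<^sub>v x)"
    unfolding q_def using A P S C x
    by (simp add: assoc_mult_mat_vec[of _ m m _ m] assoc_mult_mat_vec[of _ m l _ m])
  finally have "scalar_prod x (0\<^sub>m m m *\<^sub>v x) = scalar_prod x (P *\<^sub>v (A *\<^sub>v x))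
      + scalar_prod x (transpose_mat A *\<^sub>v q) - scalar_prod x (P *\<^sub>v (S *\<^sub>v q))
      + scalar_prod x (transpose_mat C *\<^sub>v (C *\<^sub>v x))"
    using A P S C x q by (simp add: scalar_prod_add_distrib[of _ m] scalar_prod_minus_distrib[of _ m])
  moreover have "0\<^sub>m m m *\<^sub>v x = 0\<^sub>v m" using x by (intro eq_vecI) auto
  moreover have "scalar_prod x (P *\<^sub>v (A *\<^sub>v x)) = scalar_prod (A *\<^sub>v x) q"
    unfolding symP[OF Ax] by (rule comm_scalar_prod[OF q Ax])
  moreover have "scalar_prod x (transpose_mat A *\<^sub>v q) = scalar_prod (A *\<^sub>v x) q"
    using transpose_vec_mult_scalar[OF A x q] comm_scalar_prod[OF q Ax]
      comm_scalar_prod[of "transpose_mat A *\<^sub>v q" m x] A q x by simp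
  moreover have "scalar_prod x (P *\<^sub>v (S *\<^sub>v q)) = scalar_prod q (S *\<^sub>v q)"
    using symP[of "S *\<^sub>v q"] S q by simp
  moreover have "scalar_prod x (transpose_mat C *\<^sub>v (C *\<^sub>v x)) = scalar_prod (C *\<^sub>v x) (C *\<^sub>v x)"
    using transpose_vec_mult_scalar[OF C x, of "C *\<^sub>v x"]
      comm_scalar_prod[of "transpose_mat C *\<^sub>v (C *\<^sub>v x)" m x] C x by simp
  ultimately show ?thesis using Sq x by simp
qed

text \<open>With \<open>\<beta> = B\<^sup>T P x\<close> the feedback \<open>u = - \<beta> / R\<close> gives \<open>\<beta>\<^sup>2 / R + 2 \<beta> u + R u\<^sup>2 = 0\<close>, so that only output and
  disturbance terms remain. For \<open>R = 0\<close> the inverse is \<open>0\<close> by convention and so is the control.\<close>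

lemma riccati_dissipation:
  fixes A B C E P :: "real mat" and R \<gamma> u :: real
  assumes A: "A \<in> carrier_mat m m" and B: "B \<in> carrier_mat m 1" and C: "C \<in> carrier_mat l m"
    and E: "E \<in> carrier_mat m j" and P: "P \<in> carrier_mat m m" "transpose_mat P = P"
    and x: "x \<in> carrier_vec m" and w: "w \<in> carrier_vec j" and \<gamma>: "\<gamma> > 0"
    and ric: "P * A + transpose_mat A * P - P * (inverse R \<cdot>\<^sub>m (B * transpose_mat B)
       - inverse (\<gamma>\<^sup>2) \<cdot>\<^sub>m (E * transpose_mat E)) * P + transpose_mat C * C = 0\<^sub>m m m"
    and u: "u = - inverse R * vec_index ((transpose_mat B * P) *\<^sub>v x) 0"
  shows "2 * scalar_prod (A *\<^sub>v x + u \<cdot>\<^sub>v col B 0 + E *\<^sub>v w) (P *\<^sub>v x)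
     + scalar_prod (C *\<^sub>v x) (C *\<^sub>v x) + R * u\<^sup>2 \<le> \<gamma>\<^sup>2 * scalar_prod w w"
proof -
  define q where "q = P *\<^sub>v x"
  define \<beta> where "\<beta> = vec_index (transpose_mat B *\<^sub>v q) 0"
  have q: "q \<in> carrier_vec m" using P x by (simp add: q_def)
  have Ax: "A *\<^sub>v x \<in> carrier_vec m" and uB: "u \<cdot>\<^sub>v col B 0 \<in> carrier_vec m"
    and Ew: "E *\<^sub>v w \<in> carrier_vec m" and cB: "col B 0 \<in> carrier_vec m"
    using A B E x w by auto
  have u': "u = - inverse R * \<beta>"
    unfolding u \<beta>_def q_def using B P x by (simp add: assoc_mult_mat_vec[of "transpose_mat B" 1 m P m])
  have \<beta>1: "scalar_prod (transpose_mat B *\<^sub>v q) (transpose_mat B *\<^sub>v q) = \<beta>\<^sup>2"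
    using B by (simp add: scalar_prod_def \<beta>_def power2_eq_square)
  have \<beta>2: "scalar_prod (col B 0) q = \<beta>"
    using B unfolding \<beta>_def by simp
  have Eq: "scalar_prod (E *\<^sub>v w) q = scalar_prod (transpose_mat E *\<^sub>v q) w"
    using transpose_vec_mult_scalar[OF E w q] comm_scalar_prod[OF q Ew] by simp
  have "scalar_prod (A *\<^sub>v x + u \<cdot>\<^sub>v col B 0 + E *\<^sub>v w) q
      = scalar_prod (A *\<^sub>v x) q + u * \<beta> + scalar_prod (transpose_mat E *\<^sub>v q) w"
    using add_scalar_prod_distrib[OF add_carrier_vec[OF Ax uB] Ew q]
      add_scalar_prod_distrib[OF Ax uB q] smult_scalar_prod_distrib[OF cB q] \<beta>2 Eq by simp
  moreover have "2 * scalar_prod (A *\<^sub>v x) q = inverse R * \<beta>\<^sup>2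
     - inverse (\<gamma>\<^sup>2) * scalar_prod (transpose_mat E *\<^sub>v q) (transpose_mat E *\<^sub>v q)
     - scalar_prod (C *\<^sub>v x) (C *\<^sub>v x)"
    using riccati_quadratic_form[OF A B C E P x ric] unfolding q_def[symmetric] \<beta>1 .
  moreover have "inverse R * \<beta>\<^sup>2 + 2 * (u * \<beta>) + R * u\<^sup>2 = 0"
    unfolding u' by (cases "R = 0") (simp_all add: field_simps power2_eq_square)
  moreover have "2 * scalar_prod (transpose_mat E *\<^sub>v q) w
      - inverse (\<gamma>\<^sup>2) * scalar_prod (transpose_mat E *\<^sub>v q) (transpose_mat E *\<^sub>v q) \<le> \<gamma>\<^sup>2 * scalar_prod w w"
    by (rule disturbance_complete_square[OF _ w \<gamma>]) (use E q in simp)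
  ultimately show ?thesis unfolding q_def[symmetric] by (simp add: algebra_simps)
qed

lemma mat_diag_mult_vec:
  assumes "v \<in> carrier_vec n"
  shows "mat_diag n f *\<^sub>v v = Matrix.vec n (\<lambda>i. f i * vec_index v i)"
proof (rule eq_vecI)
  fix i assume "i < dim_vec (Matrix.vec n (\<lambda>i. f i * vec_index v i))"
  then have i: "i < n" by simp
  have "vec_index (mat_diag n f *\<^sub>v v) i = (\<Sum>j\<in>{0..<n}. (if i = j then f j else 0) * vec_index v j)"
    using i assms by (auto simp: mat_diag_def scalar_prod_def)
  also have "\<dots> = (\<Sum>j\<in>{0..<n}. if i = j then f j * vec_index v j else 0)"
    by (rule sum.cong) auto
  finally show "vec_index (mat_diag n f *\<^sub>v v) i = vec_index (Matrix.vec n (\<lambda>i. f i * vec_index v i)) i"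
    using i by simp
qed (simp add: mat_diag_def)

text \<open>Modes are numbered from 1, vector entries from 0.\<close>

definition mode_vec :: "nat \<Rightarrow> (nat \<Rightarrow> real) \<Rightarrow> real Matrix.vec" where
  "mode_vec N f = Matrix.vec N (\<lambda>i. f (i + 1))"

lemma mode_vec_carrier: "mode_vec N f \<in> carrier_vec N"
  by (simp add: mode_vec_def)

lemma scalar_prod_mode_vec: "scalar_prod (mode_vec N f) (mode_vec N g) = (\<Sum>n=1..N. f n * g n)"
  by (simp add: mode_vec_def scalar_prod_def sum.atLeast1_atMost_eq atLeast0LessThan)

lemma system_matrix_carriers:
  "A_mat c1 c2 N \<in> carrier_mat (2 * N) (2 * N)" "B_mat xL xR N \<in> carrier_mat (2 * N) 1"
  "E_mat N \<in> carrier_mat (2 * N) N" "C_mat rx N \<in> carrier_mat (N + 1) (2 * N)"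
  by (auto simp: A_mat_def B_mat_def E_mat_def C_mat_def Omega_mat_def mat_diag_def append_rows_def)

lemma A_mat_mult:
  "A_mat c1 c2 N *\<^sub>v (mode_vec N p @\<^sub>v mode_vec N q)
   = mode_vec N q @\<^sub>v mode_vec N (\<lambda>n. - (omega n)\<^sup>2 * p n - (c1 + c2 * (omega n)\<^sup>2) * q n)"
proof -
  have OO: "Omega_mat N * Omega_mat N = mat_diag N (\<lambda>i. (omega (i + 1))\<^sup>2)"
    by (simp add: Omega_mat_def power2_eq_square)
  have damp: "c1 \<cdot>\<^sub>m 1\<^sub>m N + c2 \<cdot>\<^sub>m mat_diag N (\<lambda>i. (omega (i + 1))\<^sup>2)
      = mat_diag N (\<lambda>i. c1 + c2 * (omega (i + 1))\<^sup>2)"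
    by (intro eq_matI) (auto simp: mat_diag_def)
  have D: "mat_diag N f \<in> carrier_mat N N" for f :: "nat \<Rightarrow> real" by (simp add: mat_diag_def)
  have neg: "(- mat_diag N f) *\<^sub>v mode_vec N v = mode_vec N (\<lambda>n. - (f (n - 1) * v n))" for f v
  proof -
    have "(- mat_diag N f) *\<^sub>v mode_vec N v = - (mat_diag N f *\<^sub>v mode_vec N v)"
      by (rule uminus_mult_mat_vec) (simp add: mat_diag_def mode_vec_def)
    then show ?thesis
      unfolding mat_diag_mult_vec[OF mode_vec_carrier] by (auto simp: mode_vec_def)
  qed
  have zero: "0\<^sub>m N N *\<^sub>v mode_vec N p = 0\<^sub>v N"
    by (intro eq_vecI) (auto simp: mode_vec_def)
  show ?thesis
    unfolding A_mat_def OO damp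
    using D mode_vec_carrier[of N p] mode_vec_carrier[of N q]
    by (subst four_block_mat_mult_vec[of _ N N _ N _ N])
       (auto simp: neg zero intro!: arg_cong2[where f = append_vec], auto simp: mode_vec_def)
qed

lemma C_mat_norm:
  assumes "rx \<ge> 0"
  shows "scalar_prod (C_mat rx N *\<^sub>v (mode_vec N p @\<^sub>v mode_vec N q)) (C_mat rx N *\<^sub>v (mode_vec N p @\<^sub>v mode_vec N q))
   = (\<Sum>n=1..N. (1 + rx * (omega n)\<^sup>2) * (p n)\<^sup>2)"
proof -
  define s where "s i = sqrt (1 + rx * (omega (i + 1))\<^sup>2)" for i
  have D: "mat_diag N s \<in> carrier_mat N N" by (simp add: mat_diag_def)
  have "C_mat rx N *\<^sub>v (mode_vec N p @\<^sub>v mode_vec N q) = mode_vec N (\<lambda>n. s (n - 1) * p n) @\<^sub>v 0\<^sub>v 1"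
    unfolding C_mat_def s_def[symmetric]
    using D mode_vec_carrier[of N p] mode_vec_carrier[of N q]
    by (subst four_block_mat_mult_vec[of _ N N _ N _ 1]) (auto simp: mat_diag_mult_vec mode_vec_def)
  moreover have "scalar_prod (mode_vec N f @\<^sub>v 0\<^sub>v 1) (mode_vec N f @\<^sub>v 0\<^sub>v 1) = (\<Sum>n=1..N. f n * f n)" for f
    by (subst scalar_prod_append[of _ N _ 1]) (auto simp: mode_vec_carrier scalar_prod_mode_vec)
  moreover have "s (n - 1) * p n * (s (n - 1) * p n) = (1 + rx * (omega n)\<^sup>2) * (p n)\<^sup>2"
    if "n \<in> {1..N}" for n
  proof -
    have "s (n - 1) * s (n - 1) = 1 + rx * (omega n)\<^sup>2"
      unfolding s_def using that assms by (simp add: real_sqrt_mult_self)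
    then show ?thesis by (metis (no_types, opaque_lifting) mult.assoc mult.left_commute power2_eq_square)
  qed
  ultimately show ?thesis by simp
qed

lemma B_mat_col: "col (B_mat xL xR N) 0 = mode_vec N (\<lambda>n. 0) @\<^sub>v mode_vec N (bcoef xL xR)"
  by (intro eq_vecI) (auto simp: B_mat_def append_rows_def mode_vec_def)

lemma E_mat_mult: "E_mat N *\<^sub>v mode_vec N w = mode_vec N (\<lambda>n. 0) @\<^sub>v mode_vec N w"
proof -
  have "E_mat N *\<^sub>v mode_vec N w = (0\<^sub>m N N *\<^sub>v mode_vec N w) @\<^sub>v (1\<^sub>m N *\<^sub>v mode_vec N w)"
    unfolding E_mat_def by (rule mat_mult_append) (auto simp: mode_vec_carrier)
  moreover have "0\<^sub>m N N *\<^sub>v mode_vec N w = mode_vec N (\<lambda>n. 0)"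
    by (intro eq_vecI) (auto simp: mode_vec_def)
  ultimately show ?thesis by (simp add: mode_vec_carrier)
qed

text \<open>The sign matters, since \<open>sqrt r\<close> is negative for negative \<open>r\<close> and its square is then \<open>- r\<close>.\<close>

lemma R_weight_nonneg: "r \<ge> 0 \<Longrightarrow> R_weight N r = r"
proof -
  assume r: "r \<ge> 0"
  have "D_mat N r \<in> carrier_mat (N + 1) 1" unfolding D_mat_def by (intro carrier_append_rows) auto
  then have "R_weight N r = scalar_prod (col (D_mat N r) 0) (col (D_mat N r) 0)"
    by (simp add: R_weight_def)
  also have "\<dots> = (\<Sum>i\<in>{0..<N + 1}. if i = N then r else 0)"
    unfolding scalar_prod_def
    by (rule sum.cong) (use r in \<open>auto simp: D_mat_def append_rows_def\<close>)
  also have "\<dots> = r" by simp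
  finally show ?thesis .
qed

text \<open>The modal equations are \<open>x' = A x + B u + E w\<close>, so the Riccati computation applies; the control is
  weighted with the whole of \<open>r\<close>, which includes the reserve for the remaining modes.\<close>

lemma low_modes_dissipation:
  fixes p q y w :: "nat \<Rightarrow> real" and N :: nat and r rx \<gamma> c1 c2 :: real
  defines "x \<equiv> mode_vec N p @\<^sub>v mode_vec N q"
  assumes r: "r \<ge> 0" and rx: "rx \<ge> 0" and \<gamma>: "\<gamma> > 0"
    and P: "sym_pos_def (2 * N) P"
    and ric: "P * A_mat c1 c2 N + transpose_mat (A_mat c1 c2 N) * P
       - P * (inverse (R_weight N r) \<cdot>\<^sub>m (B_mat xL xR N * transpose_mat (B_mat xL xR N))
               - inverse (\<gamma>\<^sup>2) \<cdot>\<^sub>m (E_mat N * transpose_mat (E_mat N))) * P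
       + transpose_mat (C_mat rx N) * C_mat rx N = 0\<^sub>m (2 * N) (2 * N)"
    and u: "u = - inverse r * vec_index ((transpose_mat (B_mat xL xR N) * P) *\<^sub>v x) 0"
    and ode: "\<And>n. n \<in> {1..N} \<Longrightarrow>
      y n + (c1 + c2 * (omega n)\<^sup>2) * q n + (omega n)\<^sup>2 * p n = bcoef xL xR n * u + w n"
  shows "2 * scalar_prod (mode_vec N q @\<^sub>v mode_vec N y) (P *\<^sub>v x)
     + (\<Sum>n=1..N. (1 + rx * (omega n)\<^sup>2) * (p n)\<^sup>2) + r * u\<^sup>2 \<le> \<gamma>\<^sup>2 * (\<Sum>n=1..N. (w n)\<^sup>2)"
proof -
  have x: "x \<in> carrier_vec (2 * N)"
    unfolding x_def mult_2 by (intro append_carrier_vec mode_vec_carrier)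
  have P': "P \<in> carrier_mat (2 * N) (2 * N)" "transpose_mat P = P"
    using P by (auto simp: sym_pos_def_def)
  have "mode_vec N q @\<^sub>v mode_vec N y
      = A_mat c1 c2 N *\<^sub>v x + u \<cdot>\<^sub>v col (B_mat xL xR N) 0 + E_mat N *\<^sub>v mode_vec N w"
    (is "?l = ?r")
  proof (rule eq_vecI)
    fix i assume "i < dim_vec ?r"
    then have i: "i < 2 * N" using system_matrix_carriers(3)[of N] by auto
    have "i - N + 1 \<in> {1..N}" if "\<not> i < N" using that i by auto
    from ode[OF this] show "vec_index ?l i = vec_index ?r i"
      using i unfolding x_def A_mat_mult B_mat_col E_mat_mult
      by (auto simp: mode_vec_def algebra_simps)
  qed (use system_matrix_carriers(3)[of N] in \<open>auto simp: mode_vec_def\<close>)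
  moreover have "u = - inverse (R_weight N r) * vec_index ((transpose_mat (B_mat xL xR N) * P) *\<^sub>v x) 0"
    using u r by (simp add: R_weight_nonneg)
  note riccati_dissipation[OF system_matrix_carriers(1,2,4,3) P' x mode_vec_carrier \<gamma> ric this, of w]
  ultimately show ?thesis
    using C_mat_norm[OF rx, of N p q]
    by (simp add: x_def[symmetric] R_weight_nonneg[OF r] scalar_prod_mode_vec power2_eq_square[of "w _"])
qed

section \<open>From the beam to its modes\<close>

lemma sobolev_norm_scale_smooth:
  assumes "smooth f"
  shows "sobolev_norm k (\<lambda>x. c * f x) = \<bar>c\<bar> * sobolev_norm k f"
proof -
  have "L2norm (wd j (\<lambda>x. c * f x)) = \<bar>c\<bar> * L2norm (wd j f)" for j
  proof -
    have wj: "wd j f \<in> L2" "weak_deriv j f (wd j f)"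
      using wd_sobolev[OF smooth_sobolev[OF assms, of j] order_refl] by auto
    have "weak_deriv j (\<lambda>x. c * f x + 0 * f x) (\<lambda>x. c * wd j f x + 0 * wd j f x)"
      by (intro weak_deriv_lincomb wj smooth_L2 assms)
    then have w: "weak_deriv j (\<lambda>x. c * f x) (\<lambda>x. c * wd j f x)" by simp
    have l: "(\<lambda>x. c * wd j f x) \<in> L2" by (rule L2_scale[OF wj(1)])
    have "L2norm (wd j (\<lambda>x. c * f x)) = L2norm (\<lambda>x. c * wd j f x)"
      using wd_spec[OF l w] l by (intro L2norm_cong_AE)
    then show ?thesis by (simp add: L2norm_scale)
  qed
  then show ?thesis
    by (simp add: sobolev_norm_def power_mult_distrib real_sqrt_mult flip: sum_distrib_left)
qed

lemma sobolev_norm_nonneg: "0 \<le> sobolev_norm k f"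
  by (simp add: sobolev_norm_def sum_nonneg)

lemma dual4_lincomb:
  assumes "F \<in> dual4" "G \<in> dual4"
  shows "(\<lambda>f. a * F f + b * G f) \<in> dual4"
proof -
  obtain K L where "\<forall>f\<in>H_BC 4. \<bar>F f\<bar> \<le> K * sobolev_norm 4 f" "\<forall>f\<in>H_BC 4. \<bar>G f\<bar> \<le> L * sobolev_norm 4 f"
    using assms by (auto simp: dual4_def)
  then have "\<forall>f\<in>H_BC 4. \<bar>a * F f + b * G f\<bar> \<le> (\<bar>a\<bar> * K + \<bar>b\<bar> * L) * sobolev_norm 4 f"
  proof (intro ballI)
    fix f assume f: "f \<in> H_BC 4"
    assume "\<forall>f\<in>H_BC 4. \<bar>F f\<bar> \<le> K * sobolev_norm 4 f" "\<forall>f\<in>H_BC 4. \<bar>G f\<bar> \<le> L * sobolev_norm 4 f"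
    then have "\<bar>a * F f\<bar> \<le> \<bar>a\<bar> * (K * sobolev_norm 4 f)" "\<bar>b * G f\<bar> \<le> \<bar>b\<bar> * (L * sobolev_norm 4 f)"
      using f by (auto simp: abs_mult intro!: mult_left_mono)
    then show "\<bar>a * F f + b * G f\<bar> \<le> (\<bar>a\<bar> * K + \<bar>b\<bar> * L) * sobolev_norm 4 f"
      by (simp add: distrib_right mult.assoc)
  qed
  moreover have "a * F (\<lambda>x. c * f x + d * g x) + b * G (\<lambda>x. c * f x + d * g x)
      = c * (a * F f + b * G f) + d * (a * F g + b * G g)" if "f \<in> H_BC 4" "g \<in> H_BC 4" for f g c d
  proof -
    have "F (\<lambda>x. c * f x + d * g x) = c * F f + d * F g" "G (\<lambda>x. c * f x + d * g x) = c * G f + d * G g"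
      using assms that unfolding dual4_def by blast+
    then show ?thesis by (simp add: algebra_simps)
  qed
  ultimately show ?thesis unfolding dual4_def by blast
qed

text \<open>By this bound convergence in the dual norm implies convergence at every fixed eigenfunction. Dividing
  by \<open>1 +\<close> the norm, not by the norm, brings \<open>f\<close> into the unit ball also if its norm is \<open>0\<close>.\<close>

lemma dual4_eval_bound:
  assumes F: "F \<in> dual4" and f: "f \<in> smooth_BC"
  shows "\<bar>F f\<bar> \<le> (1 + sobolev_norm 4 f) * dual4_norm F"
proof -
  define s where "s = 1 + sobolev_norm 4 f"
  have s: "s > 0" using sobolev_norm_nonneg[of 4 f] by (simp add: s_def)
  define g where "g x = (1 / s) * f x" for x
  have sm: "smooth f" using f by (simp add: smooth_BC_def)
  have H: "f \<in> H_BC 4" by (rule smooth_BC_H_BC[OF f])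
  have df: "(deriv ^^ k) g = (\<lambda>x. (1 / s) * (deriv ^^ k) f x)" for k
  proof (induction k)
    case (Suc k)
    have "deriv (\<lambda>x. (1 / s) * (deriv ^^ k) f x) = (\<lambda>x. (1 / s) * deriv ((deriv ^^ k) f) x)"
      by (rule ext, rule DERIV_imp_deriv, rule DERIV_cmult)
         (rule smooth_has_deriv[OF smooth_funpow_deriv[OF sm]])
    with Suc show ?case by simp
  qed (simp add: g_def[abs_def])
  have "smooth g" unfolding g_def[abs_def] by (rule smooth_scale[OF sm])
  then have "g \<in> smooth_BC" using f unfolding smooth_BC_def by (simp add: df)
  then have gH: "g \<in> H_BC 4" by (rule smooth_BC_H_BC)
  have "sobolev_norm 4 g \<le> 1"
    unfolding g_def[abs_def] sobolev_norm_scale_smooth[OF sm] using s by (simp add: s_def)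
  moreover have "bdd_above ((\<lambda>f. \<bar>F f\<bar>) ` {f \<in> H_BC 4. sobolev_norm 4 f \<le> 1})"
  proof -
    obtain K where K: "\<And>f. f \<in> H_BC 4 \<Longrightarrow> \<bar>F f\<bar> \<le> K * sobolev_norm 4 f"
      using F unfolding dual4_def by blast
    have "\<bar>F f\<bar> \<le> \<bar>K\<bar>" if "f \<in> H_BC 4" "sobolev_norm 4 f \<le> 1" for f
    proof -
      have "K * sobolev_norm 4 f \<le> \<bar>K\<bar> * 1"
        using that sobolev_norm_nonneg[of 4 f] by (intro mult_mono) auto
      then show ?thesis using K[OF that(1)] by simp
    qed
    then show ?thesis by (intro bdd_aboveI2) auto
  qed
  ultimately have "\<bar>F g\<bar> \<le> dual4_norm F"
    unfolding dual4_norm_def using gH by (intro cSUP_upper) auto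
  moreover have "F g = (1 / s) * F f"
  proof -
    have "F (\<lambda>x. (1 / s) * f x + 0 * f x) = (1 / s) * F f + 0 * F f"
      using F H unfolding dual4_def by blast
    then show ?thesis by (simp add: g_def[abs_def])
  qed
  ultimately have "\<bar>F f\<bar> / s \<le> dual4_norm F" using s by (simp add: abs_mult)
  then show ?thesis using s by (simp add: s_def[symmetric] pos_divide_le_eq mult.commute)
qed

lemma C1_dual4_eval:
  assumes C1: "C1_dual4 F F'" and f: "f \<in> smooth_BC" and t: "t \<ge> 0"
  shows "((\<lambda>s. F s f) has_real_derivative F' t f) (at t within {0..})"
    and "((\<lambda>s. F' s f) \<longlongrightarrow> F' t f) (at t within {0..})"
proof -
  define b where "b = 1 + sobolev_norm 4 f"
  have D: "F s \<in> dual4" "F' s \<in> dual4" if "s \<ge> 0" for s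
    using C1 that by (auto simp: C1_dual4_def)
  have lim0: "((\<lambda>s. dual4_norm (\<lambda>f. (F s f - F t f) / (s - t) - F' t f)) \<longlongrightarrow> 0) (at t within {0..})"
    "((\<lambda>s. dual4_norm (\<lambda>f. F' s f - F' t f)) \<longlongrightarrow> 0) (at t within {0..})"
    using C1[unfolded C1_dual4_def, rule_format, OF t] by auto
  have lim: "((\<lambda>s. b * dual4_norm (\<lambda>f. (F s f - F t f) / (s - t) - F' t f)) \<longlongrightarrow> 0) (at t within {0..})"
    "((\<lambda>s. b * dual4_norm (\<lambda>f. F' s f - F' t f)) \<longlongrightarrow> 0) (at t within {0..})"
    using tendsto_mult_right_zero[OF lim0(1)] tendsto_mult_right_zero[OF lim0(2)] by auto
  have G: "\<bar>(F s f - F t f) / (s - t) - F' t f\<bar> \<le> b * dual4_norm (\<lambda>f. (F s f - F t f) / (s - t) - F' t f)"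
    if "s \<ge> 0" for s
  proof -
    have "(\<lambda>f. 1 * (1 / (s - t) * F s f + (- 1 / (s - t)) * F t f) + (- 1) * F' t f) \<in> dual4"
      by (intro dual4_lincomb D that t)
    moreover have "1 * (1 / (s - t) * F s f + (- 1 / (s - t)) * F t f) + (- 1) * F' t f
        = (F s f - F t f) / (s - t) - F' t f" for f
      by (simp add: diff_divide_distrib)
    ultimately show ?thesis unfolding b_def by (intro dual4_eval_bound f) simp
  qed
  have G': "\<bar>F' s f - F' t f\<bar> \<le> b * dual4_norm (\<lambda>f. F' s f - F' t f)" if "s \<ge> 0" for s
    using dual4_lincomb[OF D(2)[OF that] D(2)[OF t], of 1 "-1"]
    unfolding b_def by (intro dual4_eval_bound f) simp
  have "((\<lambda>s. (F s f - F t f) / (s - t) - F' t f) \<longlongrightarrow> 0) (at t within {0..})"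
    by (rule Lim_null_comparison[OF _ lim(1)]) (use G in \<open>auto simp: eventually_at_filter\<close>)
  then show "((\<lambda>s. F s f) has_real_derivative F' t f) (at t within {0..})"
    unfolding has_field_derivative_iff by (rule LIM_zero_cancel)
  have "((\<lambda>s. F' s f - F' t f) \<longlongrightarrow> 0) (at t within {0..})"
    by (rule Lim_null_comparison[OF _ lim(2)]) (use G' in \<open>auto simp: eventually_at_filter\<close>)
  then show "((\<lambda>s. F' s f) \<longlongrightarrow> F' t f) (at t within {0..})"
    by (rule LIM_zero_cancel)
qed

lemma continuous_AE_eq_imp_eq:
  fixes f g :: "real \<Rightarrow> real"
  assumes "AE x in Ipi. f x = g x" "continuous_on {0..pi} f" "continuous_on {0..pi} g"
    and x: "x \<in> {0<..<pi}"
  shows "f x = g x"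
proof (rule ccontr)
  assume ne: "f x \<noteq> g x"
  define U where "U = {x \<in> {0<..<pi}. f x - g x \<noteq> 0}"
  have "continuous_on {0<..<pi} (\<lambda>x. f x - g x)"
    by (intro continuous_on_diff continuous_on_subset[OF assms(2)] continuous_on_subset[OF assms(3)]) auto
  then have "open ((\<lambda>x. f x - g x) -` (- {0}) \<inter> {0<..<pi})"
    by (subst (asm) continuous_on_open_vimage) auto
  moreover have "(\<lambda>x. f x - g x) -` (- {0}) \<inter> {0<..<pi} = U"
    by (auto simp: U_def)
  ultimately have "open U" by simp
  moreover have "U \<noteq> {}" using x ne by (auto simp: U_def)
  moreover have "negligible U"
  proof -
    have "AE x in lebesgue. x \<in> {0<..<pi} \<longrightarrow> f x = g x"
      using assms(1) by (simp add: AE_restrict_space_iff)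
    then obtain S where "{x. \<not> (x \<in> {0<..<pi} \<longrightarrow> f x = g x)} \<subseteq> S" "S \<in> null_sets lebesgue"
      by (auto simp: eventually_ae_filter)
    then have "negligible S" "U \<subseteq> S"
      by (auto simp: negligible_iff_null_sets U_def)
    then show ?thesis by (rule negligible_subset)
  qed
  ultimately show False using open_not_negligible by blast
qed

text \<open>Two continuous weak derivatives agree almost everywhere, hence at every interior point, so the point
  value is well defined.\<close>

lemma deriv_at_smooth:
  assumes f: "smooth f" and x: "x \<in> {0<..<pi}"
  shows "deriv_at f x = deriv f x"
  unfolding deriv_at_def
proof (rule the_equality)
  have w: "weak_deriv 1 f (deriv f)" using weak_deriv_smooth[OF f, of 1] by simp
  have c: "continuous_on {0..pi} (deriv f)" by (intro smooth_continuous_on smooth_deriv f)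
  show "\<exists>g. continuous_on {0..pi} g \<and> weak_deriv 1 f g \<and> deriv f x = g x"
    using w c by blast
  fix y assume "\<exists>g. continuous_on {0..pi} g \<and> weak_deriv 1 f g \<and> y = g x"
  then obtain g where g: "continuous_on {0..pi} g" "weak_deriv 1 f g" "y = g x" by blast
  show "y = deriv f x"
    unfolding g(3)
    by (rule continuous_AE_eq_imp_eq[OF weak_deriv_unique[OF g(2) w] g(1) c x])
       (auto intro: continuous_L2 g c)
qed

lemma delta'_eigfun_bcoef:
  assumes "0 < xL" "xL < xR" "xR < pi"
  shows "delta' xL (eigfun n) - delta' xR (eigfun n) = bcoef xL xR n"
  using assms by (simp add: delta'_def deriv_at_smooth[OF smooth_eigfun] deriv_eigfun bcoef_def algebra_simps)

text \<open>Only derivatives of even order reproduce the eigenfunction; order 2 enters the pairing that embeds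
  the deflection in \<open>Y\<close>, order 4 the one that defines \<open>z\<^sub>x\<^sub>x\<^sub>x\<^sub>x\<close>.\<close>

lemma ip_wd_eigfun:
  assumes "h \<in> L2"
  shows "ip h (wd (2 * k) (eigfun n)) = (- omega n) ^ k * ip h (eigfun n)"
proof -
  have "ip (wd (2 * k) (eigfun n)) h = ip ((deriv ^^ (2 * k)) (eigfun n)) h"
  proof (rule ip_cong_AE[OF wd_smooth[OF smooth_eigfun] _ _ assms])
    show "wd (2 * k) (eigfun n) \<in> L2"
      by (rule wd_sobolev(1)[OF smooth_sobolev[OF smooth_eigfun] order_refl])
    show "(deriv ^^ (2 * k)) (eigfun n) \<in> L2"
      by (intro smooth_L2 smooth_funpow_deriv smooth_eigfun)
  qed
  then show ?thesis
    unfolding deriv_even_eigfun by (simp add: omega_def ip_commute[of h] ip_scale_left)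
qed

text \<open>Testing with the eigenfunctions turns the solution concept into classical oscillator equations with
  continuous accelerations \<open>y\<close>. In \<open>Y\<close> the pairing multiplies the \<open>n\<close>-th coefficient by \<open>\<omega>\<^sub>n\<^sup>2\<close> for the
  deflection and the velocity alike, so that this factor cancels from the first clause.\<close>

lemma beam_modes:
  assumes sol: "beam_solution c1 c2 xL xR u w z zt" and x: "0 < xL" "xL < xR" "xR < pi"
  obtains y :: "nat \<Rightarrow> real \<Rightarrow> real" where
    "\<And>n t. n \<ge> 1 \<Longrightarrow> t \<ge> 0 \<Longrightarrow>
       ((\<lambda>s. ip (z s) (eigfun n)) has_real_derivative ip (zt t) (eigfun n)) (at t within {0..})"
    "\<And>n t. n \<ge> 1 \<Longrightarrow> t \<ge> 0 \<Longrightarrow>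
       ((\<lambda>s. ip (zt s) (eigfun n)) has_real_derivative y n t) (at t within {0..})"
    "\<And>n. continuous_on {0..} (y n)"
    "AE t in lebesgue_on {0<..}. \<forall>n\<ge>1. y n t + (c1 + c2 * (omega n)\<^sup>2) * ip (zt t) (eigfun n)
       + (omega n)\<^sup>2 * ip (z t) (eigfun n) = bcoef xL xR n * u t + ip (w t) (eigfun n)"
proof -
  obtain ztt where H: "cont_X z zt" "C1_dual4 (\<lambda>t. emb_Y (z t)) (\<lambda>t. emb_Y_L2 (zt t))"
    "C1_dual4 (\<lambda>t. emb_L2 (zt t)) ztt"
    and eq: "AE t in lebesgue_on {0<..}. \<forall>f\<in>H_BC 4.
           ztt t f + dxxxx (z t) f + c1 * emb_L2 (zt t) f + c2 * dxxxx (zt t) f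
           = (delta' xL f - delta' xR f) * u t + emb_L2 (w t) f"
    using sol by (auto simp: beam_solution_def)
  have z: "z t \<in> H_BC 2" "zt t \<in> L2" "z t \<in> L2" "wd 2 (z t) \<in> L2" if "t \<ge> 0" for t
  proof -
    show "z t \<in> H_BC 2" "zt t \<in> L2" using H(1) that by (auto simp: cont_X_def)
    then show "z t \<in> L2" "wd 2 (z t) \<in> L2"
      using H_BC_sobolev[of "z t" 2] by (auto intro: sobolev_L2 wd_sobolev)
  qed
  have w4: "ip h (wd 4 (eigfun n)) = (omega n)\<^sup>2 * ip h (eigfun n)" if "h \<in> L2" for h n
    using ip_wd_eigfun[OF that, of 2 n] by simp
  have Y: "emb_Y (z t) (eigfun n) = (omega n)\<^sup>2 * ip (z t) (eigfun n)" if "t \<ge> 0" "n \<ge> 1" for t n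
    using ip_wd_eigfun[OF z(4)[OF that(1)], of 1 n] ip_wd2_eigfun[OF z(1)[OF that(1)] that(2)]
    by (simp add: emb_Y_def omega_def power2_eq_square)
  show ?thesis
  proof
    fix n :: nat and t :: real assume n: "n \<ge> 1" and t: "t \<ge> 0"
    have o: "(omega n)\<^sup>2 > 0" using omega_pos[OF n] by simp
    have "((\<lambda>s. emb_Y (z s) (eigfun n)) has_real_derivative (omega n)\<^sup>2 * ip (zt t) (eigfun n)) (at t within {0..})"
      using C1_dual4_eval(1)[OF H(2) eigfun_smooth_BC t, of n] w4[OF z(2)[OF t]]
      by (simp add: emb_Y_L2_def)
    then have "((\<lambda>s. (omega n)\<^sup>2 * ip (z s) (eigfun n)) has_real_derivative
        (omega n)\<^sup>2 * ip (zt t) (eigfun n)) (at t within {0..})"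
      by (rule has_field_derivative_transform_within[where d = 1]) (use t n Y in auto)
    then have "((\<lambda>s. (omega n)\<^sup>2 * ip (z s) (eigfun n) / (omega n)\<^sup>2) has_real_derivative
        (omega n)\<^sup>2 * ip (zt t) (eigfun n) / (omega n)\<^sup>2) (at t within {0..})"
      by (rule DERIV_cdivide)
    then show "((\<lambda>s. ip (z s) (eigfun n)) has_real_derivative ip (zt t) (eigfun n)) (at t within {0..})"
      using o by simp
    show "((\<lambda>s. ip (zt s) (eigfun n)) has_real_derivative (\<lambda>n t. ztt t (eigfun n)) n t) (at t within {0..})"
      using C1_dual4_eval(1)[OF H(3) eigfun_smooth_BC t, of n] by (simp add: emb_L2_def)
  next
    show "continuous_on {0..} ((\<lambda>n t. ztt t (eigfun n)) n)" for n
      unfolding continuous_on_def using C1_dual4_eval(2)[OF H(3) eigfun_smooth_BC] by simp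
  next
    have "AE t in lebesgue_on {0<..}. t \<in> {0<..}" by (rule AE_I2) simp
    with eq show "AE t in lebesgue_on {0<..}. \<forall>n\<ge>1. (\<lambda>n t. ztt t (eigfun n)) n t
        + (c1 + c2 * (omega n)\<^sup>2) * ip (zt t) (eigfun n)
        + (omega n)\<^sup>2 * ip (z t) (eigfun n) = bcoef xL xR n * u t + ip (w t) (eigfun n)"
    proof eventually_elim
      case (elim t)
      then have t: "t \<ge> 0" by simp
      show ?case
      proof (intro allI impI)
        fix n :: nat
        have "eigfun n \<in> H_BC 4" by (rule smooth_BC_H_BC[OF eigfun_smooth_BC])
        with elim(1) have "ztt t (eigfun n) + dxxxx (z t) (eigfun n) + c1 * emb_L2 (zt t) (eigfun n)
            + c2 * dxxxx (zt t) (eigfun n)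
           = (delta' xL (eigfun n) - delta' xR (eigfun n)) * u t + emb_L2 (w t) (eigfun n)" by blast
        then show "(\<lambda>n t. ztt t (eigfun n)) n t + (c1 + c2 * (omega n)\<^sup>2) * ip (zt t) (eigfun n)
          + (omega n)\<^sup>2 * ip (z t) (eigfun n) = bcoef xL xR n * u t + ip (w t) (eigfun n)"
          using w4[OF z(2)[OF t]] w4[OF z(3)[OF t]]
          by (simp add: dxxxx_def emb_L2_def delta'_eigfun_bcoef[OF x] algebra_simps)
      qed
    qed
  qed
qed

section \<open>Integrated dissipation inequalities\<close>

abbreviation Itime :: "real measure" where
  "Itime \<equiv> lebesgue_on {0<..}"

lemma continuous_truncated_integral:
  fixes f :: "real \<Rightarrow> real"
  assumes f: "continuous_on {0..} f" and T: "T \<ge> 0"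
  shows "integrable Itime (\<lambda>t. indicator {0<..<T} t * f t)"
    and "(f has_integral integral\<^sup>L Itime (\<lambda>t. indicator {0<..<T} t * f t)) {0..T}"
proof -
  have c: "continuous_on {0..T} f"
    by (rule continuous_on_subset[OF f]) auto
  have "f absolutely_integrable_on {0..T}"
    using absolutely_integrable_continuous[where a = 0 and b = T and f = f] c by simp
  then have "f absolutely_integrable_on {0<..<T}"
    using absolutely_integrable_on_open_interval[where f = f and a = 0 and b = T] by simp
  then have "integrable lebesgue (\<lambda>t. indicator {0<..<T} t * f t)"
    by (simp add: set_integrable_def)
  moreover have "(\<lambda>t. indicat_real {0<..<T} t * f t) = (\<lambda>t. indicator {0<..} t *\<^sub>R (indicator {0<..<T} t * f t))"
    by (auto simp: fun_eq_iff split: split_indicator)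
  ultimately have "integrable lebesgue (\<lambda>t. indicat_real {0<..} t *\<^sub>R (indicator {0<..<T} t * f t))"
    by simp
  then show int: "integrable Itime (\<lambda>t. indicator {0<..<T} t * f t)"
    by (subst integrable_restrict_space) auto
  have "((\<lambda>t. indicator {0<..<T} t * f t) has_integral integral\<^sup>L Itime (\<lambda>t. indicator {0<..<T} t * f t)) {0<..}"
    by (rule has_integral_integral_lebesgue_on[OF int]) simp
  then have "((\<lambda>t. if t \<in> {0<..<T} then f t else 0) has_integral integral\<^sup>L Itime (\<lambda>t. indicator {0<..<T} t * f t)) {0<..}"
    by (rule has_integral_eq[rotated]) auto
  moreover have "{0<..<T} \<subseteq> {0<..}" by auto
  ultimately have "(f has_integral integral\<^sup>L Itime (\<lambda>t. indicator {0<..<T} t * f t)) {0<..<T}"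
    by (simp only: has_integral_restrict)
  then show "(f has_integral integral\<^sup>L Itime (\<lambda>t. indicator {0<..<T} t * f t)) {0..T}"
    using has_integral_open_interval[of f _ 0 T] by simp
qed

text \<open>A storage function that starts at zero and stays nonnegative turns a pointwise dissipation inequality
  into an integral one on every finite horizon.\<close>

lemma dissipation_integral_bound:
  fixes V V' S W :: "real \<Rightarrow> real"
  assumes V: "\<And>t. t \<ge> 0 \<Longrightarrow> (V has_real_derivative V' t) (at t within {0..})"
    and V': "continuous_on {0..} V'" and S: "continuous_on {0..} S"
    and W: "integrable Itime W" "\<And>t. 0 \<le> W t"
    and diss: "AE t in Itime. S t + V' t \<le> W t"
    and V0: "V 0 = 0" and VT: "V T \<ge> 0" and T: "T \<ge> 0"
  shows "integral\<^sup>L Itime (\<lambda>t. indicator {0<..<T} t * S t) \<le> integral\<^sup>L Itime W"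
proof -
  have "(V' has_integral V T - V 0) {0..T}"
  proof (rule fundamental_theorem_of_calculus[OF T])
    fix t assume "t \<in> {0..T}"
    then have "(V has_real_derivative V' t) (at t within {0..T})"
      by (intro DERIV_subset[OF V[of t]]) auto
    then show "(V has_vector_derivative V' t) (at t within {0..T})"
      by (simp add: has_real_derivative_iff_has_vector_derivative)
  qed
  then have eq: "integral\<^sup>L Itime (\<lambda>t. indicator {0<..<T} t * V' t) = V T"
    using has_integral_unique[OF continuous_truncated_integral(2)[OF V' T]] V0 by simp
  have "integral\<^sup>L Itime (\<lambda>t. indicator {0<..<T} t * S t + indicator {0<..<T} t * V' t) \<le> integral\<^sup>L Itime W"
  proof (rule integral_mono_AE)
    show "integrable Itime (\<lambda>t. indicator {0<..<T} t * S t + indicator {0<..<T} t * V' t)"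
      by (intro Bochner_Integration.integrable_add continuous_truncated_integral(1) V' S T)
    show "AE t in Itime. indicator {0<..<T} t * S t + indicator {0<..<T} t * V' t \<le> W t"
      using diss by eventually_elim (use W(2) in \<open>auto split: split_indicator\<close>)
  qed (rule W(1))
  moreover have "integral\<^sup>L Itime (\<lambda>t. indicator {0<..<T} t * S t + indicator {0<..<T} t * V' t)
     = integral\<^sup>L Itime (\<lambda>t. indicator {0<..<T} t * S t) + V T"
    unfolding eq[symmetric]
    by (intro Bochner_Integration.integral_add continuous_truncated_integral(1) V' S T)
  ultimately show ?thesis using VT by simp
qed

text \<open>Truncating the \<open>j\<close>-th function to \<open>(0, j)\<close> makes the limits of many modes and of long times a single
  monotone limit with bounded integrals.\<close>

lemma monotone_limit_integrable:
  fixes S :: "nat \<Rightarrow> real \<Rightarrow> real"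
  assumes S: "\<And>j. continuous_on {0..} (S j)" "\<And>j t. t > 0 \<Longrightarrow> 0 \<le> S j t"
    and mono: "\<And>i j t. i \<le> j \<Longrightarrow> t > 0 \<Longrightarrow> S i t \<le> S j t"
    and lim: "\<And>t. t > 0 \<Longrightarrow> (\<lambda>j. S j t) \<longlonglongrightarrow> s t"
    and bound: "\<And>j T. T \<ge> 0 \<Longrightarrow> integral\<^sup>L Itime (\<lambda>t. indicator {0<..<T} t * S j t) \<le> I"
  shows "integrable Itime s" and "integral\<^sup>L Itime s \<le> I"
proof -
  define f where "f j t = indicator {0<..<real j} t * S j t" for j t
  have f: "integrable Itime (f j)" for j
    unfolding f_def[abs_def] by (rule continuous_truncated_integral(1)[OF S(1)]) simp
  have m: "mono (\<lambda>j. f j t)" if "t > 0" for t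
    by (rule monoI) (use S(2)[OF that] mono[OF _ that] in \<open>auto simp: f_def split: split_indicator\<close>)
  have AEpos: "AE t in Itime. P t" if "\<And>t. t > 0 \<Longrightarrow> P t" for P
    by (rule AE_I2) (use that in simp)
  have l: "(\<lambda>j. f j t) \<longlonglongrightarrow> s t" if "t > 0" for t
  proof (rule Lim_transform_eventually[OF lim[OF that]])
    obtain j0 :: nat where "t < real j0" using reals_Archimedean2 by blast
    then have "S j t = f j t" if "j \<ge> j0" for j
      using that \<open>t > 0\<close> by (simp add: f_def)
    then show "\<forall>\<^sub>F j in sequentially. S j t = f j t"
      unfolding eventually_sequentially by blast
  qed
  have inc: "incseq (\<lambda>j. integral\<^sup>L Itime (f j))"
    by (intro monoI integral_mono_AE f AEpos) (use m in \<open>auto dest: monoD\<close>)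
  have le: "integral\<^sup>L Itime (f j) \<le> I" for j
    unfolding f_def[abs_def] by (rule bound) simp
  obtain L where L: "(\<lambda>j. integral\<^sup>L Itime (f j)) \<longlonglongrightarrow> L"
    using incseq_convergent[OF inc, of I] le by blast
  have meas: "s \<in> borel_measurable Itime"
    by (rule borel_measurable_LIMSEQ_real[of _ f]) (use l f in auto)
  note conv = integral_monotone_convergence_nonneg[OF f AEpos[OF m] AEpos AEpos[OF l] L meas]
  have nn: "0 \<le> f j t" if "t > 0" for j t using S(2)[OF that] by (simp add: f_def)
  show "integrable Itime s" by (rule conv(1)) (use nn in auto)
  have "integral\<^sup>L Itime s = L" by (rule conv(2)) (use nn in auto)
  also have "L \<le> I" by (rule LIMSEQ_le_const2[OF L]) (use le in blast)
  finally show "integral\<^sup>L Itime s \<le> I" .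
qed

lemma scalar_prod_mat_vec_sum:
  fixes P :: "real mat"
  assumes "P \<in> carrier_mat m m"
  shows "scalar_prod (Matrix.vec m \<eta>) (P *\<^sub>v Matrix.vec m \<xi>)
    = (\<Sum>i<m. \<Sum>j<m. P $$ (i, j) * (\<eta> i * \<xi> j))"
proof -
  have "scalar_prod (Matrix.vec m \<eta>) (P *\<^sub>v Matrix.vec m \<xi>)
      = (\<Sum>i<m. \<eta> i * (\<Sum>j<m. P $$ (i, j) * \<xi> j))"
    using assms by (auto simp: scalar_prod_def atLeast0LessThan intro!: sum.cong)
  then show ?thesis by (simp add: sum_distrib_left mult.left_commute)
qed

lemma quadratic_form_has_derivative:
  fixes P :: "real mat" and \<xi> \<eta> :: "nat \<Rightarrow> real \<Rightarrow> real"
  assumes P: "P \<in> carrier_mat m m" "transpose_mat P = P"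
    and d: "\<And>i. i < m \<Longrightarrow> (\<xi> i has_real_derivative \<eta> i t) (at t within T)"
  shows "((\<lambda>t. scalar_prod (Matrix.vec m (\<lambda>i. \<xi> i t)) (P *\<^sub>v Matrix.vec m (\<lambda>i. \<xi> i t)))
    has_real_derivative 2 * scalar_prod (Matrix.vec m (\<lambda>i. \<eta> i t)) (P *\<^sub>v Matrix.vec m (\<lambda>i. \<xi> i t)))
    (at t within T)"
proof -
  have sym: "P $$ (i, j) = P $$ (j, i)" if "i < m" "j < m" for i j
    using P that by (metis carrier_matD index_transpose_mat(1))
  have "((\<lambda>t. \<Sum>i<m. \<Sum>j<m. P $$ (i, j) * (\<xi> i t * \<xi> j t)) has_real_derivative
      (\<Sum>i<m. \<Sum>j<m. P $$ (i, j) * (\<eta> i t * \<xi> j t + \<eta> j t * \<xi> i t))) (at t within T)"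
    by (intro DERIV_sum DERIV_cmult DERIV_mult d) auto
  moreover have "(\<Sum>i<m. \<Sum>j<m. P $$ (i, j) * (\<eta> j t * \<xi> i t)) = (\<Sum>i<m. \<Sum>j<m. P $$ (i, j) * (\<eta> i t * \<xi> j t))"
    by (subst sum.swap) (auto intro!: sum.cong simp: sym)
  then have "(\<Sum>i<m. \<Sum>j<m. P $$ (i, j) * (\<eta> i t * \<xi> j t + \<eta> j t * \<xi> i t))
      = 2 * (\<Sum>i<m. \<Sum>j<m. P $$ (i, j) * (\<eta> i t * \<xi> j t))"
    by (simp add: distrib_left sum.distrib)
  ultimately show ?thesis
    unfolding scalar_prod_mat_vec_sum[OF P(1)] by simp
qed

section \<open>Storage functions along solutions and the gain bound\<close>

lemma mode_vec_append:
  "mode_vec N f @\<^sub>v mode_vec N g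
   = Matrix.vec (2 * N) (\<lambda>i. if i < N then f (i + 1) else g (i - N + 1))"
  by (intro eq_vecI) (auto simp: mode_vec_def)

lemma low_storage_has_derivative:
  fixes p q y :: "nat \<Rightarrow> real \<Rightarrow> real"
  assumes P: "P \<in> carrier_mat (2 * N) (2 * N)" "transpose_mat P = P"
    and p: "\<And>n. n \<ge> 1 \<Longrightarrow> (p n has_real_derivative q n t) (at t within T)"
    and q: "\<And>n. n \<ge> 1 \<Longrightarrow> (q n has_real_derivative y n t) (at t within T)"
  shows "((\<lambda>t. scalar_prod (mode_vec N (\<lambda>n. p n t) @\<^sub>v mode_vec N (\<lambda>n. q n t))
      (P *\<^sub>v (mode_vec N (\<lambda>n. p n t) @\<^sub>v mode_vec N (\<lambda>n. q n t)))) has_real_derivative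
     2 * scalar_prod (mode_vec N (\<lambda>n. q n t) @\<^sub>v mode_vec N (\<lambda>n. y n t))
      (P *\<^sub>v (mode_vec N (\<lambda>n. p n t) @\<^sub>v mode_vec N (\<lambda>n. q n t)))) (at t within T)"
proof -
  define \<xi> where "\<xi> i = (if i < N then p (i + 1) else q (i - N + 1))" for i
  define \<eta> where "\<eta> i = (if i < N then q (i + 1) else y (i - N + 1))" for i
  have \<xi>t: "\<xi> i t = (if i < N then p (i + 1) t else q (i - N + 1) t)"
    and \<eta>t: "\<eta> i t = (if i < N then q (i + 1) t else y (i - N + 1) t)" for i t
    by (auto simp: \<xi>_def \<eta>_def)
  have "(\<xi> i has_real_derivative \<eta> i t) (at t within T)" for i
    unfolding \<xi>_def \<eta>_def using p q by auto
  from quadratic_form_has_derivative[where \<xi> = \<xi> and \<eta> = \<eta>, OF P this]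
  show ?thesis
    unfolding mode_vec_append \<xi>t \<eta>t .
qed

lemma low_storage_rate_continuous:
  fixes p q y :: "nat \<Rightarrow> real \<Rightarrow> real"
  assumes P: "P \<in> carrier_mat (2 * N) (2 * N)"
    and c: "\<And>n. n \<ge> 1 \<Longrightarrow> continuous_on T (p n)" "\<And>n. n \<ge> 1 \<Longrightarrow> continuous_on T (q n)"
      "\<And>n. n \<ge> 1 \<Longrightarrow> continuous_on T (y n)"
  shows "continuous_on T (\<lambda>t. scalar_prod (mode_vec N (\<lambda>n. q n t) @\<^sub>v mode_vec N (\<lambda>n. y n t))
      (P *\<^sub>v (mode_vec N (\<lambda>n. p n t) @\<^sub>v mode_vec N (\<lambda>n. q n t))))"
proof -
  have i: "continuous_on T (\<lambda>t. if i < N then f (i + 1) t else g (i - N + 1) t)"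
    if "\<And>n. n \<ge> 1 \<Longrightarrow> continuous_on T (f n)" "\<And>n. n \<ge> 1 \<Longrightarrow> continuous_on T (g n)"
    for f g :: "nat \<Rightarrow> real \<Rightarrow> real" and i
    using that by (cases "i < N") auto
  show ?thesis
    unfolding mode_vec_append scalar_prod_mat_vec_sum[OF P] by (intro continuous_intros i c)
qed

lemma mode_storage_has_derivative:
  assumes "(p has_real_derivative q t) (at t within T)" "(q has_real_derivative y t) (at t within T)"
  shows "((\<lambda>t. mode_storage a k (p t) (q t)) has_real_derivative
     (2 * a * q t * y t + 2 * a * k * p t * q t
      + (if a\<^sup>2 \<le> 2 * k then a\<^sup>2 else 2 * k) * ((q t)\<^sup>2 + p t * y t))) (at t within T)"
  unfolding mode_storage_def
  by (rule derivative_eq_intros assms refl)+ (auto simp: power2_eq_square algebra_simps)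

text \<open>The storage of mode \<open>n\<close> is scaled by \<open>(1 + \<rho>\<^sub>x \<omega>\<^sub>n\<^sup>2) / g\<^sub>n\<close>, so that its gain term becomes the contribution
  of this mode to \<open>\<parallel>z\<parallel>\<^sup>2 + \<rho>\<^sub>x \<parallel>z\<^sub>x\<^sub>x\<parallel>\<^sup>2\<close>; \<open>\<rho>\<^sub>n u\<^sup>2 + \<gamma>\<^sup>2 w\<^sub>n\<^sup>2\<close> is what the scaled input costs.\<close>

lemma high_mode_dissipation:
  fixes p q y w u rx \<gamma> :: real
  assumes n: "n \<ge> 1" and rx: "rx \<ge> 0" and \<gamma>: "\<gamma> > 0" and den: "rho_den c1 c2 rx \<gamma> n > 0"
    and ode: "y + (c1 + c2 * (omega n)\<^sup>2) * q + (omega n)\<^sup>2 * p = bcoef xL xR n * u + w"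
  defines "a \<equiv> c1 + c2 * (omega n)\<^sup>2" and "k \<equiv> (omega n)\<^sup>2" and "\<kappa> \<equiv> 1 + rx * (omega n)\<^sup>2"
  shows "\<kappa> / mode_gain a k * (2 * a * q * y + 2 * a * k * p * q
      + (if a\<^sup>2 \<le> 2 * k then a\<^sup>2 else 2 * k) * (q\<^sup>2 + p * y)) + \<kappa> * p\<^sup>2
    \<le> rho c1 c2 xL xR rx \<gamma> n * u\<^sup>2 + \<gamma>\<^sup>2 * w\<^sup>2"
    and "0 \<le> \<kappa> / mode_gain a k"
proof -
  define g where "g = mode_gain a k"
  define D where "D = 2 * a * q * y + 2 * a * k * p * q
      + (if a\<^sup>2 \<le> 2 * k then a\<^sup>2 else 2 * k) * (q\<^sup>2 + p * y)"
  have \<kappa>: "\<kappa> > 0" using rx by (simp add: \<kappa>_def add_pos_nonneg)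
  have d: "g - \<kappa> / \<gamma>\<^sup>2 > 0" "rho_den c1 c2 rx \<gamma> n = g - \<kappa> / \<gamma>\<^sup>2"
    using den unfolding rho_den_mode_gain[OF n] g_def a_def k_def \<kappa>_def by auto
  have "\<kappa> / \<gamma>\<^sup>2 > 0" using \<kappa> \<gamma> by simp
  then have g: "g > 0" using d by linarith
  then show "0 \<le> \<kappa> / mode_gain a k" using \<kappa> by (simp add: g_def)
  have "\<kappa> / g * (D + g * p\<^sup>2) \<le> \<kappa> / g * (bcoef xL xR n * u + w)\<^sup>2"
    using mode_dissipation[of y a q k p] ode g \<kappa> unfolding D_def g_def a_def k_def
    by (intro mult_left_mono) auto
  also have "\<dots> \<le> (bcoef xL xR n)\<^sup>2 * \<kappa> / (g - \<kappa> / \<gamma>\<^sup>2) * u\<^sup>2 + \<gamma>\<^sup>2 * w\<^sup>2"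
    by (rule weighted_input_bound[OF \<gamma> \<kappa> d(1)])
  also have "(bcoef xL xR n)\<^sup>2 * \<kappa> / (g - \<kappa> / \<gamma>\<^sup>2) = rho c1 c2 xL xR rx \<gamma> n"
    unfolding rho_def d(2) \<kappa>_def ..
  also have "\<kappa> / g * (D + g * p\<^sup>2) = \<kappa> / g * D + \<kappa> * p\<^sup>2"
    using g by (simp add: distrib_left)
  finally show "\<kappa> / mode_gain a k * (2 * a * q * y + 2 * a * k * p * q
      + (if a\<^sup>2 \<le> 2 * k then a\<^sup>2 else 2 * k) * (q\<^sup>2 + p * y)) + \<kappa> * p\<^sup>2
    \<le> rho c1 c2 xL xR rx \<gamma> n * u\<^sup>2 + \<gamma>\<^sup>2 * w\<^sup>2"
    by (simp only: g_def D_def)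
qed

lemma sym_pos_def_nonneg:
  assumes "sym_pos_def m P" "v \<in> carrier_vec m"
  shows "0 \<le> scalar_prod v (P *\<^sub>v v)"
proof (cases "v = 0\<^sub>v m")
  case True
  have "P *\<^sub>v v \<in> carrier_vec m"
    using assms by (auto simp: sym_pos_def_def intro: mult_mat_vec_carrier)
  then show ?thesis using True by simp
next
  case False
  then show ?thesis using assms by (auto simp: sym_pos_def_def intro: less_imp_le)
qed

lemma vector_derivative_within_atLeast:
  assumes "(f has_real_derivative d) (at t within {0..})" "t \<ge> 0"
  shows "vector_derivative f (at t within {0..}) = d"
proof (rule vector_derivative_within)
  show "(f has_vector_derivative d) (at t within {0..})"
    using assms by (simp add: has_real_derivative_iff_has_vector_derivative)
  have "{t<..} \<subseteq> {0..}" using assms(2) by auto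
  from at_le[OF this, of t] have "at_right t \<le> at t within {0..}" .
  then have "at t within {0..} \<noteq> bot"
    using trivial_limit_at_right_real[of t] bot.extremum_uniqueI by metis
  then show "at t within {0..} \<noteq> bot" .
qed

lemma row_mat_vec_sum:
  "G \<in> carrier_mat 1 m \<Longrightarrow> vec_index (G *\<^sub>v Matrix.vec m \<xi>) 0 = (\<Sum>i<m. G $$ (0, i) * \<xi> i)"
  by (auto simp: scalar_prod_def atLeast0LessThan intro!: sum.cong)

theorem theorem1:
  fixes c1 c2 xL xR rx ru \<gamma> r :: real and N M :: nat
    and A B C E P :: "real mat" and R :: real
    and u :: "real \<Rightarrow> real" and w z zt :: "real \<Rightarrow> real \<Rightarrow> real"
    and J :: "real \<Rightarrow> real"
  assumes "c1 > 0" "c2 > 0" "c1 + c2 \<le> sqrt 2"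
    and "0 < xL" "xL < xR" "xR < pi"
    and "N \<ge> 1" "rx \<ge> 0" "ru \<ge> 0" "\<gamma> > 0"
  defines "M \<equiv> Mcut c1 c2 N"
    and "r \<equiv> ru + rho_inf c1 c2 xL xR rx \<gamma> N"
    and "A \<equiv> A_mat c1 c2 N" and "B \<equiv> B_mat xL xR N" and "C \<equiv> C_mat rx N" and "E \<equiv> E_mat N"
    and "R \<equiv> R_weight N r"
    and "u \<equiv> feedback N B P r z"
    and "J \<equiv> (\<lambda>t. (L2norm (z t))\<^sup>2 + rx * (L2norm (wd 2 (z t)))\<^sup>2 + ru * (u t)\<^sup>2
                   - \<gamma>\<^sup>2 * (L2norm (w t))\<^sup>2)"
  assumes "\<forall>n\<in>{N+1..M}. rho_den c1 c2 rx \<gamma> n > 0" "C_den rx \<gamma> M > 0"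
    and "sym_pos_def (2 * N) P"
    and "P * A + transpose_mat A * P
           - P * (inverse R \<cdot>\<^sub>m (B * transpose_mat B)
                   - inverse (\<gamma>\<^sup>2) \<cdot>\<^sub>m (E * transpose_mat E)) * P
           + transpose_mat C * C = 0\<^sub>m (2 * N) (2 * N)"
    and "bochner_L2 {0<..} L2 L2norm w" "H1_loc_dual4 (\<lambda>t. emb_L2 (w t))"
    and "beam_solution c1 c2 xL xR u w z zt"
    and "AE x in Ipi. z 0 x = 0" "AE x in Ipi. zt 0 x = 0"
  shows "integrable (lebesgue_on {0<..}) J \<and> integral\<^sup>L (lebesgue_on {0<..}) J \<le> 0"
proof -
  note hyps = assms(1-3) assms(4-6) assms(8,10) M_def[THEN meta_eq_to_obj_eq] assms(20,21)
  note rx = \<open>rx \<ge> 0\<close> and ru = \<open>ru \<ge> 0\<close> and \<gamma> = \<open>\<gamma> > 0\<close>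
  have r: "r \<ge> 0" using rho_inf_nonneg[OF hyps] ru by (simp add: r_def)
  have NM: "N \<le> M" by (simp add: M_def Mcut_def)
  have den: "rho_den c1 c2 rx \<gamma> n > 0" if "n > N" for n
    by (rule rho_den_pos[OF hyps that])
  have P: "P \<in> carrier_mat (2 * N) (2 * N)" "transpose_mat P = P"
    using assms(22) by (auto simp: sym_pos_def_def)
  define p where "p n t = ip (z t) (eigfun n)" for n t
  define q where "q n t = ip (zt t) (eigfun n)" for n t
  obtain y where dp: "\<And>n t. n \<ge> 1 \<Longrightarrow> t \<ge> 0 \<Longrightarrow> (p n has_real_derivative q n t) (at t within {0..})"
    and dq: "\<And>n t. n \<ge> 1 \<Longrightarrow> t \<ge> 0 \<Longrightarrow> (q n has_real_derivative y n t) (at t within {0..})"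
    and cy: "\<And>n. continuous_on {0..} (y n)"
    and ode: "AE t in Itime. \<forall>n\<ge>1. y n t + (c1 + c2 * (omega n)\<^sup>2) * q n t
       + (omega n)\<^sup>2 * p n t = bcoef xL xR n * u t + ip (w t) (eigfun n)"
  proof (rule beam_modes[OF assms(26) assms(4-6), folded p_def q_def], goal_cases)
    case (1 y)
    show ?case by (rule 1(1)[OF 1(2-5)])
  qed
  have cp: "continuous_on {0..} (p n)" if "n \<ge> 1" for n
    by (rule DERIV_continuous_on[OF dp[OF that]]) simp
  have cq: "continuous_on {0..} (q n)" if "n \<ge> 1" for n
    by (rule DERIV_continuous_on[OF dq[OF that]]) simp
  have init: "p n 0 = 0" "q n 0 = 0" for n
  proof -
    have "ip f (eigfun n) = 0" if "AE x in Ipi. f x = 0" for f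
      unfolding ip_def by (rule integral_eq_zero_AE) (use that in auto)
    then show "p n 0 = 0" "q n 0 = 0" using assms(27,28) by (auto simp: p_def q_def)
  qed
  have zH: "z t \<in> H_BC 2" if "t \<ge> 0" for t
    using assms(26) that by (auto simp: beam_solution_def cont_X_def)
  define X where "X t = mode_vec N (\<lambda>n. p n t) @\<^sub>v mode_vec N (\<lambda>n. q n t)" for t
  have Xc: "X t \<in> carrier_vec (2 * N)" for t
    unfolding X_def mult_2 by (intro append_carrier_vec mode_vec_carrier)
  have zN: "zN N z t = X t" if "t \<ge> 0" for t
    unfolding X_def mode_vec_append zN_def
  proof (intro arg_cong[where f = "Matrix.vec (2 * N)"] ext)
    fix i
    have "vector_derivative (p (i - N + 1)) (at t within {0..}) = q (i - N + 1) t"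
      by (rule vector_derivative_within_atLeast[OF dp that]) (use that in auto)
    then show "(if i < N then ip (z t) (eigfun (i + 1))
        else vector_derivative (\<lambda>s. ip (z s) (eigfun (i - N + 1))) (at t within {0..}))
      = (if i < N then p (i + 1) t else q (i - N + 1) t)"
      by (simp add: p_def[abs_def])
  qed
  have u: "u t = - inverse r * vec_index ((transpose_mat B * P) *\<^sub>v X t) 0" if "t \<ge> 0" for t
    unfolding u_def feedback_def zN[OF that] ..
  (* The feedback is a fixed linear combination of finitely many modal coordinates. *)
  have cu: "continuous_on {0..} u"
  proof -
    have "u t = - inverse r * (\<Sum>i<2*N. (transpose_mat B * P) $$ (0, i)
        * (if i < N then p (i + 1) t else q (i - N + 1) t))" if "t \<ge> 0" for t
      unfolding u[OF that] X_def mode_vec_append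
      by (subst row_mat_vec_sum[of _ "2 * N"]) (use P system_matrix_carriers(2)[of xL xR N] in \<open>auto simp: B_def\<close>)
    moreover have "continuous_on {0..} (\<lambda>t. if i < N then p (i + 1) t else q (i - N + 1) t)" for i
      using cp cq by (cases "i < N") auto
    then have "continuous_on {0..} (\<lambda>t. - inverse r * (\<Sum>i<2*N. (transpose_mat B * P) $$ (0, i)
        * (if i < N then p (i + 1) t else q (i - N + 1) t)))"
      by (intro continuous_intros)
    ultimately show ?thesis by (subst continuous_on_cong[OF refl]) auto
  qed
  define \<kappa> where "\<kappa> n = 1 + rx * (omega n)\<^sup>2" for n
  define a where "a n = c1 + c2 * (omega n)\<^sup>2" for n
  define k where "k n = (omega n)\<^sup>2" for n
  (* Turns the gain of a mode into its weight in the output. *)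
  define \<sigma> where "\<sigma> n = \<kappa> n / mode_gain (a n) (k n)" for n
  have \<kappa>: "\<kappa> n \<ge> 0" for n using rx by (simp add: \<kappa>_def)
  define S where "S K t = (\<Sum>n=1..K. \<kappa> n * (p n t)\<^sup>2) + ru * (u t)\<^sup>2" for K t
  define W where "W t = \<gamma>\<^sup>2 * (L2norm (w t))\<^sup>2" for t
  have W: "integrable Itime W" "\<And>t. 0 \<le> W t"
    using assms(24) by (auto simp: W_def[abs_def] bochner_L2_def)
  have wL: "AE t in Itime. w t \<in> L2"
    using assms(24) by (auto simp: bochner_L2_def elim: eventually_mono)
  have cS: "continuous_on {0..} (S K)" for K
    unfolding S_def[abs_def] by (intro continuous_intros cu cp) auto
  have bound: "integral\<^sup>L Itime (\<lambda>t. indicator {0<..<T} t * S K t) \<le> integral\<^sup>L Itime W"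
    if K: "K \<ge> M" and T: "T \<ge> 0" for K T
  proof (rule dissipation_integral_bound)
    let ?D = "\<lambda>n t. 2 * a n * q n t * y n t + 2 * a n * k n * p n t * q n t
        + (if (a n)\<^sup>2 \<le> 2 * k n then (a n)\<^sup>2 else 2 * k n) * ((q n t)\<^sup>2 + p n t * y n t)"
    (* Riccati storage of the controlled modes plus scaled oscillator storages up to mode K. *)
    let ?V = "\<lambda>t. scalar_prod (X t) (P *\<^sub>v X t)
        + (\<Sum>n=N+1..K. \<sigma> n * mode_storage (a n) (k n) (p n t) (q n t))"
    let ?V' = "\<lambda>t. 2 * scalar_prod (mode_vec N (\<lambda>n. q n t) @\<^sub>v mode_vec N (\<lambda>n. y n t)) (P *\<^sub>v X t)
        + (\<Sum>n=N+1..K. \<sigma> n * ?D n t)"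
    show "(?V has_real_derivative ?V' t) (at t within {0..})" if t: "t \<ge> 0" for t
      unfolding X_def
      by (intro DERIV_add low_storage_has_derivative P DERIV_sum DERIV_cmult mode_storage_has_derivative dp dq t)
         auto
    show "continuous_on {0..} ?V'"
      unfolding X_def
      by (intro continuous_intros low_storage_rate_continuous P cp cq cy) auto
    show "continuous_on {0..} (S K)" by (rule cS)
    show "integrable Itime W" "\<And>t. 0 \<le> W t" by (rule W)+
    show "?V 0 = 0"
    proof -
      have "X 0 = 0\<^sub>v (2 * N)"
        unfolding X_def mode_vec_append init by (intro eq_vecI) auto
      then have "scalar_prod (X 0) (P *\<^sub>v X 0) = 0" using P by simp
      then show ?thesis by (simp add: init mode_storage_def)
    qed
    have a: "a n > 0" for n using assms(1,2) by (simp add: a_def add_pos_nonneg)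
    have sig: "\<sigma> n \<ge> 0" if "n > N" for n
      using high_mode_dissipation(2)[OF _ rx \<gamma> den[OF that],
          where y = 0 and q = 0 and p = 0 and xL = 0 and xR = 0 and u = 0 and w = 0] that
      by (simp add: \<sigma>_def \<kappa>_def a_def k_def)
    show "?V T \<ge> 0"
      by (intro add_nonneg_nonneg sum_nonneg mult_nonneg_nonneg mode_storage_nonneg a sig
            sym_pos_def_nonneg[OF assms(22) Xc]) (auto simp: k_def omega_def)
    have AEpos: "AE t in Itime. t > 0" by (rule AE_I2) simp
    show "AE t in Itime. S K t + ?V' t \<le> W t"
      using ode wL AEpos
    proof eventually_elim
      case (elim t)
      then have t: "t \<ge> 0" by simp
      define \<omega> where "\<omega> n = ip (w t) (eigfun n)" for n
      have low: "2 * scalar_prod (mode_vec N (\<lambda>n. q n t) @\<^sub>v mode_vec N (\<lambda>n. y n t)) (P *\<^sub>v X t)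
          + (\<Sum>n=1..N. \<kappa> n * (p n t)\<^sup>2) + r * (u t)\<^sup>2 \<le> \<gamma>\<^sup>2 * (\<Sum>n=1..N. (\<omega> n)\<^sup>2)"
        unfolding X_def \<kappa>_def
        by (rule low_modes_dissipation[OF r rx \<gamma> assms(22)])
           (use assms(23) u[OF t] elim(1) in
             \<open>auto simp: A_def B_def C_def E_def R_def X_def \<omega>_def\<close>)
      have "(\<Sum>n=N+1..K. \<sigma> n * ?D n t + \<kappa> n * (p n t)\<^sup>2)
          \<le> (\<Sum>n=N+1..K. rho c1 c2 xL xR rx \<gamma> n * (u t)\<^sup>2 + \<gamma>\<^sup>2 * (\<omega> n)\<^sup>2)"
      proof (rule sum_mono)
        fix n assume "n \<in> {N+1..K}"
        then have n: "n > N" "n \<ge> 1" by auto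
        have o: "y n t + (c1 + c2 * (omega n)\<^sup>2) * q n t + (omega n)\<^sup>2 * p n t
            = bcoef xL xR n * u t + \<omega> n"
          using elim(1) n(2) by (simp add: \<omega>_def)
        show "\<sigma> n * ?D n t + \<kappa> n * (p n t)\<^sup>2 \<le> rho c1 c2 xL xR rx \<gamma> n * (u t)\<^sup>2 + \<gamma>\<^sup>2 * (\<omega> n)\<^sup>2"
          using high_mode_dissipation(1)[OF n(2) rx \<gamma> den[OF n(1)] o]
          unfolding \<sigma>_def \<kappa>_def a_def k_def .
      qed
      then have high: "(\<Sum>n=N+1..K. \<sigma> n * ?D n t) + (\<Sum>n=N+1..K. \<kappa> n * (p n t)\<^sup>2)
          \<le> (\<Sum>n=N+1..K. rho c1 c2 xL xR rx \<gamma> n) * (u t)\<^sup>2 + \<gamma>\<^sup>2 * (\<Sum>n=N+1..K. (\<omega> n)\<^sup>2)"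
        by (simp only: sum.distrib sum_distrib_left sum_distrib_right)
      have rho: "(\<Sum>n=N+1..K. rho c1 c2 xL xR rx \<gamma> n) * (u t)\<^sup>2
          \<le> rho_inf c1 c2 xL xR rx \<gamma> N * (u t)\<^sup>2"
        by (intro mult_right_mono sum_rho_le_rho_inf[OF hyps K]) simp
      have split: "(\<Sum>n=1..K. f n) = (\<Sum>n=1..N. f n) + (\<Sum>n=N+1..K. f n)" for f :: "nat \<Rightarrow> real"
        using NM K sum.ub_add_nat[of 1 N f "K - N"] by simp
      have "(\<Sum>n=1..K. (\<omega> n)\<^sup>2) \<le> (L2norm (w t))\<^sup>2"
        unfolding \<omega>_def L2norm_power2 by (rule Bessel_inequality[OF elim(2)])
      then have bessel: "\<gamma>\<^sup>2 * ((\<Sum>n=1..N. (\<omega> n)\<^sup>2) + (\<Sum>n=N+1..K. (\<omega> n)\<^sup>2)) \<le> W t"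
        unfolding split[symmetric] W_def by (intro mult_left_mono) auto
      (* The control cost of the first N modes splits into the cost in J and the reserve
         that covers the sum of the rho n. *)
      have req: "r * (u t)\<^sup>2 = ru * (u t)\<^sup>2 + rho_inf c1 c2 xL xR rx \<gamma> N * (u t)\<^sup>2"
        by (simp add: r_def distrib_right)
      show ?case
        using low high rho bessel unfolding S_def split[of "\<lambda>n. \<kappa> n * (p n t)\<^sup>2"] req distrib_left
        by linarith
    qed
  qed (rule T)
  define s where "s t = (L2norm (z t))\<^sup>2 + rx * (L2norm (wd 2 (z t)))\<^sup>2 + ru * (u t)\<^sup>2" for t
  (* Since kappa n = 1 + rx * omega n ^ 2, the limit combines Parseval's identities for z and z_xx. *)
  have lim: "(\<lambda>j. S (M + j) t) \<longlonglongrightarrow> s t" if "t > 0" for t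
  proof -
    have zt: "z t \<in> H_BC 2" using zH that by simp
    have "(\<lambda>K. (\<Sum>n=1..K. (p n t)\<^sup>2) + rx * (\<Sum>n=1..K. (omega n)\<^sup>2 * (p n t)\<^sup>2) + ru * (u t)\<^sup>2) \<longlonglongrightarrow> s t"
      unfolding s_def p_def by (intro tendsto_intros Parseval_H_BC[OF zt])
    moreover have "(\<Sum>n=1..K. (p n t)\<^sup>2) + rx * (\<Sum>n=1..K. (omega n)\<^sup>2 * (p n t)\<^sup>2) + ru * (u t)\<^sup>2 = S K t" for K
      by (simp add: S_def \<kappa>_def distrib_right sum.distrib sum_distrib_left mult.assoc)
    ultimately have "(\<lambda>K. S K t) \<longlonglongrightarrow> s t" by simp
    from LIMSEQ_ignore_initial_segment[OF this, of M] show ?thesis by (simp add: add.commute)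
  qed
  have Smono: "S (M + i) t \<le> S (M + j) t" if "i \<le> j" for i j t
    unfolding S_def by (intro add_right_mono sum_mono2) (use that \<kappa> in auto)
  have Spos: "0 \<le> S K t" for K t
    unfolding S_def by (intro add_nonneg_nonneg sum_nonneg mult_nonneg_nonneg \<kappa> ru) auto
  have s: "integrable Itime s" "integral\<^sup>L Itime s \<le> integral\<^sup>L Itime W"
    by (rule monotone_limit_integrable[where S = "\<lambda>j. S (M + j)" and s = s and I = "integral\<^sup>L Itime W"];
        use cS Spos Smono lim bound in auto)+
  have J: "J = (\<lambda>t. s t - W t)" by (simp add: J_def s_def W_def fun_eq_iff)
  show ?thesis unfolding J using s W(1) by simp
qed

end
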